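(* The following sets of maps in $\mathsf{dSet}^G$ generate the same hypersaturated class: (1) the generating $G$-inner horn inclusions $\Lambda^{Ge}[T]\to\Omega[T]$ for $T\in\Omega_G$ and $e\in\boldsymbol{E}^{\mathsf i}(T)$; (2) the $G$-inner horn inclusions $\Lambda^{E}[T]\to\Omega[T]$ for $T\in\Omega_G$ and $G$-subset $\emptyset\neq E\subseteq\boldsymbol{E}^{\mathsf i}(T)$; (3) the orbital $G$-inner horn inclusions $\Lambda^{E}_o[T]\to\Omega[T]$ for $T\in\Omega_G$ and $G$-subset $\emptyset\neq E\subseteq\boldsymbol{E}^{\mathsf i}(T)$; (4) the $G$-Segal core inclusions $Sc[T]\to\Omega[T]$ for $T\in\Omega_G$.
   Context: Throughout $G$ is a fixed finite group. TREES. $\Omega$ is the Moerdijk--Weiss category of finite rooted trees. Trees may have leaves (edges with no vertex on top) and stumps (edges topped by a vertex with no inputs). A tree $U$ freely generates a symmetric coloured operad in sets $\Omega(U)$, whose colours are the edges of $U$, with one generating operation $t_1\cdots t_n\to t$ for each vertex with input edges $t_1,\dots,t_n$ and output edge $t$; maps $U\to V$ in $\Omega$ are maps of coloured operads $\Omega(U)\to\Omega(V)$. $\boldsymbol{E}(U)$ is the set of edges and $\boldsymbol{E}^{\mathsf i}(U)$ the set of inner edges (neither root nor leaf). A face map is a map of $\Omega$ injective on edges; it is inner if it sends the root to the root and the leaves bijectively onto the leaves, and outer if it admits no factorization as a non-isomorphism inner face map followed by a face map. For $E\subseteq \boldsymbol{E}^{\mathsf i}(U)$, $U-E\to U$ is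 the inner face with edge set $\boldsymbol{E}(U)\setminus E$, obtained by composing operations along the edges in $E$. $G$-TREES. A forest is a finite disjoint union of trees; a map of forests assigns to each component a map of $\Omega$ into some component of the target. $\Omega_G$ is the category of forests with a $G$-action that is transitive on components, and $G$-equivariant maps. For $T\in\Omega_G$ with components $T_1,\dots,T_k$, $\boldsymbol{E}^{\mathsf i}(T)=\coprod_i\boldsymbol{E}^{\mathsf i}(T_i)$ (a $G$-set). A face of $T$ is a face map $U\to T_i$ in $\Omega$ for some $i$; $\mathsf{Face}(T)$ is the $G$-poset of faces up to isomorphism over $T$, ordered by factorization over $T$ (written $U\hookrightarrow V$). An orbital face of $T$ is a map $S\to T$ in $\Omega_G$ that is injective on edges; $\mathsf{Face}_o(T)$ is the poset of orbital faces up to isomorphism over $T$. For a $G$-subset $E\subseteq\boldsymbol{E}^{\mathsf i}(T)$, $T-E$ is the orbital face with components $T_i-E_i$, $E_i=E\cap\boldsymbol{E}^{\mathsf i}(T_i)$. DENDROIDAL SETS. $\mathsf{dSet}^G=\mathsf{Set}^{\Omega^{op}\times G}$ is the category of presheaves on $\Omega$ with a $G$-action. For $T\in\Omega_G$, $\Omega[T]=\Omega[T_1]\amalg\cdots\amalg\Omega[T_k]$ (representables) with its induced $G$-action; for a face or orbital face of $T$ we regard $\Omega[U]$, $\Omega[S]$ as subpresheaves of $\Omega[T]$. The boundary $\partial\Omega[T]$ is the union of $\Omega[U]$ over $U\in\mathsf{Face}(T)$ different from all $T_i$. For a $G$-subset $\emptyset\neq E\subseteq\boldsymbol{E}^{\mathsf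 i}(T)$: the $G$-inner horn $\Lambda^E[T]$ is the union of the $\Omega[U]$ over faces $U$ of $T$ (say of $T_i$) with $(T_i-E_i)\not\hookrightarrow U$; the orbital $G$-inner horn $\Lambda_o^E[T]$ is the union of the $\Omega[S]$ over $S\in\mathsf{Face}_o(T)$ with $(T-E)\not\hookrightarrow S$. The Segal core $Sc[T]$ is the union of the $\Omega[U]$ over outer faces $U$ of $T$ with no inner edges (i.e. single edges and single vertices). A class of maps is saturated if it is closed under pushouts, transfinite composition and retracts. Normal monomorphisms are the saturation of $\{\partial\Omega[T]\to\Omega[T]\colon T\in\Omega_G\}$. A class of normal monomorphisms is hypersaturated if it is saturated and, moreover, whenever $A\xrightarrow{f}B\xrightarrow{g}C$ are normal monomorphisms such that $f$ and $gf$ are in the class, then so is $g$. The hypersaturated class generated by a set of normal monomorphisms is the smallest hypersaturated class containing it. *)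

theory Defs
  imports "HOL-Library.FuncSet" "HOL-Library.Multiset" "HOL-Algebra.Group"
begin

section \<open>Trees\<close>

text \<open>
  Edges are taken from an infinite type, so that every finite rooted tree is isomorphic to one
  of the trees below and the trees form a small category.  A tree is given by its edges, its
  root and its vertices; a vertex is the pair of its set of inputs and its output.  Trees are not
  planar.  Leaves are edges that are not an output of a vertex, stumps are vertices without inputs.
\<close>

type_synonym edge = nat

definition next_edge :: "(edge set \<times> edge) set \<Rightarrow> (edge \<times> edge) set" where
  "next_edge V = {(s, t). \<exists>I. (I, t) \<in> V \<and> s \<in> I}"

definition is_tree :: "edge set \<times> edge \<times> (edge set \<times> edge) set \<Rightarrow> bool" where
  "is_tree = (\<lambda>(E, r, V).
     finite E \<and> r \<in> E \<and> V \<subseteq> Pow E \<times> E \<and>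
     (\<forall>I J t. (I, t) \<in> V \<and> (J, t) \<in> V \<longrightarrow> I = J) \<and>
     (\<forall>(I, t)\<in>V. r \<notin> I) \<and>
     (\<forall>e\<in>E - {r}. \<exists>!v. v \<in> V \<and> e \<in> fst v) \<and>
     (\<forall>e\<in>E. (e, r) \<in> (next_edge V)\<^sup>*))"

typedef tree = "{x. is_tree x}"
proof
  show "({0}, 0, {}) \<in> {x. is_tree x}"
    by (simp add: is_tree_def)
qed

definition edges :: "tree \<Rightarrow> edge set" where
  "edges U = fst (Rep_tree U)"

definition root :: "tree \<Rightarrow> edge" where
  "root U = fst (snd (Rep_tree U))"

definition verts :: "tree \<Rightarrow> (edge set \<times> edge) set" where
  "verts U = snd (snd (Rep_tree U))"

definition leaves :: "tree \<Rightarrow> edge set" where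
  "leaves U = {t \<in> edges U. \<forall>I. (I, t) \<notin> verts U}"

definition inner_edges :: "tree \<Rightarrow> edge set" where
  "inner_edges U = edges U - {root U} - leaves U"


section \<open>The category of trees\<close>

text \<open>
  The free symmetric coloured operad on a tree: \<open>operation U [t\<^sub>1, \<dots>, t\<^sub>n] t\<close> says that there is an
  operation with this profile.  The operations are generated by the vertices
  under units, operadic composition and the symmetric group actions.  An operation of the free
  operad is a subtree with a linear order on its leaves; a subtree of a tree is determined by its
  root and its leaves, so every profile carries at most one operation and the operad is the
  relation below.  Accordingly a map of operads is a map of colours that takes profiles of operations
  to profiles of operations.
\<close>

inductive operation :: "tree \<Rightarrow> edge list \<Rightarrow> edge \<Rightarrow> bool" for U :: tree where
  unit: "t \<in> edges U \<Longrightarrow> operation U [t] t"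
| vertex: "(set ts, t) \<in> verts U \<Longrightarrow> distinct ts \<Longrightarrow> operation U ts t"
| composition: "operation U ts t \<Longrightarrow> list_all2 (operation U) sss ts \<Longrightarrow> operation U (concat sss) t"
| symmetry: "operation U ts t \<Longrightarrow> mset ts' = mset ts \<Longrightarrow> operation U ts' t"

definition tree_maps :: "tree \<Rightarrow> tree \<Rightarrow> (edge \<Rightarrow> edge) set" where
  "tree_maps U V = {f \<in> edges U \<rightarrow>\<^sub>E edges V.
     \<forall>ts t. operation U ts t \<longrightarrow> operation V (map f ts) (f t)}"

text \<open>
  Maps are extensional functions; the identity of \<open>U\<close> is \<open>restrict id (edges U)\<close> and the composite of
  \<open>f \<in> tree_maps U V\<close> and \<open>g \<in> tree_maps V W\<close> is \<open>compose (edges U) g f\<close>.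
\<close>

definition tree_iso :: "tree \<Rightarrow> tree \<Rightarrow> (edge \<Rightarrow> edge) \<Rightarrow> bool" where
  "tree_iso U V f \<longleftrightarrow> f \<in> tree_maps U V \<and>
     (\<exists>g\<in>tree_maps V U. compose (edges U) g f = restrict id (edges U) \<and>
                       compose (edges V) f g = restrict id (edges V))"

definition face_map :: "tree \<Rightarrow> tree \<Rightarrow> (edge \<Rightarrow> edge) \<Rightarrow> bool" where
  "face_map U V f \<longleftrightarrow> f \<in> tree_maps U V \<and> inj_on f (edges U)"

definition inner_face_map :: "tree \<Rightarrow> tree \<Rightarrow> (edge \<Rightarrow> edge) \<Rightarrow> bool" where
  "inner_face_map U V f \<longleftrightarrow>
     face_map U V f \<and> f (root U) = root V \<and> bij_betw f (leaves U) (leaves V)"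

definition outer_face_map :: "tree \<Rightarrow> tree \<Rightarrow> (edge \<Rightarrow> edge) \<Rightarrow> bool" where
  "outer_face_map U V f \<longleftrightarrow> face_map U V f \<and>
     \<not> (\<exists>W i j. inner_face_map U W i \<and> \<not> tree_iso U W i \<and> face_map W V j \<and>
                f = compose (edges U) j i)"

text \<open>Factorization of \<open>f: U \<rightarrow> T\<close> through \<open>g: V \<rightarrow> T\<close> over \<open>T\<close>.\<close>

definition factors_through :: "tree \<Rightarrow> (edge \<Rightarrow> edge) \<Rightarrow> tree \<Rightarrow> (edge \<Rightarrow> edge) \<Rightarrow> bool" where
  "factors_through U f V g \<longleftrightarrow> (\<exists>h\<in>tree_maps U V. f = compose (edges U) g h)"

text \<open>
  The tree \<open>U - E\<close>, for a set \<open>E\<close> of inner edges.  Its vertices are the composites of vertices of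
  \<open>U\<close> along edges in \<open>E\<close>: the inputs of the vertex below \<open>t\<close> are the remaining edges from which \<open>t\<close> is
  reached by moving towards the root along edges in \<open>E\<close>.
\<close>

definition inputs_along :: "tree \<Rightarrow> edge set \<Rightarrow> edge \<Rightarrow> edge set" where
  "inputs_along U E t =
     {s \<in> edges U - E. (s, t) \<in> next_edge (verts U) O (Id_on E O next_edge (verts U))\<^sup>*}"

definition remove_edges :: "tree \<Rightarrow> edge set \<Rightarrow> tree" where
  "remove_edges U E = Abs_tree
     (edges U - E, root U, {(inputs_along U E t, t) | t. t \<in> edges U - E - leaves U})"

definition edges_inclusion :: "tree \<Rightarrow> edge set \<Rightarrow> edge \<Rightarrow> edge" where
  "edges_inclusion U E = restrict id (edges U - E)"

text \<open>
  The construction of \<open>U - E\<close> yields a tree, and its inclusion into \<open>U\<close> is an inner face map.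
\<close>

lemma tree_props:
  shows "finite (edges U)" "root U \<in> edges U" "verts U \<subseteq> Pow (edges U) \<times> edges U"
    "\<And>I J t. (I, t) \<in> verts U \<Longrightarrow> (J, t) \<in> verts U \<Longrightarrow> I = J"
    "\<And>I t. (I, t) \<in> verts U \<Longrightarrow> root U \<notin> I"
    "\<And>e. e \<in> edges U \<Longrightarrow> e \<noteq> root U \<Longrightarrow> \<exists>!v. v \<in> verts U \<and> e \<in> fst v"
    "\<And>e. e \<in> edges U \<Longrightarrow> (e, root U) \<in> (next_edge (verts U))\<^sup>*"
proof -
  have "is_tree (edges U, root U, verts U)"
    using Rep_tree[of U] by (simp add: edges_def root_def verts_def)
  note * = this[unfolded is_tree_def prod.case]
  show "finite (edges U)" "root U \<in> edges U" "verts U \<subseteq> Pow (edges U) \<times> edges U" using * by simp_all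
  show "I = J" if "(I, t) \<in> verts U" "(J, t) \<in> verts U" for I J t using * that by metis
  show "root U \<notin> I" if "(I, t) \<in> verts U" for I t using * that by fastforce
  show "\<exists>!v. v \<in> verts U \<and> e \<in> fst v" if "e \<in> edges U" "e \<noteq> root U" for e using * that by simp
  show "(e, root U) \<in> (next_edge (verts U))\<^sup>*" if "e \<in> edges U" for e using * that by simp
qed

lemma next_edge_fun:
  assumes "(s,t) \<in> next_edge (verts U)" "(s,t') \<in> next_edge (verts U)" shows "t = t'"
proof -
  obtain I J where I: "(I,t) \<in> verts U" "s \<in> I" and J: "(J,t') \<in> verts U" "s \<in> J"
    using assms by (auto simp: next_edge_def)
  then have "s \<in> edges U" "s \<noteq> root U" using tree_props(3)[of U] tree_props(5)[of _ _ U] by auto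
  then have "(I,t) = (J,t')" using tree_props(6)[of s U] I J by (metis fst_conv)
  then show ?thesis by simp
qed

lemma next_edge_edges:
  assumes "(s,t) \<in> next_edge (verts U)" shows "s \<in> edges U" "t \<in> edges U" "t \<notin> leaves U" "s \<noteq> root U"
  using assms tree_props(3)[of U] tree_props(5)[of _ _ U] by (auto simp: next_edge_def leaves_def)

definition climb :: "tree \<Rightarrow> edge set \<Rightarrow> (edge \<times> edge) set" where "climb U E = next_edge (verts U) O (Id_on E O next_edge (verts U))\<^sup>*"

lemma climb_step1: "(s,t) \<in> next_edge (verts U) \<Longrightarrow> (s,t) \<in> climb U E"
  by (auto simp: climb_def)
lemma climb_step: "(s,m) \<in> next_edge (verts U) \<Longrightarrow> m \<in> E \<Longrightarrow> (m,t) \<in> climb U E \<Longrightarrow> (s,t) \<in> climb U E"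
  unfolding climb_def
  by (smt (verit, best) Id_onI converse_rtrancl_into_rtrancl relcomp.simps)
lemma climb_cases: assumes "(s,t) \<in> climb U E"
  obtains "(s,t) \<in> next_edge (verts U)" | m where "(s,m) \<in> next_edge (verts U)" "m \<in> E" "(m,t) \<in> climb U E"
proof -
  obtain m where m: "(s,m) \<in> next_edge (verts U)" "(m,t) \<in> (Id_on E O next_edge (verts U))\<^sup>*"
    using assms unfolding climb_def by blast
  from m(2) show ?thesis
  proof (cases rule: converse_rtranclE)
    case base then show ?thesis using m that by auto
  next
    case (step y) then show ?thesis using m that(2)[of m] by (auto simp: climb_def)
  qed
qed

lemma climb_edges:
  assumes "(s,t) \<in> climb U E" shows "s \<in> edges U" "t \<in> edges U" "t \<notin> leaves U" "s \<noteq> root U"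
proof -
  show "s \<in> edges U" "s \<noteq> root U" using assms by (auto simp: climb_def dest: next_edge_edges)
  obtain m where "(m,t) \<in> (Id_on E O next_edge (verts U))\<^sup>*" "(s,m) \<in> next_edge (verts U)"
    using assms by (auto simp: climb_def)
  then show "t \<in> edges U" "t \<notin> leaves U"
    by (induction rule: rtrancl_induct) (auto dest: next_edge_edges)
qed

lemma edge_ind[consumes 1, case_names root step]:
  assumes "e \<in> edges U" and r: "P (root U)"
   and st: "\<And>s t. (s,t) \<in> next_edge (verts U) \<Longrightarrow> P t \<Longrightarrow> P s"
  shows "P e"
  using tree_props(7)[OF assms(1)]
  by (induction rule: converse_rtrancl_induct) (auto intro: r st)

lemma climb_ex: assumes "s \<in> edges U" "s \<noteq> root U" "E \<subseteq> inner_edges U"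
  shows "\<exists>t. t \<notin> E \<and> (s,t) \<in> climb U E"
proof -
  have "s \<noteq> root U \<longrightarrow> (\<exists>t. t \<notin> E \<and> (s,t) \<in> climb U E)"
    using assms(1)
  proof (induction rule: edge_ind)
    case root then show ?case by simp
  next
    case (step s t)
    show ?case
    proof (cases "t \<in> E")
      case True
      then have "t \<noteq> root U" using assms(3) by (auto simp: inner_edges_def)
      then show ?thesis using step True by (blast intro: climb_step)
    next
      case False then show ?thesis using step climb_step1 by blast
    qed
  qed
  then show ?thesis using assms by blast
qed

lemma climb_fun:
  assumes "s \<in> edges U" "(s,t) \<in> climb U E" "(s,t') \<in> climb U E" "t \<notin> E" "t' \<notin> E" shows "t = t'"
  using assms
proof (induction rule: edge_ind)
  case root then show ?case using climb_edges(4)[of "root U"] by blast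
next
  case (step s m)
  have *: "if m \<in> E then (m,x) \<in> climb U E else m = x" if x: "(s,x) \<in> climb U E" "x \<notin> E" for x
    using x(1)
  proof (cases rule: climb_cases)
    case 1
    then have "x = m" using step(1) next_edge_fun by blast
    then show ?thesis using x by simp
  next
    case (2 k)
    then have "k = m" using step(1) next_edge_fun by blast
    then show ?thesis using 2 by simp
  qed
  show ?case using *[of t] *[of t'] step by (auto split: if_splits)
qed

abbreviation "rem_data U E \<equiv> (edges U - E, root U, {(inputs_along U E t, t) | t. t \<in> edges U - E - leaves U})"

lemma inputs_along_climb: "s \<in> inputs_along U E t \<longleftrightarrow> s \<in> edges U \<and> s \<notin> E \<and> (s,t) \<in> climb U E"
  by (auto simp: inputs_along_def climb_def)

lemma remove_edges_is_tree:
  assumes E: "E \<subseteq> inner_edges U"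
  shows "is_tree (rem_data U E)"
proof -
  let ?V = "{(inputs_along U E t, t) | t. t \<in> edges U - E - leaves U}"
  have r: "root U \<notin> E" using E by (auto simp: inner_edges_def)
  have nx: "(s,t) \<in> next_edge ?V \<longleftrightarrow> s \<in> edges U - E \<and> t \<notin> E \<and> (s,t) \<in> climb U E" for s t
    using climb_edges[of s t U E] by (auto simp: next_edge_def inputs_along_climb)
  have 6: "\<exists>!v. v \<in> ?V \<and> e \<in> fst v" if e: "e \<in> edges U - E - {root U}" for e
  proof -
    obtain t where t: "t \<notin> E" "(e,t) \<in> climb U E" using climb_ex[of e U E] E e by auto
    then have "(inputs_along U E t, t) \<in> ?V \<and> e \<in> inputs_along U E t"
      using climb_edges[OF t(2)] e by (auto simp: inputs_along_climb)
    then show ?thesis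
      using e t by (intro ex1I[of _ "(inputs_along U E t, t)"]) (auto simp: inputs_along_climb dest: climb_fun)
  qed
  have reach: "(s \<notin> E \<longrightarrow> (s, root U) \<in> (next_edge ?V)\<^sup>*) \<and> (s \<in> E \<longrightarrow> (\<forall>t. t \<notin> E \<longrightarrow> (s,t) \<in> climb U E \<longrightarrow> (t, root U) \<in> (next_edge ?V)\<^sup>*))"
    if "s \<in> edges U" for s using that
  proof (induction rule: edge_ind)
    case root then show ?case using r by simp
  next
    case (step s m)
    have A: "(t, root U) \<in> (next_edge ?V)\<^sup>*" if t: "t \<notin> E" "(s,t) \<in> climb U E" for t
      using t(2)
    proof (cases rule: climb_cases)
      case 1 then show ?thesis using step t next_edge_fun[of s t U m] by auto
    next
      case (2 k) then show ?thesis using step t next_edge_fun[of s k U m] by auto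
    qed
    have s: "s \<in> edges U" "s \<noteq> root U" using step next_edge_edges by blast+
    obtain t where t: "t \<notin> E" "(s,t) \<in> climb U E" using climb_ex[OF s E] by auto
    have "s \<notin> E \<longrightarrow> (s,t) \<in> next_edge ?V" using nx s t by auto
    then show ?case using A t by (meson converse_rtrancl_into_rtrancl)
  qed
  have nr: "(root U, b) \<notin> climb U E" for b using climb_edges(4) by blast
  show ?thesis
    unfolding is_tree_def
    using tree_props[where U=U] r 6 reach nr
    by (auto simp: inputs_along_climb)
qed

lemma remove_edges_sel:
  assumes "E \<subseteq> inner_edges U"
  shows "edges (remove_edges U E) = edges U - E"
    "root (remove_edges U E) = root U"
    "verts (remove_edges U E) = {(inputs_along U E t, t) | t. t \<in> edges U - E - leaves U}"
  using Abs_tree_inverse[of "rem_data U E"] remove_edges_is_tree[OF assms]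
  by (simp_all add: remove_edges_def edges_def root_def verts_def)

lemma remove_edges_leaves:
  assumes E: "E \<subseteq> inner_edges U" shows "leaves (remove_edges U E) = leaves U"
  using E unfolding leaves_def[of "remove_edges U E"] remove_edges_sel[OF E]
  by (auto simp: inner_edges_def leaves_def)

lemma next_edge_acyclic: "acyclic (next_edge (verts U))"
proof -
  have "(s,s) \<notin> (next_edge (verts U))\<^sup>+" if "s \<in> edges U" for s using that
  proof (induction rule: edge_ind)
    case root then show ?case by (meson next_edge_edges(4) tranclD)
  next
    case (step s t)
    show ?case
    proof
      assume "(s,s) \<in> (next_edge (verts U))\<^sup>+"
      then obtain m where "(s,m) \<in> next_edge (verts U)" "(m,s) \<in> (next_edge (verts U))\<^sup>*" by (meson tranclD)
      then have "(t,s) \<in> (next_edge (verts U))\<^sup>*" using next_edge_fun step by metis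
      then have "(t,t) \<in> (next_edge (verts U))\<^sup>+" using step by (meson rtrancl_into_trancl1)
      then show False using step by simp
    qed
  qed
  then show ?thesis unfolding acyclic_def by (meson next_edge_edges(1) tranclD)
qed

lemma next_edge_wf: "wf (next_edge (verts U))"
proof (rule finite_acyclic_wf[OF _ next_edge_acyclic])
  show "finite (next_edge (verts U))"
    by (rule finite_subset[of _ "edges U \<times> edges U"]) (use next_edge_edges tree_props(1) in auto)
qed

lemma inputs_along_unfold:
  assumes E: "E \<subseteq> inner_edges U" and v: "(I,t) \<in> verts U"
  shows "inputs_along U E t = (\<Union>i\<in>I. if i \<in> E then inputs_along U E i else {i})" (is "?L = ?R")
proof
  have n: "(i,t) \<in> next_edge (verts U) \<longleftrightarrow> i \<in> I" for i
    unfolding next_edge_def using v tree_props(4)[OF v] by blast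
  have I: "I \<subseteq> edges U" using v tree_props(3)[of U] by auto
  have cl: "(s,t) \<in> climb U E \<Longrightarrow> s \<notin> E \<Longrightarrow> \<exists>i\<in>I. s = i \<or> (i \<in> E \<and> (s,i) \<in> climb U E)" for s
  proof -
    assume "(s,t) \<in> climb U E"
    then obtain m where m: "(s,m) \<in> next_edge (verts U)" "(m,t) \<in> (Id_on E O next_edge (verts U))\<^sup>*"
      unfolding climb_def by blast
    from m(2) show ?thesis
    proof (cases rule: rtranclE)
      case base then show ?thesis using n m by auto
    next
      case (step y) then show ?thesis using m n by (auto simp: climb_def)
    qed
  qed
  show "?L \<subseteq> ?R" using cl by (fastforce simp: inputs_along_climb)
  have "(s,i) \<in> climb U E \<Longrightarrow> i \<in> E \<Longrightarrow> i \<in> I \<Longrightarrow> (s,t) \<in> climb U E" for s i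
    unfolding climb_def using n[of i]
    by (smt (verit, best) Id_onI relcomp.simps rtrancl.rtrancl_into_rtrancl)
  then show "?R \<subseteq> ?L" using I n climb_step1 by (fastforce simp: inputs_along_climb split: if_splits)
qed

lemma operation_inputs_along:
  assumes E: "E \<subseteq> inner_edges U" and "t \<in> edges U" "t \<notin> leaves U" "set ts = inputs_along U E t" "distinct ts"
  shows "operation U ts t"
  using assms(2-)
proof (induction t arbitrary: ts rule: wf_induct[OF next_edge_wf[of U]])
  case (1 t)
  obtain I where v: "(I,t) \<in> verts U" using 1 by (auto simp: leaves_def)
  then have I: "I \<subseteq> edges U" "finite I" using tree_props(1,3)[of U] finite_subset by blast+
  obtain js where iis: "set js = I" "distinct js" using finite_distinct_list[OF I(2)] by auto
  define D where "D i = (if i \<in> E then inputs_along U E i else {i})" for i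
  have "finite (D i)" for i unfolding D_def using tree_props(1)[of U] by (auto simp: inputs_along_def)
  then have "\<forall>i. \<exists>l. set l = D i \<and> distinct l" using finite_distinct_list by blast
  then obtain l where l: "\<And>i. set (l i) = D i" "\<And>i. distinct (l i)" by metis
  have opi: "operation U (l i) i" if "i \<in> I" for i
  proof (cases "i \<in> E")
    case True
    then have "i \<in> edges U" "i \<notin> leaves U" using E by (auto simp: inner_edges_def)
    moreover have "(i,t) \<in> next_edge (verts U)" using v that by (auto simp: next_edge_def)
    ultimately show ?thesis using 1(1) l[of i] True by (auto simp: D_def)
  next
    case False
    then have "set (l i) = {i}" "distinct (l i)" using l[of i] by (auto simp: D_def)
    then have "l i = [i]" by (cases "l i"; cases "tl (l i)") auto
    then show ?thesis using I that operation.unit by auto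
  qed
  have op: "operation U (concat (map l js)) t"
    by (rule operation.composition[OF operation.vertex[of js]])
       (use iis v opi in \<open>auto simp: list_all2_map1 list_all2_same\<close>)
  have disj: "D i \<inter> D j = {}" if "i \<in> I" "j \<in> I" "i \<noteq> j" for i j
  proof -
    have ni: "(i,t) \<in> next_edge (verts U)" "(j,t) \<in> next_edge (verts U)" using v that by (auto simp: next_edge_def)
    have up: "x \<in> D i \<Longrightarrow> (x,i) \<in> (next_edge (verts U))\<^sup>*" for x i
    proof -
      have "Id_on E O next_edge (verts U) \<subseteq> next_edge (verts U)" by auto
      then have "climb U E \<subseteq> (next_edge (verts U))\<^sup>*"
        unfolding climb_def using rtrancl_mono by (smt (verit, best) converse_rtrancl_into_rtrancl relcomp.simps subrelI subsetD)
      then show "x \<in> D i \<Longrightarrow> (x,i) \<in> (next_edge (verts U))\<^sup>*" by (auto simp: D_def inputs_along_climb split: if_splits)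
    qed
    have sv: "single_valued (next_edge (verts U))" using next_edge_fun by (auto simp: single_valued_def)
    { fix x assume "x \<in> D i" "x \<in> D j"
      then have "(x,i) \<in> (next_edge (verts U))\<^sup>*" "(x,j) \<in> (next_edge (verts U))\<^sup>*" using up by auto
      then have "(i,j) \<in> (next_edge (verts U))\<^sup>* \<or> (j,i) \<in> (next_edge (verts U))\<^sup>*"
        using single_valued_confluent[OF sv] by blast
      then have "(i,j) \<in> (next_edge (verts U))\<^sup>+ \<or> (j,i) \<in> (next_edge (verts U))\<^sup>+" using that by (auto simp: rtrancl_eq_or_trancl)
      then have "(t,t) \<in> (next_edge (verts U))\<^sup>+"
        using ni next_edge_fun
        by (metis (no_types, lifting) rtrancl_into_trancl1 tranclD)
      then have False using next_edge_acyclic by (auto simp: acyclic_def) }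
    then show ?thesis by auto
  qed
  have "distinct (concat (map l js))"
    unfolding distinct_concat_iff
  proof (intro conjI)
    have "inj_on l {i \<in> I. l i \<noteq> []}"
      using disj l(1) by (intro inj_onI) (metis (mono_tags, lifting) inf.idem mem_Collect_eq set_empty)
    then show "distinct (removeAll [] (map l js))"
      using iis by (simp add: removeAll_filter_not_eq eq_commute[of "[]"] filter_map distinct_map o_def)
    show "\<forall>ys. ys \<in> set (map l js) \<longrightarrow> distinct ys" using l by auto
    show "\<forall>ys zs. ys \<in> set (map l js) \<and> zs \<in> set (map l js) \<and> ys \<noteq> zs \<longrightarrow> set ys \<inter> set zs = {}"
    proof (intro allI impI)
      fix ys zs assume "ys \<in> set (map l js) \<and> zs \<in> set (map l js) \<and> ys \<noteq> zs"
      then obtain i j where "i \<in> I" "j \<in> I" "ys = l i" "zs = l j" "i \<noteq> j" using iis by auto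
      then show "set ys \<inter> set zs = {}" using disj l by simp
    qed
  qed
  moreover have "set (concat (map l js)) = set ts"
    using inputs_along_unfold[OF E v] 1(4) iis l by (simp add: D_def)
  ultimately have "mset ts = mset (concat (map l js))"
    using 1(5) by (metis set_eq_iff_mset_eq_distinct)
  then show ?case using operation.symmetry[OF op] by blast
qed

lemma operation_remove_edges:
  assumes E: "E \<subseteq> inner_edges U" and "operation (remove_edges U E) ts t"
  shows "operation U ts t"
  using assms(2)
proof (induction rule: operation.induct)
  case (unit t) then show ?case using remove_edges_sel[OF E] operation.unit by auto
next
  case (vertex ts t) then show ?case using remove_edges_sel[OF E] operation_inputs_along[OF E] by auto
next
  case (composition ts t sss) then show ?case
    by (metis (mono_tags, lifting) list.rel_mono_strong operation.composition)
next
  case (symmetry ts t ts') then show ?case using operation.symmetry by blast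
qed

lemma operation_edges: "operation U ts t \<Longrightarrow> set ts \<subseteq> edges U \<and> t \<in> edges U"
proof (induction rule: operation.induct)
  case (composition ts t sss) then show ?case
    by (fastforce simp: list_all2_conv_all_nth in_set_conv_nth)
next
  case (symmetry ts t ts') then show ?case by (metis mset_eq_setD)
qed (use tree_props(3)[of U] in auto)

lemma remove_edges_inner_face:
  assumes E: "E \<subseteq> inner_edges U"
  shows "inner_face_map (remove_edges U E) U (edges_inclusion U E)"
proof -
  have "map (restrict id (edges U - E)) ts = ts" if "set ts \<subseteq> edges U - E" for ts
    using that by (induction ts) auto
  then have "edges_inclusion U E \<in> tree_maps (remove_edges U E) U"
    unfolding tree_maps_def edges_inclusion_def
    using operation_edges[of "remove_edges U E"] operation_remove_edges[OF E]
    by (auto simp: remove_edges_sel[OF E])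
  moreover have "leaves U \<subseteq> edges U - E" "root U \<in> edges U - E" using E tree_props(2)[of U] by (auto simp: leaves_def inner_edges_def)
  ultimately show ?thesis
    by (auto simp: inner_face_map_def face_map_def remove_edges_sel[OF E] remove_edges_leaves[OF E]
       edges_inclusion_def bij_betw_def inj_on_def image_iff subset_iff)
qed


section \<open>G-trees\<close>

text \<open>
  A forest is a set of trees with pairwise disjoint sets of edges.  Since the trees are disjoint and
  nonempty, a map of forests is determined by its effect on edges.  The values of \<open>gact T g\<close>
  outside the edges of \<open>T\<close> are irrelevant.
\<close>

record 'g gforest =
  comps :: "tree set"
  gact :: "'g \<Rightarrow> edge \<Rightarrow> edge"

definition forest_edges :: "'g gforest \<Rightarrow> edge set" where
  "forest_edges T = (\<Union>U\<in>comps T. edges U)"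

definition forest_inner_edges :: "'g gforest \<Rightarrow> edge set" where
  "forest_inner_edges T = (\<Union>U\<in>comps T. inner_edges U)"

definition forest_map :: "'g gforest \<Rightarrow> 'g gforest \<Rightarrow> (edge \<Rightarrow> edge) \<Rightarrow> bool" where
  "forest_map S T f \<longleftrightarrow>
     (\<forall>U\<in>comps S. \<exists>V\<in>comps T. restrict f (edges U) \<in> tree_maps U V)"

definition G_tree :: "('g, 'b) monoid_scheme \<Rightarrow> 'g gforest \<Rightarrow> bool" where
  "G_tree G T \<longleftrightarrow>
     finite (comps T) \<and> comps T \<noteq> {} \<and>
     (\<forall>U\<in>comps T. \<forall>V\<in>comps T. U \<noteq> V \<longrightarrow> edges U \<inter> edges V = {}) \<and>
     (\<forall>g\<in>carrier G. forest_map T T (gact T g)) \<and>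
     (\<forall>e\<in>forest_edges T. gact T \<one>\<^bsub>G\<^esub> e = e) \<and>
     (\<forall>g\<in>carrier G. \<forall>h\<in>carrier G. \<forall>e\<in>forest_edges T.
        gact T (g \<otimes>\<^bsub>G\<^esub> h) e = gact T g (gact T h e)) \<and>
     (\<forall>U\<in>comps T. \<forall>V\<in>comps T. \<exists>g\<in>carrier G. restrict (gact T g) (edges U) \<in> tree_maps U V)"

definition G_tree_map ::
    "('g, 'b) monoid_scheme \<Rightarrow> 'g gforest \<Rightarrow> 'g gforest \<Rightarrow> (edge \<Rightarrow> edge) \<Rightarrow> bool" where
  "G_tree_map G S T f \<longleftrightarrow> forest_map S T f \<and>
     (\<forall>g\<in>carrier G. \<forall>e\<in>forest_edges S. f (gact S g e) = gact T g (f e))"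

definition orbital_face ::
    "('g, 'b) monoid_scheme \<Rightarrow> 'g gforest \<Rightarrow> 'g gforest \<Rightarrow> (edge \<Rightarrow> edge) \<Rightarrow> bool" where
  "orbital_face G S T f \<longleftrightarrow>
     G_tree G S \<and> G_tree_map G S T f \<and> inj_on f (forest_edges S)"

definition G_stable :: "('g, 'b) monoid_scheme \<Rightarrow> 'g gforest \<Rightarrow> edge set \<Rightarrow> bool" where
  "G_stable G T E \<longleftrightarrow> (\<forall>g\<in>carrier G. gact T g ` E \<subseteq> E)"

definition edge_orbit :: "('g, 'b) monoid_scheme \<Rightarrow> 'g gforest \<Rightarrow> edge \<Rightarrow> edge set" where
  "edge_orbit G T e = {gact T g e | g. g \<in> carrier G}"

definition forest_remove_edges :: "'g gforest \<Rightarrow> edge set \<Rightarrow> 'g gforest" where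
  "forest_remove_edges T E =
     \<lparr>comps = {remove_edges U (E \<inter> inner_edges U) | U. U \<in> comps T}, gact = gact T\<rparr>"

text \<open>Factorization of the inclusion \<open>T - E \<rightarrow> T\<close> through \<open>f: S \<rightarrow> T\<close> over \<open>T\<close>.\<close>

definition removal_factors_through ::
    "('g, 'b) monoid_scheme \<Rightarrow> 'g gforest \<Rightarrow> edge set \<Rightarrow> 'g gforest \<Rightarrow> (edge \<Rightarrow> edge) \<Rightarrow> bool" where
  "removal_factors_through G T E S f \<longleftrightarrow>
     (\<exists>h. G_tree_map G (forest_remove_edges T E) S h \<and>
          (\<forall>e\<in>forest_edges (forest_remove_edges T E). f (h e) = e))"


section \<open>Dendroidal sets with an action\<close>

text \<open>
  \<open>res X U V f\<close> is the restriction \<open>X(V) \<rightarrow> X(U)\<close> along \<open>f: U \<rightarrow> V\<close>.  The values of \<open>res\<close> and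
  \<open>act\<close>, and of maps, outside their intended domains are irrelevant; equality of maps of dendroidal
  sets is equality on cells, and all closure conditions on classes of maps below are insensitive to
  the irrelevant values.
\<close>

record ('a, 'g) gdset =
  cells :: "tree \<Rightarrow> 'a set"
  res :: "tree \<Rightarrow> tree \<Rightarrow> (edge \<Rightarrow> edge) \<Rightarrow> 'a \<Rightarrow> 'a"
  act :: "'g \<Rightarrow> tree \<Rightarrow> 'a \<Rightarrow> 'a"

definition is_gdset :: "('g, 'b) monoid_scheme \<Rightarrow> ('a, 'g) gdset \<Rightarrow> bool" where
  "is_gdset G X \<longleftrightarrow>
     (\<forall>U V. \<forall>f\<in>tree_maps U V. res X U V f \<in> cells X V \<rightarrow> cells X U) \<and>
     (\<forall>U. \<forall>x\<in>cells X U. res X U U (restrict id (edges U)) x = x) \<and>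
     (\<forall>U V W. \<forall>f\<in>tree_maps U V. \<forall>g\<in>tree_maps V W. \<forall>x\<in>cells X W.
        res X U W (compose (edges U) g f) x = res X U V f (res X V W g x)) \<and>
     (\<forall>g\<in>carrier G. \<forall>U. act X g U \<in> cells X U \<rightarrow> cells X U) \<and>
     (\<forall>U. \<forall>x\<in>cells X U. act X \<one>\<^bsub>G\<^esub> U x = x) \<and>
     (\<forall>g\<in>carrier G. \<forall>h\<in>carrier G. \<forall>U. \<forall>x\<in>cells X U.
        act X (g \<otimes>\<^bsub>G\<^esub> h) U x = act X g U (act X h U x)) \<and>
     (\<forall>g\<in>carrier G. \<forall>U V. \<forall>f\<in>tree_maps U V. \<forall>x\<in>cells X V.
        act X g U (res X U V f x) = res X U V f (act X g V x))"

type_synonym 'a trans = "tree \<Rightarrow> 'a \<Rightarrow> 'a"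

definition is_gdmap ::
    "('g, 'b) monoid_scheme \<Rightarrow> ('a, 'g) gdset \<Rightarrow> ('a, 'g) gdset \<Rightarrow> 'a trans \<Rightarrow> bool" where
  "is_gdmap G X Y \<phi> \<longleftrightarrow> is_gdset G X \<and> is_gdset G Y \<and>
     (\<forall>U. \<phi> U \<in> cells X U \<rightarrow> cells Y U) \<and>
     (\<forall>U V. \<forall>f\<in>tree_maps U V. \<forall>x\<in>cells X V. \<phi> U (res X U V f x) = res Y U V f (\<phi> V x)) \<and>
     (\<forall>g\<in>carrier G. \<forall>U. \<forall>x\<in>cells X U. \<phi> U (act X g U x) = act Y g U (\<phi> U x))"

definition trans_eq :: "('a, 'g) gdset \<Rightarrow> 'a trans \<Rightarrow> 'a trans \<Rightarrow> bool" where
  "trans_eq X \<phi> \<psi> \<longleftrightarrow> (\<forall>U. \<forall>x\<in>cells X U. \<phi> U x = \<psi> U x)"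

definition trans_id :: "'a trans" where
  "trans_id = (\<lambda>U x. x)"

definition trans_comp :: "'a trans \<Rightarrow> 'a trans \<Rightarrow> 'a trans" where
  "trans_comp \<psi> \<phi> = (\<lambda>U x. \<psi> U (\<phi> U x))"

text \<open>An arrow is given by its source, the underlying map and its target.\<close>

type_synonym ('a, 'g) arrow = "('a, 'g) gdset \<times> 'a trans \<times> ('a, 'g) gdset"

definition gdarrows :: "('g, 'b) monoid_scheme \<Rightarrow> ('a, 'g) arrow set" where
  "gdarrows G = {(X, \<phi>, Y). is_gdmap G X Y \<phi>}"


section \<open>Saturated and hypersaturated classes\<close>

definition is_pushout ::
    "('g, 'b) monoid_scheme \<Rightarrow> ('a, 'g) gdset \<Rightarrow> ('a, 'g) gdset \<Rightarrow> ('a, 'g) gdset \<Rightarrow> ('a, 'g) gdset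
      \<Rightarrow> 'a trans \<Rightarrow> 'a trans \<Rightarrow> 'a trans \<Rightarrow> 'a trans \<Rightarrow> bool" where
  "is_pushout G A B C D f h k f' \<longleftrightarrow>
     is_gdmap G A B f \<and> is_gdmap G A C h \<and> is_gdmap G B D k \<and> is_gdmap G C D f' \<and>
     trans_eq A (trans_comp k f) (trans_comp f' h) \<and>
     (\<forall>Z p q. is_gdmap G B Z p \<and> is_gdmap G C Z q \<and> trans_eq A (trans_comp p f) (trans_comp q h) \<longrightarrow>
        (\<exists>m. is_gdmap G D Z m \<and> trans_eq B (trans_comp m k) p \<and> trans_eq C (trans_comp m f') q \<and>
          (\<forall>m'. is_gdmap G D Z m' \<and> trans_eq B (trans_comp m' k) p \<and> trans_eq C (trans_comp m' f') q
             \<longrightarrow> trans_eq D m' m)))"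

definition closed_pushouts :: "('g, 'b) monoid_scheme \<Rightarrow> ('a, 'g) arrow set \<Rightarrow> bool" where
  "closed_pushouts G K \<longleftrightarrow>
     (\<forall>A B C D f h k f'. is_pushout G A B C D f h k f' \<and> (A, f, B) \<in> K \<longrightarrow> (C, f', D) \<in> K)"

definition closed_retracts :: "('g, 'b) monoid_scheme \<Rightarrow> ('a, 'g) arrow set \<Rightarrow> bool" where
  "closed_retracts G K \<longleftrightarrow>
     (\<forall>X Y X' Y' f f' i r j s. (X, f, Y) \<in> K \<and> is_gdmap G X' Y' f' \<and>
        is_gdmap G X' X i \<and> is_gdmap G X X' r \<and> trans_eq X' (trans_comp r i) trans_id \<and>
        is_gdmap G Y' Y j \<and> is_gdmap G Y Y' s \<and> trans_eq Y' (trans_comp s j) trans_id \<and>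
        trans_eq X' (trans_comp f i) (trans_comp j f') \<and>
        trans_eq X (trans_comp f' r) (trans_comp s f)
        \<longrightarrow> (X', f', Y') \<in> K)"

text \<open>Diagrams indexed by the elements of a subset \<open>J\<close> of a well-order \<open>r\<close>, and their colimits.\<close>

definition is_chain ::
    "('g, 'b) monoid_scheme \<Rightarrow> 'i rel \<Rightarrow> ('i \<Rightarrow> ('a, 'g) gdset) \<Rightarrow> ('i \<Rightarrow> 'i \<Rightarrow> 'a trans) \<Rightarrow> bool" where
  "is_chain G r X \<phi> \<longleftrightarrow>
     (\<forall>i j. (i, j) \<in> r \<longrightarrow> is_gdmap G (X i) (X j) (\<phi> i j)) \<and>
     (\<forall>i\<in>Field r. trans_eq (X i) (\<phi> i i) trans_id) \<and>
     (\<forall>i j k. (i, j) \<in> r \<and> (j, k) \<in> r \<longrightarrow>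
        trans_eq (X i) (trans_comp (\<phi> j k) (\<phi> i j)) (\<phi> i k))"

definition is_cocone ::
    "('g, 'b) monoid_scheme \<Rightarrow> 'i rel \<Rightarrow> 'i set \<Rightarrow> ('i \<Rightarrow> ('a, 'g) gdset) \<Rightarrow> ('i \<Rightarrow> 'i \<Rightarrow> 'a trans)
      \<Rightarrow> ('a, 'g) gdset \<Rightarrow> ('i \<Rightarrow> 'a trans) \<Rightarrow> bool" where
  "is_cocone G r J X \<phi> L \<iota> \<longleftrightarrow>
     (\<forall>i\<in>J. is_gdmap G (X i) L (\<iota> i)) \<and>
     (\<forall>i\<in>J. \<forall>j\<in>J. (i, j) \<in> r \<longrightarrow> trans_eq (X i) (trans_comp (\<iota> j) (\<phi> i j)) (\<iota> i))"

definition is_colimit ::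
    "('g, 'b) monoid_scheme \<Rightarrow> 'i rel \<Rightarrow> 'i set \<Rightarrow> ('i \<Rightarrow> ('a, 'g) gdset) \<Rightarrow> ('i \<Rightarrow> 'i \<Rightarrow> 'a trans)
      \<Rightarrow> ('a, 'g) gdset \<Rightarrow> ('i \<Rightarrow> 'a trans) \<Rightarrow> bool" where
  "is_colimit G r J X \<phi> L \<iota> \<longleftrightarrow> is_cocone G r J X \<phi> L \<iota> \<and>
     (\<forall>Z \<kappa>. is_gdset G Z \<and> is_cocone G r J X \<phi> Z \<kappa> \<longrightarrow>
        (\<exists>m. is_gdmap G L Z m \<and> (\<forall>i\<in>J. trans_eq (X i) (trans_comp m (\<iota> i)) (\<kappa> i)) \<and>
          (\<forall>m'. is_gdmap G L Z m' \<and> (\<forall>i\<in>J. trans_eq (X i) (trans_comp m' (\<iota> i)) (\<kappa> i))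
             \<longrightarrow> trans_eq L m' m)))"

text \<open>
  \<open>underS r j\<close> is the set of elements strictly below \<open>j\<close>, and \<open>j\<close> is the successor of \<open>i\<close> iff
  \<open>i\<close> is the largest element of it; it is a limit if \<open>underS r j\<close> is nonempty without largest element.
\<close>

definition is_succ :: "'i rel \<Rightarrow> 'i \<Rightarrow> 'i \<Rightarrow> bool" where
  "is_succ r i j \<longleftrightarrow> i \<in> underS r j \<and> (\<forall>k\<in>underS r j. (k, i) \<in> r)"

definition is_limit :: "'i rel \<Rightarrow> 'i \<Rightarrow> bool" where
  "is_limit r j \<longleftrightarrow> j \<in> Field r \<and> underS r j \<noteq> {} \<and> (\<forall>i. \<not> is_succ r i j)"

text \<open>
  The transfinite composition of a chain that is continuous at limits and
  whose successor steps lie in \<open>K\<close> is the map from its first term \<open>X z\<close> to its colimit \<open>L\<close>.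
\<close>

definition is_transfinite_composition ::
    "('g, 'b) monoid_scheme \<Rightarrow> ('a, 'g) arrow set \<Rightarrow> 'i rel
      \<Rightarrow> ('i \<Rightarrow> ('a, 'g) gdset) \<Rightarrow> ('i \<Rightarrow> 'i \<Rightarrow> 'a trans) \<Rightarrow> 'i \<Rightarrow> ('a, 'g) gdset \<Rightarrow> ('i \<Rightarrow> 'a trans) \<Rightarrow> bool"
  where
  "is_transfinite_composition G K r X \<phi> z L \<iota> \<longleftrightarrow>
     Well_order r \<and> is_chain G r X \<phi> \<and> z \<in> Field r \<and> underS r z = {} \<and>
     (\<forall>i j. j \<in> Field r \<and> is_succ r i j \<longrightarrow> (X i, \<phi> i j, X j) \<in> K) \<and>
     (\<forall>j. is_limit r j \<longrightarrow> is_colimit G r (underS r j) X \<phi> (X j) (\<lambda>i. \<phi> i j)) \<and>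
     is_colimit G r (Field r) X \<phi> L \<iota>"

text \<open>
  The dendroidal sets under consideration have their cells in a type \<open>'a\<close>, which plays the role of a
  universe.  Chains are indexed by well-orders with elements in \<open>'a set\<close>: this covers all ordinals of
  cardinality at most that of \<open>'a set\<close>, and for infinite \<open>'a\<close> longer chains of monomorphisms
  are eventually constant up to isomorphism.
\<close>

definition closed_transfinite :: "('g, 'b) monoid_scheme \<Rightarrow> ('a, 'g) arrow set \<Rightarrow> bool" where
  "closed_transfinite G K \<longleftrightarrow>
     (\<forall>(r :: 'a set rel) X \<phi> z L \<iota>.
        is_transfinite_composition G K r X \<phi> z L \<iota> \<longrightarrow> (X z, \<iota> z, L) \<in> K)"

definition saturated :: "('g, 'b) monoid_scheme \<Rightarrow> ('a, 'g) arrow set \<Rightarrow> bool" where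
  "saturated G K \<longleftrightarrow>
     K \<subseteq> gdarrows G \<and> closed_pushouts G K \<and> closed_transfinite G K \<and> closed_retracts G K"

definition saturation :: "('g, 'b) monoid_scheme \<Rightarrow> ('a, 'g) arrow set \<Rightarrow> ('a, 'g) arrow set" where
  "saturation G S = \<Inter>{K. saturated G K \<and> S \<subseteq> K}"


section \<open>Representables and their subpresheaves\<close>

text \<open>
  The cells of \<open>\<Omega>[T]\<close> over \<open>W\<close> are the maps from \<open>W\<close> to a component of \<open>T\<close>; these maps for different
  components are distinct because the components are disjoint and \<open>W\<close> has an edge.
  The universe of cells is \<open>(edge \<Rightarrow> edge) + 'u\<close> with \<open>'u\<close> arbitrary:
  the left summand contains the cells of \<open>\<Omega>[T]\<close>, the right summand makes the universe as large as desired.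
\<close>

type_synonym 'u cell = "(edge \<Rightarrow> edge) + 'u"

definition subrepresentable :: "'g gforest \<Rightarrow> (tree \<Rightarrow> (edge \<Rightarrow> edge) set) \<Rightarrow> ('u cell, 'g) gdset" where
  "subrepresentable T C =
     \<lparr>cells = (\<lambda>W. Inl ` C W),
      res = (\<lambda>V W f. map_sum (\<lambda>x. compose (edges V) x f) id),
      act = (\<lambda>g W. map_sum (\<lambda>x. compose (edges W) (gact T g) x) id)\<rparr>"

definition representable :: "'g gforest \<Rightarrow> ('u cell, 'g) gdset" where
  "representable T = subrepresentable T (\<lambda>W. \<Union>V\<in>comps T. tree_maps W V)"

text \<open>The image of \<open>\<Omega>[U]\<close> under \<open>f: U \<rightarrow> T\<close>.\<close>

definition face_cells :: "tree \<Rightarrow> (edge \<Rightarrow> edge) \<Rightarrow> tree \<Rightarrow> (edge \<Rightarrow> edge) set" where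
  "face_cells U f W = compose (edges W) f ` tree_maps W U"

definition boundary :: "'g gforest \<Rightarrow> ('u cell, 'g) gdset" where
  "boundary T = subrepresentable T (\<lambda>W.
     \<Union>{face_cells U f W | U V f. V \<in> comps T \<and> face_map U V f \<and> \<not> tree_iso U V f})"

definition inner_horn :: "'g gforest \<Rightarrow> edge set \<Rightarrow> ('u cell, 'g) gdset" where
  "inner_horn T E = subrepresentable T (\<lambda>W.
     \<Union>{face_cells U f W | U V f. V \<in> comps T \<and> face_map U V f \<and>
        \<not> factors_through (remove_edges V (E \<inter> inner_edges V))
            (edges_inclusion V (E \<inter> inner_edges V)) U f})"

definition orbital_inner_horn ::
    "('g, 'b) monoid_scheme \<Rightarrow> 'g gforest \<Rightarrow> edge set \<Rightarrow> ('u cell, 'g) gdset" where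
  "orbital_inner_horn G T E = subrepresentable T (\<lambda>W.
     \<Union>{face_cells U f W | U S f. orbital_face G S T f \<and> \<not> removal_factors_through G T E S f \<and>
        U \<in> comps S})"

definition segal_core :: "'g gforest \<Rightarrow> ('u cell, 'g) gdset" where
  "segal_core T = subrepresentable T (\<lambda>W.
     \<Union>{face_cells U f W | U V f. V \<in> comps T \<and> outer_face_map U V f \<and> inner_edges U = {}})"


section \<open>Normal monomorphisms and hypersaturation\<close>

definition normal_monos :: "('g, 'b) monoid_scheme \<Rightarrow> ('u cell, 'g) arrow set" where
  "normal_monos G = saturation G {(boundary T, trans_id, representable T) | T. G_tree G T}"

definition hypersaturated :: "('g, 'b) monoid_scheme \<Rightarrow> ('u cell, 'g) arrow set \<Rightarrow> bool" where
  "hypersaturated G K \<longleftrightarrow> K \<subseteq> normal_monos G \<and> saturated G K \<and>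
     (\<forall>A B C f g. (A, f, B) \<in> normal_monos G \<and> (B, g, C) \<in> normal_monos G \<and>
        (A, f, B) \<in> K \<and> (A, trans_comp g f, C) \<in> K \<longrightarrow> (B, g, C) \<in> K)"

definition hypersaturation ::
    "('g, 'b) monoid_scheme \<Rightarrow> ('u cell, 'g) arrow set \<Rightarrow> ('u cell, 'g) arrow set" where
  "hypersaturation G S = \<Inter>{K. hypersaturated G K \<and> S \<subseteq> K}"

definition generating_inner_horn_inclusions ::
    "('g, 'b) monoid_scheme \<Rightarrow> ('u cell, 'g) arrow set" where
  "generating_inner_horn_inclusions G =
     {(inner_horn T (edge_orbit G T e), trans_id, representable T) | T e.
        G_tree G T \<and> e \<in> forest_inner_edges T}"

definition inner_horn_inclusions :: "('g, 'b) monoid_scheme \<Rightarrow> ('u cell, 'g) arrow set" where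
  "inner_horn_inclusions G =
     {(inner_horn T E, trans_id, representable T) | T E.
        G_tree G T \<and> E \<noteq> {} \<and> E \<subseteq> forest_inner_edges T \<and> G_stable G T E}"

definition orbital_inner_horn_inclusions :: "('g, 'b) monoid_scheme \<Rightarrow> ('u cell, 'g) arrow set" where
  "orbital_inner_horn_inclusions G =
     {(orbital_inner_horn G T E, trans_id, representable T) | T E.
        G_tree G T \<and> E \<noteq> {} \<and> E \<subseteq> forest_inner_edges T \<and> G_stable G T E}"

definition segal_core_inclusions :: "('g, 'b) monoid_scheme \<Rightarrow> ('u cell, 'g) arrow set" where
  "segal_core_inclusions G = {(segal_core T, trans_id, representable T) | T. G_tree G T}"

end

theory Submission
  imports Defs "HOL-Library.Nat_Bijection"
begin

text \<open>
  The proof sorts the cells of \<open>\<Omega>[T]\<close> by the faces of \<open>T\<close>.  A face of a component \<open>V\<close> is recorded as a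
  pair \<open>(P, Q)\<close>: \<open>P\<close> is its set of edges, and \<open>Q\<close> is the set of non-leaf edges of its outer hull, that is, of
  the smallest subtree of \<open>V\<close> that contains it.  (Because of stumps, \<open>P\<close> alone does not determine the face.)
  A map into \<open>V\<close> factors through a face iff the pair of its image is contained componentwise in the
  pair of the face (\<open>face_cells_iff\<close>).  So subpresheaves of \<open>\<Omega>[T]\<close> that are generated by faces
  and stable under the group are the same as sieves of pairs, and the horns, the orbital horns, the boundary
  and the Segal core become explicit sieves.

  The heart of the matter is \<open>sieve_extension\<close>.  Let \<open>\<A> \<subseteq> \<B>\<close> be sieves, and let an equivariant choice
  assign to each hull \<open>Q\<close> a set \<open>\<epsilon> Q\<close> of edges such that for \<open>(P, Q)\<close> in \<open>\<B>\<close> but not in \<open>\<A>\<close>, deleting \<open>\<epsilon> Q\<close>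
  from \<open>P\<close> does not lead into \<open>\<A>\<close> and adding \<open>\<epsilon> Q\<close> does not lead out of \<open>\<B>\<close>.  Then the inclusion of \<open>\<A>\<close> into \<open>\<B>\<close>
  is a composite of pushouts of inner horn inclusions.  Indeed, take \<open>(P\<^sub>0, Q)\<close> in \<open>\<B>\<close> but not in \<open>\<A>\<close> with \<open>Q\<close>
  as small as possible and then \<open>P\<^sub>0\<close> as small as possible.  By minimality \<open>P\<^sub>0\<close> is disjoint from \<open>\<epsilon> Q\<close>,
  and a face of \<open>U = (P\<^sub>0 \<union> \<epsilon> Q, Q)\<close> lies outside \<open>\<A>\<close> iff it contains \<open>U - \<epsilon> Q\<close>;
  thus \<open>\<A>\<close> meets \<open>\<Omega>[U]\<close> in the horn of \<open>\<epsilon> Q\<close>.  The same computation shows that a cell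
  outside \<open>\<A>\<close> lies in at most one translate of \<open>U\<close>.  Hence all the translates are attached
  by a single pushout (\<open>attach_orbit\<close>), along the horn inclusion of the \<open>G\<close>-tree whose components are disjoint
  copies of the translates.  With \<open>\<epsilon> Q = {}\<close> the horns are boundaries, which shows that
  horn inclusions are normal monomorphisms.

  Now fix \<open>T\<close> and a nonempty stable set \<open>E\<close> of inner edges.  With \<open>\<epsilon> Q = E \<inter> Q\<close> one gets an extension
  \<open>X \<rightarrow> \<Lambda>\<^sup>E[T]\<close> for \<open>X = \<Lambda>\<^sup>E\<^sup>'[T]\<close> with \<open>E \<subseteq> E'\<close> and for \<open>X = \<Lambda>\<^sub>o\<^sup>E[T]\<close>; if \<open>E\<close> consists of all inner edges,
  the choice of \<open>\<epsilon> Q\<close> as \<open>Q\<close> without its root does the same for \<open>X = Sc[T]\<close>.  All horns that are attached belong to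
  \<open>G\<close>-trees with smaller components than \<open>T\<close>.  By induction on the size of \<open>T\<close>, a saturated class with the horns of
  orbits of edges contains all horns: compose \<open>\<Lambda>\<^sup>E[T] \<rightarrow> \<Lambda>\<^sup>G\<^sup>e[T] \<rightarrow> \<Omega>[T]\<close> for \<open>e \<in> E\<close>.  A saturated class with all horns contains
  \<open>X \<rightarrow> \<Lambda>\<^sup>E[T] \<rightarrow> \<Omega>[T]\<close>, so also the orbital horns and the Segal cores.  Conversely, if a
  hypersaturated class contains \<open>X \<rightarrow> \<Omega>[T]\<close> for orbital horns \<open>X\<close>, or for Segal cores, then by induction it
  contains \<open>X \<rightarrow> \<Lambda>\<^sup>E[T]\<close>, and by cancellation \<open>\<Lambda>\<^sup>E[T] \<rightarrow> \<Omega>[T]\<close>.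
\<close>

section \<open>The order of a tree and its operations\<close>

text \<open>
  The tree order, with the root as least element: \<open>below V t s\<close> says that the path from \<open>s\<close> to the root
  passes through \<open>t\<close>.
\<close>

definition below :: "tree \<Rightarrow> edge \<Rightarrow> edge \<Rightarrow> bool" where
  "below V t s \<longleftrightarrow> s \<in> edges V \<and> (s, t) \<in> (next_edge (verts V))\<^sup>*"

lemma below_edges:
  assumes "below V t s" shows "t \<in> edges V" "s \<in> edges V"
proof -
  show "s \<in> edges V" using assms by (simp add: below_def)
  have "(s, t) \<in> (next_edge (verts V))\<^sup>*" using assms by (simp add: below_def)
  then show "t \<in> edges V"
    using \<open>s \<in> edges V\<close> by (induction rule: rtrancl_induct) (auto dest: next_edge_edges)
qed

lemma below_refl [simp]: "t \<in> edges V \<Longrightarrow> below V t t"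
  by (simp add: below_def)

lemma below_trans [trans]: "below V r s \<Longrightarrow> below V s t \<Longrightarrow> below V r t"
  by (auto simp: below_def)

lemma below_antisym: "below V s t \<Longrightarrow> below V t s \<Longrightarrow> s = t"
  using next_edge_acyclic[of V] acyclic_impl_antisym_rtrancl unfolding below_def antisym_def by metis

lemma root_edges [simp]: "root V \<in> edges V"
  by (rule tree_props)

lemma below_root: "s \<in> edges V \<Longrightarrow> below V (root V) s"
  by (simp add: below_def tree_props(7))

lemma below_comparable:
  assumes "below V a s" "below V b s" shows "below V a b \<or> below V b a"
proof -
  have sv: "single_valued (next_edge (verts V))"
    using next_edge_fun by (auto simp: single_valued_def)
  show ?thesis
    using single_valued_confluent[OF sv, of s a b] assms below_edges[OF assms(1)] below_edges[OF assms(2)]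
    by (auto simp: below_def)
qed

lemma leaves_edges: "leaves V \<subseteq> edges V"
  by (auto simp: leaves_def)

lemma below_leaf: "l \<in> leaves V \<Longrightarrow> below V l s \<Longrightarrow> s = l"
  unfolding below_def by (meson next_edge_edges(3) rtranclE)

lemma vertex_edges: "(I, t) \<in> verts V \<Longrightarrow> I \<subseteq> edges V \<and> t \<in> edges V \<and> t \<notin> leaves V"
  using tree_props(3)[of V] by (auto simp: leaves_def)

lemma nonleaf_vertex: "t \<in> edges V \<Longrightarrow> t \<notin> leaves V \<Longrightarrow> \<exists>I. (I, t) \<in> verts V"
  by (auto simp: leaves_def)

lemma below_input:
  assumes "(I, t) \<in> verts V" "i \<in> I" shows "below V t i" "\<not> below V i t"
proof -
  have n: "(i, t) \<in> next_edge (verts V)" using assms by (auto simp: next_edge_def)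
  show "below V t i" using n next_edge_edges(1)[OF n] by (auto simp: below_def)
  show "\<not> below V i t"
    using rtrancl_into_trancl2[OF n] next_edge_acyclic[of V] unfolding below_def acyclic_def by metis
qed

lemma below_vertex:
  assumes v: "(I, t) \<in> verts V" and "below V t s"
  shows "s = t \<or> (\<exists>i\<in>I. below V i s)"
proof -
  have "(s, t) \<in> (next_edge (verts V))\<^sup>*" "s \<in> edges V" using assms by (auto simp: below_def)
  then show ?thesis
  proof (cases rule: rtranclE)
    case (step y)
    then obtain J where "(J, t) \<in> verts V" "y \<in> J" by (auto simp: next_edge_def)
    then have "y \<in> I" using tree_props(4)[OF v] by blast
    then show ?thesis using step \<open>s \<in> edges V\<close> by (auto simp: below_def)
  qed simp
qed

lemma inputs_antichain:
  assumes v: "(I, t) \<in> verts V" and "i \<in> I" "j \<in> I" "below V i j" shows "i = j"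
proof -
  have "(j, i) \<in> (next_edge (verts V))\<^sup>*" using assms by (auto simp: below_def)
  then show ?thesis
  proof (cases rule: converse_rtranclE)
    case (step y)
    have "(j, t) \<in> next_edge (verts V)" using v assms by (auto simp: next_edge_def)
    then have "y = t" using step next_edge_fun by blast
    then have "below V i t" using step vertex_edges[OF v] by (auto simp: below_def)
    then show ?thesis using below_input[OF v \<open>i \<in> I\<close>] by blast
  qed simp
qed

text \<open>
  The sets of inputs of the operations with output \<open>t\<close>: antichains above \<open>t\<close> that meet every path from a leaf
  above \<open>t\<close> down to \<open>t\<close>.  Branches that end in stumps need not be met; in particular
  \<open>{}\<close> is a cut above \<open>t\<close> if there are no leaves above \<open>t\<close>.
\<close>

definition cut :: "tree \<Rightarrow> edge \<Rightarrow> edge set \<Rightarrow> bool" where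
  "cut V t L \<longleftrightarrow> t \<in> edges V \<and> (\<forall>a\<in>L. below V t a) \<and> (\<forall>a\<in>L. \<forall>b\<in>L. below V a b \<longrightarrow> a = b) \<and>
     (\<forall>l\<in>leaves V. below V t l \<longrightarrow> (\<exists>a\<in>L. below V a l))"

lemma cut_edges: "cut V t L \<Longrightarrow> t \<in> edges V \<and> L \<subseteq> edges V"
  using below_edges by (auto simp: cut_def)

lemma cut_unit: "t \<in> edges V \<Longrightarrow> cut V t {t}"
  by (auto simp: cut_def)

lemma cut_vertex: "(I, t) \<in> verts V \<Longrightarrow> cut V t I"
  using vertex_edges[of I t V] below_input[of I t V] inputs_antichain[of I t V] below_vertex[of I t V]
  unfolding cut_def by blast

lemma cut_leaves: "cut V (root V) (leaves V)"
  unfolding cut_def using below_root[of _ V] leaves_edges[of V] below_leaf[of _ V] below_refl[of _ V]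
  by (metis root_edges subsetD)

lemma cut_restrict:
  assumes c: "cut V t L" and i: "below V t i" and n: "\<And>a. a \<in> L \<Longrightarrow> below V a i \<Longrightarrow> a = i"
  shows "cut V i {a \<in> L. below V i a}"
proof -
  have "\<exists>a\<in>L. below V i a \<and> below V a l" if l: "l \<in> leaves V" "below V i l" for l
  proof -
    obtain a where a: "a \<in> L" "below V a l"
      using c l below_trans[OF i l(2)] by (auto simp: cut_def)
    then show ?thesis using below_comparable[OF l(2) a(2)] n[OF a(1)] l by blast
  qed
  then show ?thesis using c below_edges[OF i] unfolding cut_def by blast
qed

lemma cut_compose:
  assumes c: "cut V t L" and d: "\<And>a. a \<in> L \<Longrightarrow> cut V a (M a)"
  shows "cut V t (\<Union>a\<in>L. M a)"
proof -
  have 1: "below V t b" if "a \<in> L" "b \<in> M a" for a b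
    using c d[OF that(1)] that by (meson cut_def below_trans)
  have 2: "b = b'" if "a \<in> L" "b \<in> M a" "a' \<in> L" "b' \<in> M a'" "below V b b'" for a b a' b'
  proof -
    have "below V a b'" "below V a' b'" using d that by (meson cut_def below_trans)+
    then have "a = a'" using below_comparable c that by (metis cut_def)
    then show ?thesis using d that by (auto simp: cut_def)
  qed
  have 3: "\<exists>a\<in>L. \<exists>b\<in>M a. below V b l" if "l \<in> leaves V" "below V t l" for l
    using c d that by (meson cut_def)
  show ?thesis using c 1 2 3 by (auto simp: cut_def)
qed

text \<open>
  Distinct elements of an antichain have nothing above them in common, because the elements below a given edge
  form a chain.
\<close>

lemma distinct_concat_fibres:
  assumes "list_all2 (\<lambda>ss s. distinct ss \<and> cut V s (set ss)) sss ts" "distinct ts"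
    and "\<And>a b. a \<in> set ts \<Longrightarrow> b \<in> set ts \<Longrightarrow> below V a b \<Longrightarrow> a = b"
  shows "distinct (concat sss) \<and> (\<forall>x\<in>set (concat sss). \<exists>s\<in>set ts. below V s x)"
  using assms
proof (induction rule: list_all2_induct)
  case (Cons ss sss s ts)
  then have IH: "distinct (concat sss)" "\<forall>x\<in>set (concat sss). \<exists>s\<in>set ts. below V s x" by auto
  have "x \<notin> set (concat sss)" if "x \<in> set ss" for x
  proof
    assume "x \<in> set (concat sss)"
    then obtain s' where s': "s' \<in> set ts" "below V s' x" using IH by blast
    have "below V s x" using Cons that by (auto simp: cut_def)
    then have "s = s'" using below_comparable[OF _ s'(2)] Cons.prems(2) s'(1) by (metis list.set_intros)
    then show False using s' Cons.prems by auto
  qed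
  then show ?case using IH Cons by (auto simp: cut_def)
qed simp

lemma cut_concat:
  assumes c: "cut V t (set ts)" "distinct ts"
    and d: "list_all2 (\<lambda>ss s. distinct ss \<and> cut V s (set ss)) sss ts"
  shows "cut V t (set (concat sss))"
proof -
  define n where "n = length ts"
  have len: "length sss = n" using d by (simp add: n_def list_all2_lengthD)
  have nth: "cut V (ts ! i) (set (sss ! i))" if "i < n" for i
    using d that by (auto simp: list_all2_conv_all_nth n_def)
  \<comment> \<open>The entries of the lists as a family indexed by the inputs themselves.\<close>
  define M where "M a = set (sss ! (THE i. i < n \<and> ts ! i = a))" for a
  have M: "M (ts ! i) = set (sss ! i)" if "i < n" for i
  proof -
    have "(THE j. j < n \<and> ts ! j = ts ! i) = i"
      using that c(2) by (auto simp: n_def nth_eq_iff_index_eq)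
    then show ?thesis by (simp add: M_def)
  qed
  have Mc: "cut V a (M a)" if "a \<in> set ts" for a
    using that nth M by (auto simp: in_set_conv_nth n_def)
  have "set (concat sss) = (\<Union>a\<in>set ts. M a)"
    using M len by (fastforce simp: in_set_conv_nth n_def set_conv_nth[of sss] set_conv_nth[of ts])
  then show ?thesis using cut_compose[OF c(1) Mc] by simp
qed

lemma operation_imp_cut: "operation V ts t \<Longrightarrow> distinct ts \<and> cut V t (set ts)"
proof (induction rule: operation.induct)
  case (unit t) then show ?case by (simp add: cut_unit)
next
  case (vertex ts t) then show ?case by (simp add: cut_vertex)
next
  case (composition ts t sss)
  have d: "list_all2 (\<lambda>ss s. distinct ss \<and> cut V s (set ss)) sss ts"
    by (rule list_all2_mono[OF composition(3)]) simp
  have ts: "cut V t (set ts)" "distinct ts" using composition(2) by auto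
  then have "a = b" if "a \<in> set ts" "b \<in> set ts" "below V a b" for a b
    using that unfolding cut_def by blast
  then have "distinct (concat sss)" using distinct_concat_fibres[OF d ts(2)] by blast
  then show ?case using cut_concat[OF ts d] by blast
next
  case (symmetry ts t ts') then show ?case by (metis mset_eq_imp_distinct_iff mset_eq_setD)
qed

text \<open>
  By well-founded induction from the top of the tree: unless \<open>t\<close> itself is the only input, the operation is the
  composite of the vertex with output \<open>t\<close> with the operations given by the parts of the cut above the inputs of
  this vertex.
\<close>

lemma cut_imp_operation: "cut V t (set ts) \<Longrightarrow> distinct ts \<Longrightarrow> operation V ts t"
proof (induction t arbitrary: ts rule: wf_induct[OF next_edge_wf[of V]])
  case (1 t)
  let ?L = "set ts"
  have t: "t \<in> edges V" using 1 cut_edges by blast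
  show ?case
  proof (cases "t \<in> ?L")
    case True
    then have "?L = {t}" using 1(2) by (auto simp: cut_def)
    then have "ts = [t]" using 1(3) by (cases ts; cases "tl ts") auto
    then show ?thesis using t by (simp add: operation.unit)
  next
    case tL: False
    have "t \<notin> leaves V" using 1(2) t tL below_antisym by (fastforce simp: cut_def)
    then obtain I where v: "(I, t) \<in> verts V" using nonleaf_vertex t by blast
    have I: "I \<subseteq> edges V" using vertex_edges v by blast
    then obtain js where js: "set js = I" "distinct js"
      using finite_distinct_list[of I] tree_props(1)[of V] finite_subset by blast
    define l where "l i = filter (\<lambda>a. below V i a) ts" for i
    have li: "cut V i (set (l i)) \<and> distinct (l i)" if i: "i \<in> I" for i
    proof -
      have "a = i" if a: "a \<in> ?L" "below V a i" for a
      proof -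
        have "below V t a" using 1(2) a by (auto simp: cut_def)
        then obtain j where j: "j \<in> I" "below V j a" using below_vertex[OF v] a tL by metis
        then have "below V j i" using a below_trans by blast
        then have "j = i" using inputs_antichain[OF v j(1) i] by simp
        then show ?thesis using below_antisym[OF a(2)] j(2) by simp
      qed
      then show ?thesis
        using cut_restrict[OF 1(2) below_input(1)[OF v i]] 1(3) by (simp add: l_def)
    qed
    have op: "operation V (l i) i" if "i \<in> I" for i
      using 1(1) v that li[OF that] by (auto simp: next_edge_def)
    have "operation V (concat (map l js)) t"
      by (rule operation.composition[OF operation.vertex[of js]])
         (use js v op in \<open>auto simp: list_all2_map1 list_all2_same\<close>)
    moreover have "mset ts = mset (concat (map l js))"
    proof -
      have "list_all2 (\<lambda>ss s. distinct ss \<and> cut V s (set ss)) (map l js) js"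
        using li js by (auto simp: list_all2_map1 list_all2_same)
      then have "distinct (concat (map l js))"
        using distinct_concat_fibres js inputs_antichain[OF v] by blast
      moreover have "set (concat (map l js)) = ?L"
      proof -
        have "\<exists>i\<in>I. below V i a" if "a \<in> ?L" for a
          using that 1(2) below_vertex[OF v, of a] tL by (auto simp: cut_def)
        then show ?thesis using js by (auto simp: l_def)
      qed
      ultimately show ?thesis using 1(3) by (metis set_eq_iff_mset_eq_distinct)
    qed
    ultimately show ?thesis using operation.symmetry by blast
  qed
qed

lemma operation_iff_cut: "operation V ts t \<longleftrightarrow> distinct ts \<and> cut V t (set ts)"
  using operation_imp_cut cut_imp_operation by blast

text \<open>
  Operations, and with them maps of trees, thus depend only on the order and the leaves of a tree.
\<close>

lemma tree_maps_iff_cut: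
  "f \<in> tree_maps U V \<longleftrightarrow> f \<in> edges U \<rightarrow>\<^sub>E edges V \<and>
     (\<forall>t L. cut U t L \<longrightarrow> inj_on f L \<and> cut V (f t) (f ` L))"
proof -
  have fin: "\<exists>ts. set ts = L \<and> distinct ts" if "cut U t L" for t L
    using cut_edges[OF that] finite_subset[OF _ tree_props(1)[of U]] finite_distinct_list[of L] by blast
  have "(\<forall>ts t. operation U ts t \<longrightarrow> operation V (map f ts) (f t)) \<longleftrightarrow>
      (\<forall>t L. cut U t L \<longrightarrow> inj_on f L \<and> cut V (f t) (f ` L))"
    unfolding operation_iff_cut distinct_map using fin by (metis set_map)
  then show ?thesis by (simp add: tree_maps_def)
qed

lemma antichain_extends_to_cut:
  assumes "t \<in> edges V" "\<And>b. b \<in> B \<Longrightarrow> below V t b" "\<And>a b. a \<in> B \<Longrightarrow> b \<in> B \<Longrightarrow> below V a b \<Longrightarrow> a = b"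
  shows "cut V t (B \<union> {l \<in> leaves V. below V t l \<and> (\<forall>b\<in>B. \<not> below V b l)})"
proof -
  have 1: "a = b" if "a \<in> B \<union> {l \<in> leaves V. below V t l \<and> (\<forall>b\<in>B. \<not> below V b l)}"
      "b \<in> B \<union> {l \<in> leaves V. below V t l \<and> (\<forall>b\<in>B. \<not> below V b l)}" "below V a b" for a b
    using that assms(3)[of a b] below_leaf[of a V b] by blast
  have 2: "\<exists>a\<in>B \<union> {l \<in> leaves V. below V t l \<and> (\<forall>b\<in>B. \<not> below V b l)}. below V a l"
    if "l \<in> leaves V" "below V t l" for l
    using that below_refl[OF below_edges(2)[OF that(2)]] by blast
  show ?thesis using assms(1,2) 1 2 unfolding cut_def by blast
qed

text \<open>
  For a cut \<open>L\<close> above \<open>t\<close>, the edges that are outputs of vertices of the subtree with root \<open>t\<close> and leaves \<open>L\<close>.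
\<close>

definition interior :: "tree \<Rightarrow> edge \<Rightarrow> edge set \<Rightarrow> edge set" where
  "interior V t L = {s. below V t s \<and> (\<forall>a\<in>L. \<not> below V a s)}"

context
  fixes W V :: tree and x :: "edge \<Rightarrow> edge"
  assumes x: "x \<in> tree_maps W V"
begin

lemma tree_map_edges: "a \<in> edges W \<Longrightarrow> x a \<in> edges V"
  using x by (auto simp: tree_maps_def)

lemma tree_map_cut: "cut W t L \<Longrightarrow> inj_on x L \<and> cut V (x t) (x ` L)"
  using x by (simp add: tree_maps_iff_cut)

lemma tree_map_mono: assumes "below W t a" shows "below V (x t) (x a)"
proof -
  have "cut W t ({a} \<union> {l \<in> leaves W. below W t l \<and> (\<forall>b\<in>{a}. \<not> below W b l)})"
    using assms below_edges by (intro antichain_extends_to_cut) auto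
  from tree_map_cut[OF this] show ?thesis by (auto simp: cut_def)
qed

text \<open>
  Two incomparable edges are part of a common cut, and the image of a cut is an antichain on which the map
  is injective.
\<close>

lemma tree_map_incomparable:
  assumes "a \<in> edges W" "b \<in> edges W" "\<not> below W a b" "\<not> below W b a"
  shows "\<not> below V (x a) (x b)"
proof
  assume ab: "below V (x a) (x b)"
  have c: "cut W (root W) ({a, b} \<union> {l \<in> leaves W. below W (root W) l \<and> (\<forall>c\<in>{a, b}. \<not> below W c l)})"
    using assms below_root by (intro antichain_extends_to_cut) auto
  have "x a = x b" using tree_map_cut[OF c] ab by (auto simp: cut_def)
  then have "a = b" using inj_onD[OF conjunct1[OF tree_map_cut[OF c]], of a b] by blast
  then show False using assms by simp
qed

lemma tree_map_reflects:
  assumes "inj_on x (edges W)" "a \<in> edges W" "b \<in> edges W" "below V (x a) (x b)"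
  shows "below W a b"
proof (cases "below W b a")
  case True
  then have "x a = x b" using tree_map_mono[OF True] below_antisym assms(4) by blast
  then have "a = b" using inj_onD[OF assms(1)] assms(2,3) by blast
  then show ?thesis using assms(2) by simp
next
  case False
  then show ?thesis using tree_map_incomparable[OF assms(2,3)] assms(4) by blast
qed

text \<open>
  An operation of \<open>W\<close> is a subtree of \<open>W\<close>, so its image is a subtree of the image of all of \<open>W\<close>.
\<close>

lemma interior_tree_map_mono:
  assumes c: "cut W t L"
  shows "interior V (x t) (x ` L) \<subseteq> interior V (x (root W)) (x ` leaves W)"
proof
  fix s assume s: "s \<in> interior V (x t) (x ` L)"
  have t: "t \<in> edges W" using cut_edges[OF c] by blast
  have ts: "below V (x t) s" and ns: "\<And>a. a \<in> L \<Longrightarrow> \<not> below V (x a) s"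
    using s by (auto simp: interior_def)
  have "below V (x (root W)) s" using tree_map_mono[OF below_root[OF t]] ts below_trans by blast
  moreover have "\<not> below V (x l) s" if l: "l \<in> leaves W" for l
  proof
    assume ls: "below V (x l) s"
    have le: "l \<in> edges W" using l leaves_edges by blast
    have nt: "\<not> below W t l"
    proof
      assume "below W t l"
      then obtain a where "a \<in> L" "below W a l" using c l by (auto simp: cut_def)
      then show False using tree_map_mono ls below_trans ns by blast
    qed
    then have "\<not> below W l t" using below_leaf l t below_refl by metis
    then show False
      using nt tree_map_incomparable le t below_comparable[OF ts ls] by blast
  qed
  ultimately show "s \<in> interior V (x (root W)) (x ` leaves W)" by (auto simp: interior_def)
qed

end

section \<open>Faces as pairs of sets of edges\<close>

lemma interior_edges: "interior V t L \<subseteq> edges V"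
  using below_edges by (auto simp: interior_def)

lemma interior_nonleaf: "cut V t L \<Longrightarrow> s \<in> interior V t L \<Longrightarrow> s \<notin> leaves V"
  using below_refl[OF below_edges(2)] unfolding interior_def cut_def by blast

lemma interior_disjoint: "cut V t L \<Longrightarrow> a \<in> L \<Longrightarrow> a \<notin> interior V t L"
  using cut_edges[of V t L] below_refl[of a V] unfolding interior_def by blast

lemma interior_leaves: "interior V (root V) (leaves V) = edges V - leaves V"
proof -
  have "s \<in> leaves V" if "a \<in> leaves V" "below V a s" for a s using below_leaf that by blast
  then show ?thesis using below_root[of _ V] below_refl[of _ V] below_edges(2)[of V] unfolding interior_def by blast
qed

text \<open>
  The pair of the edges of a face and the non-leaf edges of its outer hull.
\<close>

type_synonym face = "edge set \<times> edge set"

definition face_le :: "face \<Rightarrow> face \<Rightarrow> bool" where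
  "face_le F F' \<longleftrightarrow> fst F \<subseteq> fst F' \<and> snd F \<subseteq> snd F'"

lemma face_le_refl [simp]: "face_le F F" by (simp add: face_le_def)

lemma face_le_trans [trans]: "face_le F F' \<Longrightarrow> face_le F' F'' \<Longrightarrow> face_le F F''"
  by (auto simp: face_le_def)

definition face :: "tree \<Rightarrow> face \<Rightarrow> bool" where
  "face V F \<longleftrightarrow> (\<exists>t L. cut V t L \<and> snd F = interior V t L \<and> insert t L \<subseteq> fst F \<and> fst F \<subseteq> snd F \<union> L)"

definition image_face :: "tree \<Rightarrow> tree \<Rightarrow> (edge \<Rightarrow> edge) \<Rightarrow> face" where
  "image_face V W x = (x ` edges W, interior V (x (root W)) (x ` leaves W))"

definition top_face :: "tree \<Rightarrow> face" where
  "top_face V = (edges V, edges V - leaves V)"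

lemma faceE:
  assumes "face V (P, Q)"
  obtains t where "cut V t (P - Q)" "interior V t (P - Q) = Q" "t \<in> P"
proof -
  obtain t L where tL: "cut V t L" "Q = interior V t L" "insert t L \<subseteq> P" "P \<subseteq> Q \<union> L"
    using assms by (auto simp: face_def)
  then have "P - Q = L" using interior_disjoint[OF tL(1)] by blast
  then show ?thesis using that[of t] tL by auto
qed

lemma faceI: "cut V t (P - Q) \<Longrightarrow> interior V t (P - Q) = Q \<Longrightarrow> t \<in> P \<Longrightarrow> face V (P, Q)"
  unfolding face_def by (intro exI[of _ t] exI[of _ "P - Q"]) simp

lemma face_edges: "face V (P, Q) \<Longrightarrow> P \<subseteq> edges V \<and> Q \<subseteq> edges V - leaves V \<and> P \<noteq> {}"
proof (erule faceE)
  fix t assume t: "cut V t (P - Q)" "interior V t (P - Q) = Q" "t \<in> P"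
  have "Q \<subseteq> edges V" using interior_edges[of V t "P - Q"] t(2) by simp
  moreover have "s \<notin> leaves V" if "s \<in> Q" for s using interior_nonleaf[OF t(1)] that t(2) by simp
  moreover have "P - Q \<subseteq> edges V" using cut_edges[OF t(1)] by blast
  ultimately show ?thesis using t(3) by blast
qed

lemma face_root_below:
  assumes "cut V t (P - Q)" "interior V t (P - Q) = Q" "p \<in> P" "t \<in> P" shows "below V t p"
proof (cases "p \<in> Q")
  case True
  then show ?thesis using assms(2) unfolding interior_def by blast
next
  case False
  then show ?thesis using assms(1,3) unfolding cut_def by blast
qed

lemma face_root_in:
  assumes "cut V t (P - Q)" "interior V t (P - Q) = Q" "t \<in> P" "Q \<noteq> {}" shows "t \<in> Q"
proof (rule ccontr)
  assume "t \<notin> Q"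
  then have "t \<in> P - Q" using assms by blast
  then have "Q = {}" using assms(2) by (auto simp: interior_def)
  then show False using assms by simp
qed

lemma face_root_unique:
  assumes "cut V t (P - Q)" "interior V t (P - Q) = Q" "t \<in> P" 
    "cut V t' (P - Q)" "interior V t' (P - Q) = Q" "t' \<in> P"
  shows "t = t'"
  using face_root_below[OF assms(1,2,6,3)] face_root_below[OF assms(4,5,3,6)] by (rule below_antisym)

text \<open>
  The only edges of \<open>W\<close> that can be sent above the image of a leaf \<open>l\<close> are those below \<open>l\<close>,
  and then they are sent to the image of \<open>l\<close>.
\<close>

lemma image_face_face:
  assumes x: "x \<in> tree_maps W V"
  shows "face V (image_face V W x)"
proof -
  have c: "cut V (x (root W)) (x ` leaves W)" using tree_map_cut[OF x cut_leaves] by blast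
  have "x a \<in> interior V (x (root W)) (x ` leaves W) \<union> x ` leaves W" if a: "a \<in> edges W" for a
  proof (cases "\<exists>l\<in>leaves W. below V (x l) (x a)")
    case True
    then obtain l where l: "l \<in> leaves W" "below V (x l) (x a)" by blast
    have le: "l \<in> edges W" using l leaves_edges by blast
    have "x a = x l"
    proof (cases "below W a l \<or> below W l a")
      case True
      then show ?thesis using l below_leaf tree_map_mono[OF x] below_antisym by metis
    next
      case False
      then show ?thesis using tree_map_incomparable[OF x le a] l by blast
    qed
    then show ?thesis using l by blast
  next
    case False
    then show ?thesis using tree_map_mono[OF x below_root[OF a]] by (auto simp: interior_def)
  qed
  then have "x ` edges W \<subseteq> interior V (x (root W)) (x ` leaves W) \<union> x ` leaves W" by blast
  moreover have "insert (x (root W)) (x ` leaves W) \<subseteq> x ` edges W" using leaves_edges[of W] by auto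
  ultimately show ?thesis
    unfolding face_def image_face_def using c by (intro exI[of _ "x (root W)"] exI[of _ "x ` leaves W"]) simp
qed

text \<open>
  Factorization through a face is decided by the pairs.  The lift along \<open>f\<close> is forced on edges, and the point is
  that it takes cuts to cuts.  The image of a leaf of \<open>U\<close>
  that is missed by a lifted cut would lie in the interior of the image of \<open>x\<close>, hence in the interior of the image of
  \<open>f\<close>, which contains no images of leaves of \<open>U\<close>.
\<close>

lemma face_cells_iff:
  assumes f: "f \<in> tree_maps U V" "inj_on f (edges U)" and x: "x \<in> tree_maps W V"
  shows "x \<in> face_cells U f W \<longleftrightarrow> face_le (image_face V W x) (image_face V U f)"
proof
  assume "x \<in> face_cells U f W"
  then obtain y where y: "y \<in> tree_maps W U" and xy: "x = compose (edges W) f y" by (auto simp: face_cells_def)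
  have e: "x a = f (y a)" if "a \<in> edges W" for a using that by (simp add: xy compose_eq)
  have c: "cut U (y (root W)) (y ` leaves W)" using tree_map_cut[OF y cut_leaves] by blast
  have "x ` leaves W = f ` y ` leaves W" using e leaves_edges by force
  then have "interior V (x (root W)) (x ` leaves W) \<subseteq> interior V (f (root U)) (f ` leaves U)"
    using interior_tree_map_mono[OF f(1) c] e by simp
  moreover have "x ` edges W \<subseteq> f ` edges U" using e tree_map_edges[OF y] by auto
  ultimately show "face_le (image_face V W x) (image_face V U f)"
    by (auto simp: face_le_def image_face_def)
next
  assume le: "face_le (image_face V W x) (image_face V U f)"
  define y where "y = restrict (inv_into (edges U) f \<circ> x) (edges W)"
  have im: "x a \<in> f ` edges U" if "a \<in> edges W" for a
    using le that by (auto simp: face_le_def image_face_def)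
  have fy: "f (y a) = x a" "y a \<in> edges U" if "a \<in> edges W" for a
    using im[OF that] that by (auto simp: y_def f_inv_into_f inv_into_into)
  have ref: "below U (y a) (y b)" if "a \<in> edges W" "b \<in> edges W" "below V (x a) (x b)" for a b
    using tree_map_reflects[OF f(1,2), of "y a" "y b"] that fy by simp
  have inq: "\<not> below V (f l) s" if "s \<in> interior V (x (root W)) (x ` leaves W)" "l \<in> leaves U" for s l
    using le that by (auto simp: face_le_def image_face_def interior_def)
  have "inj_on y L \<and> cut U (y t) (y ` L)" if c: "cut W t L" for t L
  proof
    have L: "L \<subseteq> edges W" and t: "t \<in> edges W" using cut_edges[OF c] by auto
    have xc: "inj_on x L" "cut V (x t) (x ` L)" using tree_map_cut[OF x c] by auto
    show "inj_on y L" using xc(1) fy(1) L unfolding inj_on_def by (metis subsetD)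
    have "below U (y t) (y a)" if "a \<in> L" for a
      using ref[of t a] t L that xc(2) unfolding cut_def by blast
    moreover have "y a = y b" if "a \<in> L" "b \<in> L" "below U (y a) (y b)" for a b
    proof -
      have "below V (x a) (x b)" using tree_map_mono[OF f(1) that(3)] fy L that by (metis subsetD)
      then have "x a = x b" using xc(2) that unfolding cut_def by blast
      then have "a = b" using xc(1) that unfolding inj_on_def by blast
      then show ?thesis by simp
    qed
    moreover have "\<exists>a\<in>L. below U (y a) l" if l: "l \<in> leaves U" "below U (y t) l" for l
    proof (rule ccontr)
      assume no: "\<not> (\<exists>a\<in>L. below U (y a) l)"
      have le: "l \<in> edges U" using l leaves_edges by blast
      have tl: "below V (x t) (f l)" using tree_map_mono[OF f(1) l(2)] fy t by simp
      have "\<not> below V (x a) (f l)" if "a \<in> L" for a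
      proof
        assume "below V (x a) (f l)"
        then have "below U (y a) l" using tree_map_reflects[OF f(1,2), of "y a" l] fy L that le by auto
        then show False using no that by blast
      qed
      then have "f l \<in> interior V (x t) (x ` L)" using tl by (auto simp: interior_def)
      then have "f l \<in> interior V (x (root W)) (x ` leaves W)" using interior_tree_map_mono[OF x c] by blast
      then show False using inq[OF _ l(1)] below_refl[OF tree_map_edges[OF f(1) le]] by blast
    qed
    ultimately show "cut U (y t) (y ` L)" unfolding cut_def using fy(2)[OF t] by blast
  qed
  moreover have "y \<in> edges W \<rightarrow>\<^sub>E edges U" using fy by (auto simp: y_def)
  ultimately have "y \<in> tree_maps W U" by (simp add: tree_maps_iff_cut)
  moreover have "x = compose (edges W) f y"
  proof
    fix a show "x a = compose (edges W) f y a"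
    proof (cases "a \<in> edges W")
      case False
      then have "x a = undefined" using x by (auto simp: tree_maps_def)
      then show ?thesis using False by (simp add: compose_def)
    qed (simp add: fy compose_eq)
  qed
  ultimately show "x \<in> face_cells U f W" by (auto simp: face_cells_def)
qed

lemma factors_through_iff_face_cells: "factors_through U f V g \<longleftrightarrow> f \<in> face_cells V g U"
  by (auto simp: factors_through_def face_cells_def)

lemma tree_map_outside: "x \<in> tree_maps W V \<Longrightarrow> a \<notin> edges W \<Longrightarrow> x a = undefined"
  by (auto simp: tree_maps_def)

lemma tree_map_id: "restrict id (edges U) \<in> tree_maps U U"
  unfolding tree_maps_iff_cut
proof (intro conjI allI impI)
  fix t L assume "cut U t L"
  moreover from this have "t \<in> edges U" "restrict id (edges U) ` L = L" "inj_on (restrict id (edges U)) L"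
    using cut_edges[of U t L] by (auto simp: inj_on_def image_iff subset_iff)
  ultimately show "inj_on (restrict id (edges U)) L" "cut U (restrict id (edges U) t) (restrict id (edges U) ` L)"
    by simp_all
qed auto

lemma tree_map_compose:
  assumes f: "f \<in> tree_maps U V" and g: "g \<in> tree_maps V W"
  shows "compose (edges U) g f \<in> tree_maps U W"
  unfolding tree_maps_iff_cut
proof (intro conjI allI impI)
  show "compose (edges U) g f \<in> edges U \<rightarrow>\<^sub>E edges W"
    using tree_map_edges[OF f] tree_map_edges[OF g] by (auto simp: compose_def)
  fix t L assume c: "cut U t L"
  have e: "compose (edges U) g f a = g (f a)" if "a \<in> edges U" for a using that by (rule compose_eq)
  have 1: "inj_on f L" "cut V (f t) (f ` L)" using tree_map_cut[OF f c] by auto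
  have 2: "inj_on g (f ` L)" "cut W (g (f t)) (g ` f ` L)" using tree_map_cut[OF g 1(2)] by auto
  have t: "t \<in> edges U" and L: "L \<subseteq> edges U" using cut_edges[OF c] by auto
  have im: "compose (edges U) g f ` L = g ` f ` L" using e L by (force simp: image_iff)
  show "cut W (compose (edges U) g f t) (compose (edges U) g f ` L)" using 2 e[OF t] im by simp
  show "inj_on (compose (edges U) g f) L"
    using comp_inj_on[OF 1(1) 2(1)] e L by (auto simp: inj_on_def subset_iff)
qed

lemma image_face_id: "image_face V V (restrict id (edges V)) = top_face V"
proof -
  have "restrict id (edges V) ` leaves V = leaves V" using leaves_edges[of V] by (auto simp: image_iff subset_iff)
  then show ?thesis by (simp add: image_face_def top_face_def interior_leaves)
qed

lemma finite_below: "finite {u. below V u a}"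
  by (rule finite_subset[of _ "edges V"]) (auto dest: below_edges(1) simp: tree_props(1))

lemma finite_has_max_on:
  fixes h :: "'a \<Rightarrow> nat"
  assumes "finite D" "D \<noteq> {}" shows "\<exists>t\<in>D. \<forall>u\<in>D. h u \<le> h t"
proof -
  have "Max (h ` D) \<in> h ` D" using assms by simp
  then obtain t where "t \<in> D" "h t = Max (h ` D)" by auto
  then show ?thesis using assms by (metis Max_ge finite_imageI image_eqI)
qed

text \<open>
  The tree with edges \<open>P\<close>, order \<open>leq\<close> and non-leaf edges \<open>P \<inter> N\<close>: the inputs of the vertex with
  output \<open>t\<close> are the covers of \<open>t\<close>.
\<close>

definition poset_tree :: "edge set \<Rightarrow> edge \<Rightarrow> (edge \<Rightarrow> edge \<Rightarrow> bool) \<Rightarrow> edge set \<Rightarrow> tree" where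
  "poset_tree P r leq N = Abs_tree (P, r,
     {({s \<in> P. s \<noteq> t \<and> leq t s \<and> (\<forall>m\<in>P. leq t m \<longrightarrow> leq m s \<longrightarrow> m = t \<or> m = s)}, t) | t. t \<in> P \<inter> N})"

locale tree_order =
  fixes P :: "edge set" and r :: edge and leq :: "edge \<Rightarrow> edge \<Rightarrow> bool" and N :: "edge set"
  assumes finite_P: "finite P" and r_in: "r \<in> P"
    and refl: "a \<in> P \<Longrightarrow> leq a a"
    and trans: "a \<in> P \<Longrightarrow> b \<in> P \<Longrightarrow> c \<in> P \<Longrightarrow> leq a b \<Longrightarrow> leq b c \<Longrightarrow> leq a c"
    and antisym: "a \<in> P \<Longrightarrow> b \<in> P \<Longrightarrow> leq a b \<Longrightarrow> leq b a \<Longrightarrow> a = b"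
    and least: "a \<in> P \<Longrightarrow> leq r a"
    and chain: "a \<in> P \<Longrightarrow> b \<in> P \<Longrightarrow> c \<in> P \<Longrightarrow> leq a c \<Longrightarrow> leq b c \<Longrightarrow> leq a b \<or> leq b a"
    and nonmaximal: "a \<in> P \<Longrightarrow> b \<in> P \<Longrightarrow> leq a b \<Longrightarrow> a \<noteq> b \<Longrightarrow> a \<in> N"
begin

definition covers :: "edge \<Rightarrow> edge set" where
  "covers t = {s \<in> P. s \<noteq> t \<and> leq t s \<and> (\<forall>m\<in>P. leq t m \<longrightarrow> leq m s \<longrightarrow> m = t \<or> m = s)}"

definition vertices :: "(edge set \<times> edge) set" where
  "vertices = {(covers t, t) | t. t \<in> P \<inter> N}"

lemma covers_in: "s \<in> covers t \<Longrightarrow> s \<in> P \<and> s \<noteq> t \<and> leq t s"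
  by (simp add: covers_def)

lemma card_down:
  assumes "a \<in> P" "b \<in> P" "leq a b" "a \<noteq> b"
  shows "card {u \<in> P. leq u a} < card {u \<in> P. leq u b}"
proof (rule psubset_card_mono)
  show "{u \<in> P. leq u a} \<subset> {u \<in> P. leq u b}" using assms trans antisym refl by blast
qed (simp add: finite_P)

text \<open>
  The elements strictly below \<open>s\<close> form a finite chain; its largest element is found as the one with the most elements
  below it.
\<close>

lemma predecessor:
  assumes s: "s \<in> P" "s \<noteq> r"
  shows "\<exists>t\<in>P. s \<in> covers t"
proof -
  let ?D = "{t \<in> P. leq t s \<and> t \<noteq> s}"
  have "finite ?D" "?D \<noteq> {}" using finite_P r_in least s by auto
  from finite_has_max_on[OF this, of "\<lambda>t. card {u \<in> P. leq u t}"]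
  obtain t where t: "t \<in> ?D" and mx: "\<And>u. u \<in> ?D \<Longrightarrow> card {v \<in> P. leq v u} \<le> card {v \<in> P. leq v t}"
    by blast
  have "m = t" if "m \<in> P" "leq t m" "leq m s" "m \<noteq> s" for m
    using mx[of m] card_down[of t m] that t by fastforce
  then have "s \<in> covers t" using t s unfolding covers_def by blast
  then show ?thesis using t by blast
qed

lemma covers_unique: "t \<in> P \<Longrightarrow> t' \<in> P \<Longrightarrow> s \<in> covers t \<Longrightarrow> s \<in> covers t' \<Longrightarrow> t = t'"
  using chain[of t t' s] unfolding covers_def by blast

lemma next_edge_vertices: "(s, t) \<in> next_edge vertices \<longleftrightarrow> t \<in> P \<and> s \<in> covers t"
  using nonmaximal[of t s] covers_in[of s t] by (auto simp: next_edge_def vertices_def)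

lemma le_imp_next_edges: "a \<in> P \<Longrightarrow> b \<in> P \<Longrightarrow> leq a b \<Longrightarrow> (b, a) \<in> (next_edge vertices)\<^sup>*"
proof (induction "card {u \<in> P. leq u b}" arbitrary: b rule: less_induct)
  case less
  show ?case
  proof (cases "b = r")
    case True
    then show ?thesis using less antisym least r_in by (metis rtrancl.rtrancl_refl)
  next
    case False
    then obtain t where t: "t \<in> P" "b \<in> covers t" using predecessor less by blast
    then have tb: "leq t b" "t \<noteq> b" using covers_in by auto
    show ?thesis
    proof (cases "a = b")
      case False
      have "leq a t" using chain[OF less(2) t(1) less(3) less(4) tb(1)] t less(2,4) False refl
        unfolding covers_def by blast
      then have "(t, a) \<in> (next_edge vertices)\<^sup>*" using less(1)[of t] card_down[of t b] t tb less by blast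
      then show ?thesis using next_edge_vertices t by (meson converse_rtrancl_into_rtrancl)
    qed simp
  qed
qed

lemma next_edges_imp_le: "(b, a) \<in> (next_edge vertices)\<^sup>* \<Longrightarrow> b \<in> P \<Longrightarrow> a \<in> P \<and> leq a b"
proof (induction rule: rtrancl_induct)
  case (step y z)
  then show ?case using next_edge_vertices covers_in trans by blast
qed (simp add: refl)

lemma is_tree_vertices: "is_tree (P, r, vertices)"
  unfolding is_tree_def prod.case
proof (intro conjI)
  show "\<forall>(I, t)\<in>vertices. r \<notin> I"
    using covers_in[of r] least antisym[OF r_in] unfolding vertices_def by blast
  show "\<forall>e\<in>P - {r}. \<exists>!v. v \<in> vertices \<and> e \<in> fst v"
  proof
    fix e assume e: "e \<in> P - {r}"
    then obtain t where t: "t \<in> P" "e \<in> covers t" using predecessor by blast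
    then have "t \<in> N" using nonmaximal[of t e] covers_in[of e t] by blast
    show "\<exists>!v. v \<in> vertices \<and> e \<in> fst v"
    proof (rule ex1I[of _ "(covers t, t)"])
      show "(covers t, t) \<in> vertices \<and> e \<in> fst (covers t, t)"
        using t \<open>t \<in> N\<close> by (auto simp: vertices_def)
      fix v assume "v \<in> vertices \<and> e \<in> fst v"
      then obtain t' where t': "v = (covers t', t')" "t' \<in> P" "e \<in> covers t'" by (auto simp: vertices_def)
      then have "t' = t" using covers_unique[OF t'(2) t(1) t'(3) t(2)] by simp
      then show "v = (covers t, t)" using t' by simp
    qed
  qed
  show "\<forall>e\<in>P. (e, r) \<in> (next_edge vertices)\<^sup>*" using le_imp_next_edges[OF r_in _ least] by blast
  show "vertices \<subseteq> Pow P \<times> P" using covers_in by (auto simp: vertices_def)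
qed (use finite_P r_in in \<open>auto simp: vertices_def\<close>)

lemma poset_tree_sel:
  "edges (poset_tree P r leq N) = P" "root (poset_tree P r leq N) = r" "verts (poset_tree P r leq N) = vertices"
proof -
  have "poset_tree P r leq N = Abs_tree (P, r, vertices)"
    by (simp add: poset_tree_def vertices_def covers_def)
  then have "Rep_tree (poset_tree P r leq N) = (P, r, vertices)"
    using is_tree_vertices by (simp add: Abs_tree_inverse)
  then show "edges (poset_tree P r leq N) = P" "root (poset_tree P r leq N) = r"
    "verts (poset_tree P r leq N) = vertices" by (simp_all add: edges_def root_def verts_def)
qed

lemma poset_tree_leaves: "leaves (poset_tree P r leq N) = P - N"
  by (auto simp: leaves_def poset_tree_sel vertices_def)

lemma below_poset_tree: "below (poset_tree P r leq N) a b \<longleftrightarrow> a \<in> P \<and> b \<in> P \<and> leq a b"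
  using le_imp_next_edges next_edges_imp_le by (auto simp: below_def poset_tree_sel)

end

text \<open>
  The edges of a face are renamed so that different faces get disjoint sets of edges and so that the name of an edge
  remembers the face and the original edge.  Thus the inclusions of the copies into the forest, and the
  action on the copies, are functions of the names alone.
\<close>

definition label :: "face \<Rightarrow> edge \<Rightarrow> edge" where
  "label F p = prod_encode (prod_encode (set_encode (fst F), set_encode (snd F)), p)"

definition unlabel :: "edge \<Rightarrow> edge" where
  "unlabel e = snd (prod_decode e)"

definition label_face :: "edge \<Rightarrow> face" where
  "label_face e = map_prod set_decode set_decode (prod_decode (fst (prod_decode e)))"

lemma unlabel_label [simp]: "unlabel (label F p) = p"
  by (simp add: unlabel_def label_def)

lemma label_face_label: "finite (fst F) \<Longrightarrow> finite (snd F) \<Longrightarrow> label_face (label F p) = F"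
  by (simp add: label_face_def label_def)

lemma label_eq_iff [simp]: "label F p = label F q \<longleftrightarrow> p = q"
  by (simp add: label_def)

lemma inj_on_unlabel_label: "inj_on unlabel (label F ` P)"
  by (auto simp: inj_on_def)

text \<open>
  The tree of a face: the leaves are the edges of the face outside the interior \<open>snd F\<close> of its hull.
\<close>

definition face_tree :: "tree \<Rightarrow> face \<Rightarrow> tree" where
  "face_tree V F = poset_tree (label F ` fst F) (label F (THE t. t \<in> fst F \<and> (\<forall>p\<in>fst F. below V t p)))
     (\<lambda>a b. below V (unlabel a) (unlabel b)) (label F ` snd F)"

lemma face_tree_props:
  assumes F: "face V (P, Q)"
  shows face_tree_edges: "edges (face_tree V (P, Q)) = label (P, Q) ` P"
    and face_tree_leaves: "leaves (face_tree V (P, Q)) = label (P, Q) ` (P - Q)"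
    and face_tree_below: "below (face_tree V (P, Q)) (label (P, Q) a) (label (P, Q) b) \<longleftrightarrow>
      a \<in> P \<and> b \<in> P \<and> below V a b"
    and face_tree_root: "cut V t (P - Q) \<Longrightarrow> interior V t (P - Q) = Q \<Longrightarrow> t \<in> P \<Longrightarrow>
      root (face_tree V (P, Q)) = label (P, Q) t"
proof -
  obtain t0 where t0: "cut V t0 (P - Q)" "interior V t0 (P - Q) = Q" "t0 \<in> P" using faceE[OF F] by blast
  have PE: "P \<subseteq> edges V" using face_edges[OF F] by blast
  have below0: "below V t0 p" if "p \<in> P" for p using face_root_below[OF t0(1,2) that t0(3)] .
  have the: "(THE t. t \<in> P \<and> (\<forall>p\<in>P. below V t p)) = t0"
    using t0 below0 below_antisym by blast
  interpret tree_order "label (P, Q) ` P" "label (P, Q) t0" "\<lambda>a b. below V (unlabel a) (unlabel b)" "label (P, Q) ` Q"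
  proof
    show "finite (label (P, Q) ` P)" using PE tree_props(1)[of V] finite_subset by blast
    show "label (P, Q) t0 \<in> label (P, Q) ` P" using t0 by blast
    show "below V (unlabel a) (unlabel a)" if "a \<in> label (P, Q) ` P" for a using that PE by auto
    show "a = b" if "a \<in> label (P, Q) ` P" "b \<in> label (P, Q) ` P" "below V (unlabel a) (unlabel b)"
      "below V (unlabel b) (unlabel a)" for a b using that below_antisym by auto
    show "below V (unlabel (label (P, Q) t0)) (unlabel a)" if "a \<in> label (P, Q) ` P" for a
      using that below0 by auto
    show "a \<in> label (P, Q) ` Q" if ab: "a \<in> label (P, Q) ` P" "b \<in> label (P, Q) ` P"
      "below V (unlabel a) (unlabel b)" "a \<noteq> b" for a b
    proof -
      obtain p q where pq: "a = label (P, Q) p" "b = label (P, Q) q" "p \<in> P" "q \<in> P" using ab by blast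
      then have "below V p q" "p \<noteq> q" using ab by auto
      then have "p \<in> Q" using pq t0(1,2) unfolding cut_def interior_def by blast
      then show ?thesis using pq by blast
    qed
  next
    fix a b c
    show "below V (unlabel a) (unlabel b) \<Longrightarrow> below V (unlabel b) (unlabel c) \<Longrightarrow> below V (unlabel a) (unlabel c)"
      by (rule below_trans)
    show "below V (unlabel a) (unlabel c) \<Longrightarrow> below V (unlabel b) (unlabel c) \<Longrightarrow>
        below V (unlabel a) (unlabel b) \<or> below V (unlabel b) (unlabel a)"
      by (rule below_comparable)
  qed
  have ft: "face_tree V (P, Q) = poset_tree (label (P, Q) ` P) (label (P, Q) t0)
      (\<lambda>a b. below V (unlabel a) (unlabel b)) (label (P, Q) ` Q)"
    by (simp add: face_tree_def the)
  show "edges (face_tree V (P, Q)) = label (P, Q) ` P" by (simp add: ft poset_tree_sel)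
  show "leaves (face_tree V (P, Q)) = label (P, Q) ` (P - Q)"
    by (simp add: ft poset_tree_leaves) auto
  show "below (face_tree V (P, Q)) (label (P, Q) a) (label (P, Q) b) \<longleftrightarrow> a \<in> P \<and> b \<in> P \<and> below V a b"
    by (auto simp: ft below_poset_tree)
  show "root (face_tree V (P, Q)) = label (P, Q) t" if "cut V t (P - Q)" "interior V t (P - Q) = Q" "t \<in> P"
    using face_root_unique[OF that t0] by (simp add: ft poset_tree_sel)
qed

lemma face_tree_sel:
  assumes "face V F"
  shows "edges (face_tree V F) = label F ` fst F"
    and "leaves (face_tree V F) = label F ` (fst F - snd F)"
  using face_tree_edges[of V "fst F" "snd F"] face_tree_leaves[of V "fst F" "snd F"] assms by simp_all

definition face_inclusion :: "tree \<Rightarrow> face \<Rightarrow> edge \<Rightarrow> edge" where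
  "face_inclusion V F = restrict unlabel (edges (face_tree V F))"

text \<open>
  Every pair that satisfies \<open>face\<close> is the pair of an actual face map.  A cut of the face is a cut of \<open>V\<close>,
  because every leaf of \<open>V\<close> above the root of the face lies above a leaf of the face.
\<close>

lemma face_inclusion:
  assumes F: "face V F"
  shows face_inclusion_tree_map: "face_inclusion V F \<in> tree_maps (face_tree V F) V"
    and face_inclusion_inj: "inj_on (face_inclusion V F) (edges (face_tree V F))"
    and image_face_inclusion: "image_face V (face_tree V F) (face_inclusion V F) = F"
proof -
  obtain P Q where FPQ: "F = (P, Q)" by (cases F)
  note F' = F[unfolded FPQ]
  let ?U = "face_tree V (P, Q)" and ?l = "label (P, Q)"
  note E = face_tree_edges[OF F'] and Lv = face_tree_leaves[OF F']
  obtain t0 where t0: "cut V t0 (P - Q)" "interior V t0 (P - Q) = Q" "t0 \<in> P" using faceE[OF F'] by blast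
  have PE: "P \<subseteq> edges V" using face_edges[OF F'] by blast
  have k: "face_inclusion V (P, Q) (?l p) = p" if "p \<in> P" for p
    using that by (simp add: face_inclusion_def E)
  show inj: "inj_on (face_inclusion V F) (edges (face_tree V F))"
    by (auto simp: inj_on_def FPQ E k)
  have im: "face_inclusion V (P, Q) ` ?l ` R = R" if "R \<subseteq> P" for R
    using that k by (force simp: image_iff subset_iff)
  show "face_inclusion V F \<in> tree_maps (face_tree V F) V"
    unfolding tree_maps_iff_cut FPQ
  proof (intro conjI allI impI)
    show "face_inclusion V (P, Q) \<in> edges ?U \<rightarrow>\<^sub>E edges V" using PE by (auto simp: face_inclusion_def E)
    fix t L assume c: "cut ?U t L"
    have L: "L \<subseteq> edges ?U" and t: "t \<in> edges ?U" using cut_edges[OF c] by auto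
    show "inj_on (face_inclusion V (P, Q)) L" using inj L unfolding FPQ by (rule inj_on_subset)
    obtain u M where u: "t = ?l u" "L = ?l ` M" "u \<in> P" "M \<subseteq> P"
      using t L unfolding E by (metis imageE subset_imageE)
    have b: "below ?U (?l a) (?l b) \<longleftrightarrow> a \<in> P \<and> b \<in> P \<and> below V a b" for a b
      by (rule face_tree_below[OF F'])
    have "\<exists>a\<in>M. below V a l" if l: "l \<in> leaves V" "below V u l" for l
    proof -
      have "below V t0 l" using face_root_below[OF t0(1,2) u(3) t0(3)] l(2) by (rule below_trans)
      then obtain l0 where l0: "l0 \<in> P - Q" "below V l0 l" using t0(1) l by (auto simp: cut_def)
      have "below V u l0"
        using below_comparable[OF l(2) l0(2)]
      proof
        assume lu: "below V l0 u"
        then have "u \<notin> Q" using t0(2) l0 unfolding interior_def by blast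
        then have "l0 = u" using t0(1) lu l0 u unfolding cut_def by blast
        then show ?thesis using lu by simp
      qed
      then have "below ?U t (?l l0)" using u b l0 by blast
      moreover have "?l l0 \<in> leaves ?U" using Lv l0 by blast
      ultimately obtain a where "a \<in> M" "below ?U (?l a) (?l l0)" using c u unfolding cut_def by blast
      then show ?thesis using b l0 below_trans by blast
    qed
    then have "cut V u M" using c u PE unfolding cut_def by (auto simp: b)
    then show "cut V (face_inclusion V (P, Q) t) (face_inclusion V (P, Q) ` L)"
      using u k im by simp
  qed
  show "image_face V (face_tree V F) (face_inclusion V F) = F"
    unfolding image_face_def FPQ E Lv
    using im[of P] im[of "P - Q"] face_tree_root[OF F' t0] k t0 by simp
qed

section \<open>Composites and excision in saturated classes\<close>

lemma trans_comp_id [simp]: "trans_comp trans_id trans_id = (trans_id :: 'a trans)"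
  by (simp add: trans_comp_def trans_id_def)

lemma gdset_res: "is_gdset G X \<Longrightarrow> f \<in> tree_maps U V \<Longrightarrow> x \<in> cells X V \<Longrightarrow> res X U V f x \<in> cells X U"
  by (simp add: is_gdset_def Pi_iff)

lemma gdset_act: "is_gdset G X \<Longrightarrow> g \<in> carrier G \<Longrightarrow> x \<in> cells X U \<Longrightarrow> act X g U x \<in> cells X U"
  by (simp add: is_gdset_def Pi_iff)

lemma is_gdmap_comp: "is_gdmap G X Y f \<Longrightarrow> is_gdmap G Y Z g \<Longrightarrow> is_gdmap G X Z (trans_comp g f)"
  unfolding is_gdmap_def trans_comp_def by (auto simp: Pi_iff)

lemma is_gdmap_id: "is_gdset G X \<Longrightarrow> is_gdmap G X X trans_id"
  by (simp add: is_gdmap_def trans_id_def)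

text \<open>
  A chain with a last term has this term as colimit; finite composites are transfinite composites of this kind.
\<close>

lemma colimit_of_top:
  assumes ch: "is_chain G r X \<phi>" and c: "c \<in> Field r" "\<And>i. i \<in> Field r \<Longrightarrow> (i, c) \<in> r"
  shows "is_colimit G r (Field r) X \<phi> (X c) (\<lambda>i. \<phi> i c)"
  unfolding is_colimit_def
proof (intro conjI allI impI)
  show "is_cocone G r (Field r) X \<phi> (X c) (\<lambda>i. \<phi> i c)"
    using ch c unfolding is_cocone_def is_chain_def by blast
  fix Z \<kappa> assume Z: "is_gdset G Z \<and> is_cocone G r (Field r) X \<phi> Z \<kappa>"
  show "\<exists>m. is_gdmap G (X c) Z m \<and> (\<forall>i\<in>Field r. trans_eq (X i) (trans_comp m (\<phi> i c)) (\<kappa> i)) \<and>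
      (\<forall>m'. is_gdmap G (X c) Z m' \<and> (\<forall>i\<in>Field r. trans_eq (X i) (trans_comp m' (\<phi> i c)) (\<kappa> i))
         \<longrightarrow> trans_eq (X c) m' m)"
  proof (intro exI[of _ "\<kappa> c"] conjI allI impI)
    show "is_gdmap G (X c) Z (\<kappa> c)" using Z c by (simp add: is_cocone_def)
    show "\<forall>i\<in>Field r. trans_eq (X i) (trans_comp (\<kappa> c) (\<phi> i c)) (\<kappa> i)"
      using Z c by (simp add: is_cocone_def)
    fix m' assume "is_gdmap G (X c) Z m' \<and> (\<forall>i\<in>Field r. trans_eq (X i) (trans_comp m' (\<phi> i c)) (\<kappa> i))"
    then have "trans_eq (X c) (trans_comp m' (\<phi> c c)) (\<kappa> c)" using c by blast
    moreover have "trans_eq (X c) (\<phi> c c) trans_id" using ch c by (simp add: is_chain_def)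
    ultimately show "trans_eq (X c) m' (\<kappa> c)" by (simp add: trans_eq_def trans_comp_def trans_id_def)
  qed
qed

lemma saturated_gdmap: "saturated G K \<Longrightarrow> (A, f, B) \<in> K \<Longrightarrow> is_gdmap G A B f"
  by (auto simp: saturated_def gdarrows_def)

text \<open>
  The chain \<open>A \<rightarrow> B \<rightarrow> C\<close>, indexed by any three distinct elements of the index type.
\<close>

lemma two_step_transfinite_composition:
  fixes a b c :: 'i
  assumes ne: "a \<noteq> b" "a \<noteq> c" "b \<noteq> c"
    and fm: "is_gdmap G A B f" and gm: "is_gdmap G B C g" and f: "(A, f, B) \<in> K" and g: "(B, g, C) \<in> K"
  shows "\<exists>r X \<phi> \<iota>. is_transfinite_composition G K r X \<phi> a C \<iota> \<and> X a = A \<and> \<iota> a = trans_comp g f"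
proof -
  note ne' = ne ne[symmetric]
  define r where "r = {(a, a), (a, b), (a, c), (b, b), (b, c), (c, c)}"
  define X where "X i = (if i = a then A else if i = b then B else C)" for i
  define \<phi> where "\<phi> i j = (if i = j then trans_id else if i = b then g else if j = b then f else trans_comp g f)"
    for i j
  have F: "Field r = {a, b, c}" by (auto simp: r_def Field_def)
  have sets: "is_gdset G A" "is_gdset G B" "is_gdset G C" using fm gm by (auto simp: is_gdmap_def)
  have ch: "is_chain G r X \<phi>"
    unfolding is_chain_def
  proof (intro conjI)
    show "\<forall>i j. (i, j) \<in> r \<longrightarrow> is_gdmap G (X i) (X j) (\<phi> i j)"
      using fm gm is_gdmap_comp[OF fm gm] sets[THEN is_gdmap_id] ne' by (auto simp: r_def X_def \<phi>_def)
    show "\<forall>i\<in>Field r. trans_eq (X i) (\<phi> i i) trans_id" by (simp add: \<phi>_def trans_eq_def)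
    show "\<forall>i j k. (i, j) \<in> r \<and> (j, k) \<in> r \<longrightarrow> trans_eq (X i) (trans_comp (\<phi> j k) (\<phi> i j)) (\<phi> i k)"
      using ne' by (auto simp: r_def \<phi>_def trans_eq_def trans_comp_def trans_id_def)
  qed
  have wo: "Well_order r"
  proof -
    have "wf (r - Id)"
      by (rule wf_subset[OF wf_measure[of "\<lambda>x. if x = a then 0 else if x = b then 1 else (2::nat)"]])
         (use ne' in \<open>auto simp: r_def\<close>)
    then show ?thesis
      using ne' unfolding well_order_on_def linear_order_on_def partial_order_on_def preorder_on_def F
      by (auto simp: r_def refl_on_def trans_def antisym_def total_on_def)
  qed
  have u: "underS r a = {}" "underS r b = {a}" "underS r c = {a, b}"
    using ne' by (auto simp: underS_def r_def)
  have succ: "is_succ r i j \<longleftrightarrow> i = a \<and> j = b \<or> i = b \<and> j = c" if "j \<in> Field r" for i j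
    using that ne' u by (auto simp: F is_succ_def r_def)
  have nl: "\<not> is_limit r j" for j
    using succ[of j] u ne' by (auto simp: is_limit_def F)
  have "is_transfinite_composition G K r X \<phi> a (X c) (\<lambda>i. \<phi> i c)"
    unfolding is_transfinite_composition_def
  proof (intro conjI allI impI)
    show "is_colimit G r (Field r) X \<phi> (X c) (\<lambda>i. \<phi> i c)"
      by (rule colimit_of_top[OF ch]) (auto simp: F r_def)
    show "(X i, \<phi> i j, X j) \<in> K" if "j \<in> Field r \<and> is_succ r i j" for i j
      using that succ[of j i] f g ne' by (auto simp: X_def \<phi>_def)
  qed (use wo ch u nl F in auto)
  moreover have "X c = C" "X a = A" "\<phi> a c = trans_comp g f" using ne' by (simp_all add: X_def \<phi>_def)
  ultimately show ?thesis by (intro exI[of _ r] exI[of _ X] exI[of _ \<phi>] exI[of _ "\<lambda>i. \<phi> i c"]) simp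
qed

lemma saturated_comp:
  fixes K :: "('u cell, 'g) arrow set"
  assumes K: "saturated G K" and f: "(A, f, B) \<in> K" and g: "(B, g, C) \<in> K"
  shows "(A, trans_comp g f, C) \<in> K"
proof -
  have "Inl (\<lambda>_. 0) \<noteq> (Inl id :: 'u cell)" by (auto simp: fun_eq_iff)
  then have "({} :: 'u cell set) \<noteq> {Inl id}" "({} :: 'u cell set) \<noteq> UNIV" "({Inl id} :: 'u cell set) \<noteq> UNIV" by auto
  from two_step_transfinite_composition[OF this saturated_gdmap[OF K f] saturated_gdmap[OF K g] f g]
  show ?thesis using K unfolding saturated_def closed_transfinite_def by metis
qed

lemma saturated_id:
  fixes K :: "('u cell, 'g) arrow set"
  assumes K: "saturated G K" and X: "is_gdset G X"
  shows "(X, trans_id, X) \<in> K"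
proof -
  define r where "r = {({} :: 'u cell set, {} :: 'u cell set)}"
  have F: "Field r = {{}}" by (auto simp: r_def Field_def)
  have ch: "is_chain G r (\<lambda>_. X) (\<lambda>_ _. trans_id)"
    using is_gdmap_id[OF X] by (auto simp: is_chain_def trans_eq_def)
  have wo: "Well_order r"
    unfolding well_order_on_def linear_order_on_def partial_order_on_def preorder_on_def F
    by (auto simp: r_def refl_on_def trans_def antisym_def total_on_def)
  have u: "underS r {} = {}" by (auto simp: underS_def r_def)
  have "is_transfinite_composition G K r (\<lambda>_. X) (\<lambda>_ _. trans_id) {} X (\<lambda>_. trans_id)"
    unfolding is_transfinite_composition_def
    using wo ch u colimit_of_top[OF ch, of "{}"]
    by (auto simp: F r_def is_succ_def is_limit_def)
  then show ?thesis using K unfolding saturated_def closed_transfinite_def by blast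
qed

text \<open>
  Cells are attached along a pushout square if \<open>k\<close> is a bijection from the cells of \<open>B\<close> outside \<open>A\<close> to those
  of \<open>D\<close> outside \<open>C\<close>: a map out of \<open>D\<close> is then defined by cases, and it is natural because a restriction of a new cell
  is either new or covered by the compatibility over \<open>A\<close>.
\<close>

lemma pushout_of_excision:
  assumes i: "is_gdmap G A B trans_id" and k: "is_gdmap G B D k" and j: "is_gdmap G C D trans_id"
    and A: "\<And>U. cells A U = {x \<in> cells B U. k U x \<in> cells C U}"
    and D: "\<And>U. cells D U \<subseteq> cells C U \<union> k U ` cells B U"
    and inj: "\<And>U x y. x \<in> cells B U \<Longrightarrow> y \<in> cells B U \<Longrightarrow> k U x = k U y \<Longrightarrow> k U x \<notin> cells C U \<Longrightarrow> x = y"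
  shows "is_pushout G A B C D trans_id k k trans_id"
proof -
  have AB: "cells A U \<subseteq> cells B U" and CD: "cells C U \<subseteq> cells D U" for U
    using i j by (auto simp: is_gdmap_def trans_id_def)
  have res: "res A U V f x = res B U V f x" if "f \<in> tree_maps U V" "x \<in> cells A V" for U V f x
    using i that by (auto simp: is_gdmap_def trans_id_def)
  have act: "act A g U x = act B g U x" if "g \<in> carrier G" "x \<in> cells A U" for g U x
    using i that by (auto simp: is_gdmap_def trans_id_def)
  have resC: "res C U V f x = res D U V f x" if "f \<in> tree_maps U V" "x \<in> cells C V" for U V f x
    using j that by (auto simp: is_gdmap_def trans_id_def)
  have actC: "act C g U x = act D g U x" if "g \<in> carrier G" "x \<in> cells C U" for g U x
    using j that by (auto simp: is_gdmap_def trans_id_def)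
  have Bset: "is_gdset G B" and Cset: "is_gdset G C" and Dset: "is_gdset G D" and Aset: "is_gdset G A"
    using i j k by (auto simp: is_gdmap_def)
  have kres: "k U (res B U V f x) = res D U V f (k V x)" if "f \<in> tree_maps U V" "x \<in> cells B V" for U V f x
    using k that by (auto simp: is_gdmap_def)
  have kact: "k U (act B g U x) = act D g U (k U x)" if "g \<in> carrier G" "x \<in> cells B U" for g U x
    using k that by (auto simp: is_gdmap_def)
  have kA: "is_gdmap G A C k"
    unfolding is_gdmap_def using Aset Cset A AB res act kres kact resC actC by auto
  show ?thesis
    unfolding is_pushout_def
  proof (intro conjI allI impI)
    show "trans_eq A (trans_comp k trans_id) (trans_comp trans_id k)"
      by (simp add: trans_eq_def trans_comp_def trans_id_def)
    fix Z p q
    assume "is_gdmap G B Z p \<and> is_gdmap G C Z q \<and> trans_eq A (trans_comp p trans_id) (trans_comp q k)"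
    then have p: "is_gdmap G B Z p" and q: "is_gdmap G C Z q"
      and pq: "\<And>U x. x \<in> cells A U \<Longrightarrow> p U x = q U (k U x)"
      by (auto simp: trans_eq_def trans_comp_def trans_id_def)
    have Zset: "is_gdset G Z" using p by (simp add: is_gdmap_def)
    define m where "m U x = (if x \<in> cells C U then q U x else p U (SOME y. y \<in> cells B U \<and> k U y = x))" for U x
    have mC: "m U x = q U x" if "x \<in> cells C U" for U x using that by (simp add: m_def)
    have mk: "m U (k U y) = p U y" if y: "y \<in> cells B U" for U y
    proof (cases "k U y \<in> cells C U")
      case True
      then show ?thesis using y A pq by (simp add: m_def)
    next
      case False
      have "(SOME z. z \<in> cells B U \<and> k U z = k U y) = y"
        using y inj[OF _ y _] False by (intro some_equality) auto
      then show ?thesis using False by (simp add: m_def)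
    qed
    have cov: "x \<in> cells C U \<or> (\<exists>y\<in>cells B U. x = k U y)" if "x \<in> cells D U" for U x
      using D that by blast
    have m: "is_gdmap G D Z m"
      unfolding is_gdmap_def
    proof (intro conjI allI ballI)
      show "m U \<in> cells D U \<rightarrow> cells Z U" for U
      proof
        fix x assume "x \<in> cells D U"
        from cov[OF this] show "m U x \<in> cells Z U"
        proof
          assume x: "x \<in> cells C U"
          then have "q U x \<in> cells Z U" using q unfolding is_gdmap_def by blast
          then show ?thesis using mC[OF x] by simp
        next
          assume "\<exists>y\<in>cells B U. x = k U y"
          then obtain y where y: "y \<in> cells B U" "x = k U y" by blast
          then have "p U y \<in> cells Z U" using p unfolding is_gdmap_def by blast
          then show ?thesis using mk[OF y(1)] y(2) by simp
        qed
      qed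
      show "m U (res D U V f x) = res Z U V f (m V x)" if f: "f \<in> tree_maps U V" and x: "x \<in> cells D V" for U V f x
        using cov[OF x]
      proof
        assume x: "x \<in> cells C V"
        have "res C U V f x \<in> cells C U" using gdset_res[OF Cset f] x by blast
        moreover have "q U (res C U V f x) = res Z U V f (q V x)" using q f x unfolding is_gdmap_def by blast
        ultimately show ?thesis using mC x resC[OF f x] by simp
      next
        assume "\<exists>y\<in>cells B V. x = k V y"
        then obtain y where y: "y \<in> cells B V" "x = k V y" by blast
        have "res B U V f y \<in> cells B U" using gdset_res[OF Bset f] y by blast
        moreover have "p U (res B U V f y) = res Z U V f (p V y)" using p f y unfolding is_gdmap_def by blast
        ultimately show ?thesis using mk y kres[OF f y(1)] by metis
      qed
      show "m U (act D g U x) = act Z g U (m U x)" if g: "g \<in> carrier G" and x: "x \<in> cells D U" for U g x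
        using cov[OF x]
      proof
        assume x: "x \<in> cells C U"
        have "act C g U x \<in> cells C U" using gdset_act[OF Cset g] x by blast
        moreover have "q U (act C g U x) = act Z g U (q U x)" using q g x unfolding is_gdmap_def by blast
        ultimately show ?thesis using mC x actC[OF g x] by simp
      next
        assume "\<exists>y\<in>cells B U. x = k U y"
        then obtain y where y: "y \<in> cells B U" "x = k U y" by blast
        have "act B g U y \<in> cells B U" using gdset_act[OF Bset g] y by blast
        moreover have "p U (act B g U y) = act Z g U (p U y)" using p g y unfolding is_gdmap_def by blast
        ultimately show ?thesis using mk y kact[OF g y(1)] by metis
      qed
    qed (use Dset Zset in auto)
    show "\<exists>m. is_gdmap G D Z m \<and> trans_eq B (trans_comp m k) p \<and> trans_eq C (trans_comp m trans_id) q \<and>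
        (\<forall>m'. is_gdmap G D Z m' \<and> trans_eq B (trans_comp m' k) p \<and> trans_eq C (trans_comp m' trans_id) q
           \<longrightarrow> trans_eq D m' m)"
    proof (intro exI[of _ m] conjI allI impI)
      show "trans_eq B (trans_comp m k) p" "trans_eq C (trans_comp m trans_id) q"
        using mk mC by (simp_all add: trans_eq_def trans_comp_def trans_id_def)
      fix m' assume m': "is_gdmap G D Z m' \<and> trans_eq B (trans_comp m' k) p \<and> trans_eq C (trans_comp m' trans_id) q"
      show "trans_eq D m' m"
        unfolding trans_eq_def
      proof (intro allI ballI)
        fix U x assume "x \<in> cells D U"
        from cov[OF this] show "m' U x = m U x"
          using m' mk mC by (auto simp: trans_eq_def trans_comp_def trans_id_def)
      qed
    qed (rule m)
  qed (use i k j kA in auto)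
qed

section \<open>Subpresheaves given by faces\<close>

lemma image_face_compose_le:
  assumes f: "f \<in> tree_maps U W" and x: "x \<in> tree_maps W V"
  shows "face_le (image_face V U (compose (edges U) x f)) (image_face V W x)"
proof -
  have e: "compose (edges U) x f a = x (f a)" if "a \<in> edges U" for a using that by (rule compose_eq)
  have "compose (edges U) x f ` leaves U = x ` f ` leaves U" using e leaves_edges by (force simp: image_iff)
  then have "interior V (compose (edges U) x f (root U)) (compose (edges U) x f ` leaves U)
      = interior V (x (f (root U))) (x ` f ` leaves U)" using e by simp
  also have "\<dots> \<subseteq> interior V (x (root W)) (x ` leaves W)"
    using interior_tree_map_mono[OF x] tree_map_cut[OF f cut_leaves] by blast
  finally show ?thesis using e tree_map_edges[OF f] by (auto simp: face_le_def image_face_def)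
qed

definition faces :: "'g gforest \<Rightarrow> face set" where
  "faces T = {F. \<exists>V\<in>comps T. face V F}"

definition translate :: "'g gforest \<Rightarrow> 'g \<Rightarrow> face \<Rightarrow> face" where
  "translate T g F = (gact T g ` fst F, gact T g ` snd F)"

lemma face_le_translate: "face_le F F' \<Longrightarrow> face_le (translate T g F) (translate T g F')"
  by (auto simp: face_le_def translate_def)

definition cells_with_image :: "'g gforest \<Rightarrow> face set \<Rightarrow> tree \<Rightarrow> (edge \<Rightarrow> edge) set" where
  "cells_with_image T \<A> W = {x. \<exists>V\<in>comps T. x \<in> tree_maps W V \<and> image_face V W x \<in> \<A>}"

text \<open>
  The subpresheaf of the cells whose image is one of the faces in \<open>\<A>\<close>.
\<close>

definition face_sub :: "'g gforest \<Rightarrow> face set \<Rightarrow> ('u cell, 'g) gdset" where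
  "face_sub T \<A> = subrepresentable T (cells_with_image T \<A>)"

lemma cells_face_sub: "cells (face_sub T \<A>) W = Inl ` cells_with_image T \<A> W"
  by (simp add: face_sub_def subrepresentable_def)

lemma representable_face_sub: "representable T = face_sub T (faces T)"
proof -
  have "(\<lambda>W. \<Union>V\<in>comps T. tree_maps W V) = cells_with_image T (faces T)"
    unfolding fun_eq_iff cells_with_image_def faces_def using image_face_face by blast
  then show ?thesis by (simp add: representable_def face_sub_def)
qed

text \<open>
  The unions of faces by which horns and cores are defined are given by a condition \<open>\<Phi>\<close> on face maps.
  If the images of these face maps are cofinal in \<open>\<A>\<close>, the union is the subpresheaf of \<open>\<A>\<close>.
\<close>

lemma union_face_cells_cofinal:
  assumes sub: "\<And>U V f. \<Phi> U V f \<Longrightarrow> V \<in> comps T \<and> f \<in> tree_maps U V \<and> inj_on f (edges U) \<and> image_face V U f \<in> \<A>"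
    and ex: "\<And>V F. V \<in> comps T \<Longrightarrow> face V F \<Longrightarrow> F \<in> \<A> \<Longrightarrow> \<exists>U f. \<Phi> U V f \<and> face_le F (image_face V U f)"
    and down: "\<And>F F'. F \<in> \<A> \<Longrightarrow> F' \<in> faces T \<Longrightarrow> face_le F' F \<Longrightarrow> F' \<in> \<A>"
  shows "\<Union>{face_cells U f W | U V f. \<Phi> U V f} = cells_with_image T \<A> W"
proof (intro equalityI subsetI)
  fix x assume "x \<in> \<Union>{face_cells U f W | U V f. \<Phi> U V f}"
  then obtain U V f where x: "x \<in> face_cells U f W" and "\<Phi> U V f" by blast
  from sub[OF this(2)] have V: "V \<in> comps T" and f: "f \<in> tree_maps U V" "inj_on f (edges U)"
    and A: "image_face V U f \<in> \<A>" by auto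
  obtain y where y: "y \<in> tree_maps W U" "x = compose (edges W) f y" using x by (auto simp: face_cells_def)
  have x': "x \<in> tree_maps W V" using tree_map_compose[OF y(1) f(1)] y by simp
  have "face_le (image_face V W x) (image_face V U f)" using image_face_compose_le[OF y(1) f(1)] y by simp
  moreover have "image_face V W x \<in> faces T" using image_face_face[OF x'] V by (auto simp: faces_def)
  ultimately show "x \<in> cells_with_image T \<A> W" using down[OF A] x' V unfolding cells_with_image_def by blast
next
  fix x assume "x \<in> cells_with_image T \<A> W"
  then obtain V where V: "V \<in> comps T" "x \<in> tree_maps W V" "image_face V W x \<in> \<A>"
    by (auto simp: cells_with_image_def)
  obtain U f where f: "\<Phi> U V f" "face_le (image_face V W x) (image_face V U f)"
    using ex[OF V(1) image_face_face[OF V(2)] V(3)] by blast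
  then have "x \<in> face_cells U f W" using face_cells_iff[of f U V x W] sub[OF f(1)] V(2) by blast
  then show "x \<in> \<Union>{face_cells U f W | U V f. \<Phi> U V f}" using f(1) by blast
qed

lemma union_face_cells:
  assumes "\<And>U V f. \<Phi> U V f \<Longrightarrow> V \<in> comps T \<and> f \<in> tree_maps U V \<and> inj_on f (edges U) \<and> image_face V U f \<in> \<A>"
    and ex: "\<And>V F. V \<in> comps T \<Longrightarrow> face V F \<Longrightarrow> F \<in> \<A> \<Longrightarrow> \<Phi> (face_tree V F) V (face_inclusion V F)"
    and "\<And>F F'. F \<in> \<A> \<Longrightarrow> F' \<in> faces T \<Longrightarrow> face_le F' F \<Longrightarrow> F' \<in> \<A>"
  shows "\<Union>{face_cells U f W | U V f. \<Phi> U V f} = cells_with_image T \<A> W"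
proof (rule union_face_cells_cofinal)
  show "\<exists>U f. \<Phi> U V f \<and> face_le F (image_face V U f)" if "V \<in> comps T" "face V F" "F \<in> \<A>" for V F
    using ex[OF that] image_face_inclusion[OF that(2)]
    by (intro exI[of _ "face_tree V F"] exI[of _ "face_inclusion V F"]) simp
qed (rule assms(1), assumption, rule assms(3))

text \<open>
  The pair of \<open>V - E\<close>.
\<close>

definition face_without :: "tree \<Rightarrow> edge set \<Rightarrow> face" where
  "face_without V E = (edges V - E \<inter> inner_edges V, edges V - leaves V)"

lemma image_face_removal:
  "image_face V (remove_edges V (E \<inter> inner_edges V)) (edges_inclusion V (E \<inter> inner_edges V)) = face_without V E"
proof -
  let ?D = "E \<inter> inner_edges V"
  have D: "?D \<subseteq> inner_edges V" by simp
  have "leaves V \<subseteq> edges V - ?D" "root V \<in> edges V - ?D"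
    using leaves_edges by (auto simp: inner_edges_def)
  then have "edges_inclusion V ?D ` leaves V = leaves V" "edges_inclusion V ?D (root V) = root V"
    "edges_inclusion V ?D ` (edges V - ?D) = edges V - ?D"
    by (auto simp: edges_inclusion_def image_iff subset_iff)
  then show ?thesis
    by (simp add: image_face_def face_without_def remove_edges_sel[OF D] remove_edges_leaves[OF D] interior_leaves)
qed

lemma face_without_empty: "face_without V {} = top_face V"
  by (simp add: face_without_def top_face_def)

lemma removal_factors_iff:
  assumes f: "f \<in> tree_maps U V" "inj_on f (edges U)"
  shows "factors_through (remove_edges V (E \<inter> inner_edges V)) (edges_inclusion V (E \<inter> inner_edges V)) U f
    \<longleftrightarrow> face_le (face_without V E) (image_face V U f)"
  using face_cells_iff[OF f, of "edges_inclusion V (E \<inter> inner_edges V)" "remove_edges V (E \<inter> inner_edges V)"]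
    remove_edges_inner_face[of "E \<inter> inner_edges V" V]
  by (simp add: factors_through_iff_face_cells image_face_removal inner_face_map_def face_map_def)

text \<open>
  A face map is an isomorphism iff the identity factors through it.
\<close>

lemma tree_iso_iff_top:
  assumes f: "f \<in> tree_maps U V" "inj_on f (edges U)"
  shows "tree_iso U V f \<longleftrightarrow> face_le (top_face V) (image_face V U f)"
proof
  assume "tree_iso U V f"
  then obtain h where h: "h \<in> tree_maps V U" "compose (edges V) f h = restrict id (edges V)"
    by (auto simp: tree_iso_def)
  then have "restrict id (edges V) \<in> face_cells U f V" by (force simp: face_cells_def)
  then show "face_le (top_face V) (image_face V U f)"
    using face_cells_iff[OF f tree_map_id] by (simp add: image_face_id)
next
  assume "face_le (top_face V) (image_face V U f)"
  then have "restrict id (edges V) \<in> face_cells U f V"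
    using face_cells_iff[OF f tree_map_id] by (simp add: image_face_id)
  then obtain h where h: "h \<in> tree_maps V U" "compose (edges V) f h = restrict id (edges V)"
    by (force simp: face_cells_def)
  have fh: "f (h b) = b" if "b \<in> edges V" for b
    using fun_cong[OF h(2), of b] that by (simp add: compose_eq)
  have "h (f a) = a" if a: "a \<in> edges U" for a
    using inj_onD[OF f(2) fh[OF tree_map_edges[OF f(1) a]]] tree_map_edges[OF h(1)] tree_map_edges[OF f(1) a] a
    by blast
  then have "compose (edges U) h f = restrict id (edges U)" by (auto simp: compose_def)
  then show "tree_iso U V f" using f h by (auto simp: tree_iso_def)
qed

definition horn_faces :: "'g gforest \<Rightarrow> edge set \<Rightarrow> face set" where
  "horn_faces T E = {F \<in> faces T. \<not> (\<exists>V\<in>comps T. face_le (face_without V E) F)}"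

definition segal_faces :: "'g gforest \<Rightarrow> face set" where
  "segal_faces T = {F \<in> faces T. \<exists>t. snd F \<subseteq> {t}}"

text \<open>
  The leaves and the root of a face can be recovered from its pair; so they are the images of the leaves and
  the root under any map with this image.
\<close>

lemma image_face_data:
  assumes x: "x \<in> tree_maps W V" and F: "image_face V W x = (P, Q)"
  shows "P - Q = x ` leaves W" "cut V (x (root W)) (P - Q)" "interior V (x (root W)) (P - Q) = Q" "x (root W) \<in> P"
proof -
  have c: "cut V (x (root W)) (x ` leaves W)" using tree_map_cut[OF x cut_leaves] by blast
  have PQ: "P = x ` edges W" "Q = interior V (x (root W)) (x ` leaves W)" using F by (auto simp: image_face_def)
  obtain t where t: "cut V t (P - Q)" "interior V t (P - Q) = Q" "t \<in> P"
    using faceE image_face_face[OF x] F by metis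
  have xr: "below V (x (root W)) t"
    using t(3) tree_map_mono[OF x below_root] unfolding PQ by blast
  have sub: "x ` leaves W \<subseteq> P - Q"
    using interior_disjoint[OF c] leaves_edges[of W] unfolding PQ by blast
  moreover have "P - Q \<subseteq> x ` leaves W"
  proof
    fix a assume a: "a \<in> P - Q"
    then have "below V (x (root W)) a" using t(1) xr below_trans unfolding cut_def by blast
    then obtain b where b: "b \<in> x ` leaves W" "below V b a" using a PQ(2) unfolding interior_def by blast
    then have "b = a" using t(1) a sub unfolding cut_def by blast
    then show "a \<in> x ` leaves W" using b by simp
  qed
  ultimately show *: "P - Q = x ` leaves W" by blast
  show "cut V (x (root W)) (P - Q)" "interior V (x (root W)) (P - Q) = Q" "x (root W) \<in> P"
    unfolding * using c PQ by auto
qed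

lemma face_hull: "face V (P, Q) \<Longrightarrow> face V (P \<union> Q, Q)"
proof (erule faceE)
  fix t assume t: "cut V t (P - Q)" "interior V t (P - Q) = Q" "t \<in> P"
  have "P \<union> Q - Q = P - Q" by blast
  then show ?thesis using t by (intro faceI[of _ t]) auto
qed

text \<open>
  An outer face is its own hull, because it factors through the hull by an inner face map.  If it has no inner
  edges either, then its interior contains at most its root.
\<close>

lemma outer_face_without_inner_edges:
  assumes o: "outer_face_map U V f" and i: "inner_edges U = {}"
  shows "\<exists>t. snd (image_face V U f) \<subseteq> {t}"
proof -
  have f: "f \<in> tree_maps U V" "inj_on f (edges U)" using o by (auto simp: outer_face_map_def face_map_def)
  obtain P Q where PQ: "image_face V U f = (P, Q)" by fastforce
  note d = image_face_data[OF f(1) PQ]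
  \<comment> \<open>The outer hull of the face.\<close>
  let ?H = "(P \<union> Q, Q)"
  have H: "face V ?H" using face_hull image_face_face[OF f(1)] PQ by simp
  let ?W = "face_tree V ?H" and ?j = "face_inclusion V ?H"
  note j = face_inclusion_tree_map[OF H] face_inclusion_inj[OF H] image_face_inclusion[OF H]
  note dj = image_face_data[OF j(1,3)]
  have PQ': "P \<union> Q - Q = P - Q" by blast
  have "f \<in> face_cells ?W ?j U"
    using face_cells_iff[OF j(1,2) f(1)] by (simp add: j(3) PQ face_le_def)
  then obtain y where y: "y \<in> tree_maps U ?W" and fy: "f = compose (edges U) ?j y"
    by (auto simp: face_cells_def)
  have e: "f a = ?j (y a)" if "a \<in> edges U" for a using that by (simp add: fy compose_eq)
  have inj: "inj_on y (edges U)" using f(2) e unfolding inj_on_def by metis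
  have "?j (root ?W) = f (root U)"
    by (rule face_root_unique[OF dj(2-4)]) (use d PQ' in simp_all)
  then have r: "y (root U) = root ?W"
    using inj_onD[OF j(2), of "y (root U)" "root ?W"] e tree_map_edges[OF y] by simp
  have "?j ` y ` leaves U = f ` leaves U"
    unfolding image_image using e leaves_edges[of U] by (intro image_cong) auto
  then have "?j ` y ` leaves U = ?j ` leaves ?W" using d(1) dj(1) PQ' by simp
  then have l: "y ` leaves U = leaves ?W"
    using inj_on_image_eq_iff[OF j(2), of "y ` leaves U" "leaves ?W"] leaves_edges tree_map_edges[OF y] by blast
  have "inner_face_map U ?W y"
    unfolding inner_face_map_def face_map_def bij_betw_def
    using y inj r l inj_on_subset[OF inj leaves_edges] by simp
  moreover have "face_map ?W V ?j" using j by (simp add: face_map_def)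
  ultimately have "tree_iso U ?W y" using o fy unfolding outer_face_map_def by blast
  then obtain h where h: "h \<in> tree_maps ?W U" "compose (edges ?W) y h = restrict id (edges ?W)"
    by (auto simp: tree_iso_def)
  have "y (h b) = b" if "b \<in> edges ?W" for b
    using fun_cong[OF h(2), of b] that by (simp add: compose_eq)
  then have "?j ` edges ?W \<subseteq> f ` edges U"
    using e[OF tree_map_edges[OF h(1)]] tree_map_edges[OF h(1)] by (intro image_subsetI) (metis image_eqI)
  then have "P \<union> Q \<subseteq> P" using j(3) PQ by (simp add: image_face_def)
  moreover have "P \<subseteq> insert (f (root U)) (P - Q)"
    using PQ d(1) i unfolding image_face_def inner_edges_def by auto
  ultimately show ?thesis using PQ by (intro exI[of _ "f (root U)"]) auto
qed

text \<open>
  A face whose interior is contained in a single edge has all the edges of its hull, so that there is nothing for a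
  factorization through an inner face to add.
\<close>

lemma face_inclusion_outer:
  assumes F: "face V F" and Q: "snd F \<subseteq> {s}"
  shows "outer_face_map (face_tree V F) V (face_inclusion V F) \<and> inner_edges (face_tree V F) = {}"
proof -
  obtain P Q where PQ: "F = (P, Q)" by fastforce
  note F' = F[unfolded PQ]
  obtain t where t: "cut V t (P - Q)" "interior V t (P - Q) = Q" "t \<in> P" using faceE[OF F'] by blast
  have Qt: "Q \<subseteq> {t}" using face_root_in[OF t] Q PQ by auto
  let ?U = "face_tree V F" and ?f = "face_inclusion V F"
  note f = face_inclusion_tree_map[OF F] face_inclusion_inj[OF F]
  have im: "image_face V ?U ?f = (P, Q)" using image_face_inclusion[OF F] PQ by simp
  have "inner_edges ?U = {}"
    using Qt face_tree_edges[OF F'] face_tree_leaves[OF F'] face_tree_root[OF F' t]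
    by (auto simp: PQ inner_edges_def)
  moreover have "tree_iso ?U W i"
    if i: "inner_face_map ?U W i" and j: "face_map W V j" and eq: "?f = compose (edges ?U) j i" for W i j
  proof -
    have i': "i \<in> tree_maps ?U W" "inj_on i (edges ?U)" "i (root ?U) = root W" "i ` leaves ?U = leaves W"
      using i by (auto simp: inner_face_map_def face_map_def bij_betw_def)
    have j': "j \<in> tree_maps W V" "inj_on j (edges W)" using j by (auto simp: face_map_def)
    have e: "?f a = j (i a)" if "a \<in> edges ?U" for a using fun_cong[OF eq, of a] that by (simp add: compose_eq)
    have r: "j (root W) = ?f (root ?U)" using e i'(3) by simp
    have l: "j ` leaves W = ?f ` leaves ?U"
    proof -
      have "?f ` leaves ?U = (\<lambda>a. j (i a)) ` leaves ?U" using e leaves_edges by (intro image_cong) auto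
      then show ?thesis using i'(4) by (simp add: image_image[symmetric])
    qed
    have Qj: "snd (image_face V W j) = Q" using im by (simp add: image_face_def r l)
    obtain P' where P': "image_face V W j = (P', Q)" using Qj by (metis prod.collapse)
    have "P' - Q = P - Q" using image_face_data(1)[OF j'(1) P'] image_face_data(1)[OF f(1) im] l by simp
    moreover have "Q \<subseteq> P" using Qt t by blast
    ultimately have "face_le (image_face V W j) (image_face V ?U ?f)" by (auto simp: P' im face_le_def)
    then have "j \<in> face_cells ?U ?f W" using face_cells_iff[OF f j'(1)] by blast
    then obtain h where h: "h \<in> tree_maps W ?U" "j = compose (edges W) ?f h" by (auto simp: face_cells_def)
    have ih: "i (h b) = b" if b: "b \<in> edges W" for b
    proof -
      have "j b = j (i (h b))" using fun_cong[OF h(2), of b] e[OF tree_map_edges[OF h(1) b]] b by (simp add: compose_eq)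
      then show ?thesis using inj_onD[OF j'(2)] b tree_map_edges[OF i'(1) tree_map_edges[OF h(1) b]] by metis
    qed
    have hi: "h (i a) = a" if a: "a \<in> edges ?U" for a
      using inj_onD[OF i'(2) ih[OF tree_map_edges[OF i'(1) a]]] a tree_map_edges[OF h(1)] tree_map_edges[OF i'(1) a]
      by blast
    have "compose (edges ?U) h i = restrict id (edges ?U)" "compose (edges W) i h = restrict id (edges W)"
      using ih hi by (auto simp: compose_def)
    then show ?thesis using i'(1) h(1) by (auto simp: tree_iso_def)
  qed
  ultimately show ?thesis using f unfolding outer_face_map_def face_map_def by blast
qed

section \<open>The action on a forest\<close>

locale G_forest = group G for G :: "('g, 'b) monoid_scheme" (structure) +
  fixes T :: "'g gforest"
  assumes G_tree: "G_tree G T"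
begin

text \<open>
  The element \<open>g\<close> maps the component \<open>V\<close> to \<open>V'\<close>.
\<close>

abbreviation carries :: "'g \<Rightarrow> tree \<Rightarrow> tree \<Rightarrow> bool" where
  "carries g V V' \<equiv> restrict (gact T g) (edges V) \<in> tree_maps V V'"

lemma comps_eq: "V \<in> comps T \<Longrightarrow> V' \<in> comps T \<Longrightarrow> e \<in> edges V \<Longrightarrow> e \<in> edges V' \<Longrightarrow> V = V'"
  using G_tree unfolding G_tree_def by blast

lemma comps_finite: "finite (comps T)" and comps_nonempty: "comps T \<noteq> {}"
  using G_tree by (auto simp: G_tree_def)

lemma act_comp: "V \<in> comps T \<Longrightarrow> g \<in> carrier G \<Longrightarrow> \<exists>V'\<in>comps T. carries g V V'"
  using G_tree unfolding G_tree_def forest_map_def by blast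

lemma act_transitive: "V \<in> comps T \<Longrightarrow> V' \<in> comps T \<Longrightarrow>
    \<exists>g\<in>carrier G. carries g V V'"
  using G_tree unfolding G_tree_def by blast

lemma forest_edgeI: "V \<in> comps T \<Longrightarrow> e \<in> edges V \<Longrightarrow> e \<in> forest_edges T"
  by (auto simp: forest_edges_def)

lemma act_one: "e \<in> forest_edges T \<Longrightarrow> gact T \<one> e = e"
  using G_tree unfolding G_tree_def by blast

lemma act_mult: "g \<in> carrier G \<Longrightarrow> h \<in> carrier G \<Longrightarrow> e \<in> forest_edges T \<Longrightarrow>
    gact T (g \<otimes> h) e = gact T g (gact T h e)"
  using G_tree unfolding G_tree_def by blast

lemma act_inv: "g \<in> carrier G \<Longrightarrow> e \<in> forest_edges T \<Longrightarrow> gact T (inv g) (gact T g e) = e"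
  using act_mult[of "inv g" g e] act_one by simp

lemma act_edge:
  assumes "g \<in> carrier G" "V \<in> comps T" "e \<in> edges V"
    and "carries g V V'"
  shows "gact T g e \<in> edges V'"
  using tree_map_edges[OF assms(4,3)] assms(3) by simp

lemma forest_edgeE:
  assumes "e \<in> forest_edges T" obtains V where "V \<in> comps T" "e \<in> edges V"
  using assms by (auto simp: forest_edges_def)

lemma act_forest_edge:
  assumes "g \<in> carrier G" "e \<in> forest_edges T" shows "gact T g e \<in> forest_edges T"
proof -
  obtain V where V: "V \<in> comps T" "e \<in> edges V" using assms(2) by (rule forest_edgeE)
  then obtain V' where "V' \<in> comps T" "carries g V V'"
    using act_comp[OF V(1) assms(1)] by blast
  then show ?thesis using act_edge[OF assms(1) V] forest_edgeI by blast
qed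

lemma act_inj: "g \<in> carrier G \<Longrightarrow> inj_on (gact T g) (forest_edges T)"
  by (rule inj_on_inverseI[of _ "gact T (inv g)"]) (rule act_inv)

lemma act_inv': "g \<in> carrier G \<Longrightarrow> e \<in> forest_edges T \<Longrightarrow> gact T g (gact T (inv g) e) = e"
  using act_inv[of "inv g" e] by simp

lemma act_tree_map:
  assumes "g \<in> carrier G" "V \<in> comps T" "V' \<in> comps T" "e \<in> edges V" "gact T g e \<in> edges V'"
  shows "carries g V V'"
proof -
  obtain V'' where V'': "V'' \<in> comps T" "carries g V V''"
    using act_comp[OF assms(2,1)] by blast
  have "V'' = V'" using comps_eq[OF V''(1) assms(3) act_edge[OF assms(1,2,4) V''(2)] assms(5)] .
  then show ?thesis using V'' by simp
qed

context
  fixes g V V'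
  assumes g: "g \<in> carrier G" and V: "V \<in> comps T" and V': "V' \<in> comps T"
    and gV: "carries g V V'"
begin

lemma act_inv_tree_map: "carries (inv g) V' V"
proof -
  have "gact T g (root V) \<in> edges V'" using act_edge[OF g V _ gV] by simp
  moreover have "gact T (inv g) (gact T g (root V)) \<in> edges V"
    using act_inv[OF g forest_edgeI[OF V]] by simp
  ultimately show ?thesis using act_tree_map[OF _ V' V] g by simp
qed

lemma act_image_edges: "gact T g ` edges V = edges V'"
proof
  show "gact T g ` edges V \<subseteq> edges V'" using act_edge[OF g V _ gV] by blast
  show "edges V' \<subseteq> gact T g ` edges V"
  proof
    fix e assume e: "e \<in> edges V'"
    have "gact T (inv g) e \<in> edges V" using act_edge[OF _ V' e act_inv_tree_map] g by simp
    moreover have "e = gact T g (gact T (inv g) e)" using act_inv'[OF g forest_edgeI[OF V' e]] by simp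
    ultimately show "e \<in> gact T g ` edges V" by blast
  qed
qed

lemma act_inj_tree: "inj_on (gact T g) (edges V)"
  using act_inj[OF g] by (rule inj_on_subset) (use forest_edgeI[OF V] in blast)

lemma act_below_iff:
  assumes "a \<in> edges V" "b \<in> edges V"
  shows "below V' (gact T g a) (gact T g b) \<longleftrightarrow> below V a b"
proof -
  have "inj_on (restrict (gact T g) (edges V)) (edges V)" using act_inj_tree by (simp add: inj_on_def)
  then show ?thesis using tree_map_reflects[OF gV, of a b] tree_map_mono[OF gV, of a b] assms by auto
qed

lemma act_interior:
  assumes t: "t \<in> edges V" and L: "L \<subseteq> edges V"
  shows "interior V' (gact T g t) (gact T g ` L) = gact T g ` interior V t L"
proof (intro equalityI subsetI)
  fix s assume s: "s \<in> interior V' (gact T g t) (gact T g ` L)"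
  then obtain u where u: "u \<in> edges V" "s = gact T g u" using interior_edges act_image_edges by blast
  then have "u \<in> interior V t L" using s act_below_iff t L unfolding interior_def by auto
  then show "s \<in> gact T g ` interior V t L" using u by blast
next
  fix s assume "s \<in> gact T g ` interior V t L"
  then obtain u where u: "u \<in> interior V t L" "s = gact T g u" by blast
  then have "u \<in> edges V" using interior_edges by blast
  then show "s \<in> interior V' (gact T g t) (gact T g ` L)" using u act_below_iff t L unfolding interior_def by auto
qed

lemma act_root: "gact T g (root V) = root V'"
proof -
  obtain u where "u \<in> edges V" "root V' = gact T g u" using act_image_edges root_edges[of V'] by (metis imageE)
  then have "below V' (gact T g (root V)) (root V')" using act_below_iff below_root by simp
  then show ?thesis using below_antisym below_root below_edges(1) by metis
qed

text \<open>
  If the image of a leaf were the output of a vertex, the inputs of this vertex would be carried back to a cut above the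
  leaf; but the only cut above a leaf is the leaf itself.
\<close>

lemma act_leaves_subset: "gact T g ` leaves V \<subseteq> leaves V'"
proof
  fix s assume "s \<in> gact T g ` leaves V"
  then obtain l where l: "l \<in> leaves V" "s = gact T g l" by blast
  have le: "l \<in> edges V" using l leaves_edges by blast
  have se: "s \<in> edges V'" using act_edge[OF g V le gV] l by simp
  show "s \<in> leaves V'"
  proof (rule ccontr)
    assume "s \<notin> leaves V'"
    then obtain I where v: "(I, s) \<in> verts V'" using nonleaf_vertex se by blast
    have "cut V (gact T (inv g) s) (restrict (gact T (inv g)) (edges V') ` I)"
      using tree_map_cut[OF act_inv_tree_map cut_vertex[OF v]] se by simp
    moreover have "gact T (inv g) s = l" using act_inv[OF g forest_edgeI[OF V le]] l by simp
    ultimately obtain i where i: "i \<in> I" "below V (restrict (gact T (inv g)) (edges V') i) l" "below V l (restrict (gact T (inv g)) (edges V') i)"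
      using l(1) le below_refl[OF le] unfolding cut_def by blast
    have ie: "i \<in> edges V'" using i vertex_edges[OF v] by blast
    have "gact T (inv g) i = l" using below_antisym[OF i(2,3)] ie by simp
    then have "i = s" using act_inv'[OF g forest_edgeI[OF V' ie]] l by simp
    then show False using below_input[OF v i(1)] by simp
  qed
qed

lemma act_translate_face:
  assumes F: "face V F" shows "face V' (translate T g F)"
proof -
  obtain t L where tL: "cut V t L" "snd F = interior V t L" "insert t L \<subseteq> fst F" "fst F \<subseteq> snd F \<union> L"
    using F by (auto simp: face_def)
  have e: "t \<in> edges V" "L \<subseteq> edges V" using cut_edges[OF tL(1)] by auto
  have "restrict (gact T g) (edges V) ` L = gact T g ` L" using e by (intro image_cong) auto
  then have "cut V' (gact T g t) (gact T g ` L)" using tree_map_cut[OF gV tL(1)] e by simp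
  then show ?thesis
    unfolding face_def translate_def fst_conv snd_conv using act_interior[OF e] tL
    by (intro exI[of _ "gact T g t"] exI[of _ "gact T g ` L"]) auto
qed

lemma act_compose:
  assumes x: "x \<in> tree_maps W V"
  shows "compose (edges W) (gact T g) x \<in> tree_maps W V'"
    and "image_face V' W (compose (edges W) (gact T g) x) = translate T g (image_face V W x)"
proof -
  have eq: "compose (edges W) (gact T g) x = compose (edges W) (restrict (gact T g) (edges V)) x"
    using tree_map_edges[OF x] by (auto simp: compose_def)
  show "compose (edges W) (gact T g) x \<in> tree_maps W V'"
    unfolding eq by (rule tree_map_compose[OF x gV])
  have "compose (edges W) (gact T g) x ` L = gact T g ` x ` L" if "L \<subseteq> edges W" for L
    unfolding image_image using that by (intro image_cong) (auto simp: compose_eq)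
  note im = this[OF subset_refl] this[OF leaves_edges]
  have "x ` leaves W \<subseteq> edges V" "x (root W) \<in> edges V" using leaves_edges tree_map_edges[OF x] by auto
  then show "image_face V' W (compose (edges W) (gact T g) x) = translate T g (image_face V W x)"
    unfolding image_face_def translate_def fst_conv snd_conv im compose_eq[OF root_edges]
    using act_interior by simp
qed

end

lemma act_leaves:
  assumes g: "g \<in> carrier G" and V: "V \<in> comps T" and V': "V' \<in> comps T"
    and gV: "carries g V V'"
  shows "gact T g ` leaves V = leaves V'"
proof
  show "gact T g ` leaves V \<subseteq> leaves V'" by (rule act_leaves_subset[OF assms])
  show "leaves V' \<subseteq> gact T g ` leaves V"
  proof
    fix l assume l: "l \<in> leaves V'"
    then have "gact T (inv g) l \<in> leaves V"
      using act_leaves_subset[OF _ V' V act_inv_tree_map[OF assms]] g by auto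
    moreover have "l = gact T g (gact T (inv g) l)"
      using act_inv'[OF g forest_edgeI[OF V']] l leaves_edges by fastforce
    ultimately show "l \<in> gact T g ` leaves V" by blast
  qed
qed

lemma act_nonleaves:
  assumes g: "g \<in> carrier G" and V: "V \<in> comps T" and V': "V' \<in> comps T"
    and gV: "carries g V V'"
  shows "gact T g ` (edges V - leaves V) = edges V' - leaves V'"
  using inj_on_image_set_diff[OF act_inj_tree[OF assms], of "edges V" "leaves V"] leaves_edges[of V]
    act_leaves[OF assms] act_image_edges[OF assms] by simp

lemma faces_edges: "F \<in> faces T \<Longrightarrow> fst F \<subseteq> forest_edges T \<and> snd F \<subseteq> forest_edges T"
proof -
  assume "F \<in> faces T"
  then obtain V where "V \<in> comps T" "face V F" by (auto simp: faces_def)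
  then show ?thesis using face_edges[of V "fst F" "snd F"] forest_edgeI by auto
qed

lemma face_comp_unique:
  assumes "V \<in> comps T" "V' \<in> comps T" "face V F" "face V' F'" "fst F' \<subseteq> fst F" shows "V' = V"
proof -
  obtain e where "e \<in> fst F'" using face_edges[of V' "fst F'" "snd F'"] assms(4) by auto
  then have "e \<in> edges V'" "e \<in> edges V"
    using face_edges[of V' "fst F'" "snd F'"] face_edges[of V "fst F" "snd F"] assms by auto
  then show ?thesis using comps_eq assms by blast
qed

lemma face_comp:
  assumes "V \<in> comps T" "face V F" "F' \<in> faces T" "fst F' \<subseteq> fst F" shows "face V F'"
proof -
  obtain V' where V': "V' \<in> comps T" "face V' F'" using assms by (auto simp: faces_def)
  then show ?thesis using face_comp_unique[OF assms(1) V'(1) assms(2) V'(2) assms(4)] by simp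
qed

lemma translate_faces: "F \<in> faces T \<Longrightarrow> g \<in> carrier G \<Longrightarrow> translate T g F \<in> faces T"
proof -
  assume F: "F \<in> faces T" and g: "g \<in> carrier G"
  obtain V where V: "V \<in> comps T" "face V F" using F by (auto simp: faces_def)
  obtain V' where V': "V' \<in> comps T" "carries g V V'"
    using act_comp[OF V(1) g] by blast
  show ?thesis using act_translate_face[OF g V(1) V' V(2)] V'(1) by (auto simp: faces_def)
qed

lemma translate_mult: "g \<in> carrier G \<Longrightarrow> h \<in> carrier G \<Longrightarrow> F \<in> faces T \<Longrightarrow>
    translate T (g \<otimes> h) F = translate T g (translate T h F)"
  using faces_edges[of F] unfolding translate_def image_image fst_conv snd_conv
  by (auto simp: act_mult subset_iff intro!: image_cong)

lemma translate_one: "F \<in> faces T \<Longrightarrow> translate T \<one> F = F"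
proof -
  assume "F \<in> faces T"
  then have "gact T \<one> ` fst F = fst F" "gact T \<one> ` snd F = snd F"
    using faces_edges[of F] act_one by (auto simp: image_iff subset_iff)
  then show ?thesis by (simp add: translate_def)
qed

lemma translate_inv: "g \<in> carrier G \<Longrightarrow> F \<in> faces T \<Longrightarrow> translate T (inv g) (translate T g F) = F"
  using translate_mult[of "inv g" g F] translate_one by simp

lemma finite_forest_edges: "finite (forest_edges T)"
  using comps_finite tree_props(1) by (auto simp: forest_edges_def)

lemma finite_faces: "finite (faces T)"
proof (rule finite_subset)
  show "faces T \<subseteq> Pow (forest_edges T) \<times> Pow (forest_edges T)" using faces_edges by (auto simp: subset_iff)
qed (simp add: finite_forest_edges)

text \<open>
  These are the sets of faces that define subpresheaves with action.
\<close>

definition sieve :: "face set \<Rightarrow> bool" where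
  "sieve \<A> \<longleftrightarrow> \<A> \<subseteq> faces T \<and> (\<forall>F\<in>\<A>. \<forall>F'\<in>faces T. face_le F' F \<longrightarrow> F' \<in> \<A>) \<and>
     (\<forall>F\<in>\<A>. \<forall>g\<in>carrier G. translate T g F \<in> \<A>)"

lemma sieve_faces: "sieve (faces T)"
  using translate_faces by (auto simp: sieve_def)

lemma sieve_translate_iff:
  assumes "sieve \<A>" "F \<in> faces T" "g \<in> carrier G" shows "translate T g F \<in> \<A> \<longleftrightarrow> F \<in> \<A>"
  using assms translate_inv[of g F] inv_closed[of g] unfolding sieve_def by metis

lemma cells_with_imageI: "V \<in> comps T \<Longrightarrow> x \<in> tree_maps W V \<Longrightarrow> image_face V W x \<in> \<A> \<Longrightarrow> x \<in> cells_with_image T \<A> W"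
  by (auto simp: cells_with_image_def)

lemma cells_with_imageE:
  assumes "x \<in> cells_with_image T \<A> W"
  obtains V where "V \<in> comps T" "x \<in> tree_maps W V" "image_face V W x \<in> \<A>"
  using assms by (auto simp: cells_with_image_def)

lemma cells_with_image_iff:
  assumes "V \<in> comps T" "x \<in> tree_maps W V"
  shows "x \<in> cells_with_image T \<A> W \<longleftrightarrow> image_face V W x \<in> \<A>"
proof
  assume "x \<in> cells_with_image T \<A> W"
  then obtain V' where V': "V' \<in> comps T" "x \<in> tree_maps W V'" "image_face V' W x \<in> \<A>" by (rule cells_with_imageE)
  have "V' = V"
    using comps_eq[OF V'(1) assms(1) tree_map_edges[OF V'(2) root_edges] tree_map_edges[OF assms(2) root_edges]] .
  then show "image_face V W x \<in> \<A>" using V' by simp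
qed (rule cells_with_imageI[OF assms])

lemma is_gdset_face_sub:
  assumes A: "sieve \<A>" shows "is_gdset G (face_sub T \<A> :: ('u cell, 'g) gdset)"
proof -
  have act: "compose (edges W) (gact T g) x \<in> cells_with_image T \<A> W"
    if g: "g \<in> carrier G" and x: "x \<in> cells_with_image T \<A> W" for g W x
  proof -
    from x obtain V where V: "V \<in> comps T" "x \<in> tree_maps W V" "image_face V W x \<in> \<A>" by (rule cells_with_imageE)
    obtain V' where V': "V' \<in> comps T" "carries g V V'" using act_comp[OF V(1) g] by blast
    show ?thesis
      using act_compose[OF g V(1) V' V(2)] V(3) A V'(1) g unfolding sieve_def
      by (intro cells_with_imageI[of V']) auto
  qed
  have res: "compose (edges U) x f \<in> cells_with_image T \<A> U"
    if f: "f \<in> tree_maps U W" and x: "x \<in> cells_with_image T \<A> W" for U W f x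
  proof -
    from x obtain V where V: "V \<in> comps T" "x \<in> tree_maps W V" "image_face V W x \<in> \<A>" by (rule cells_with_imageE)
    have c: "compose (edges U) x f \<in> tree_maps U V" by (rule tree_map_compose[OF f V(2)])
    then have "image_face V U (compose (edges U) x f) \<in> faces T" using image_face_face V(1) unfolding faces_def by blast
    then have "image_face V U (compose (edges U) x f) \<in> \<A>"
      using image_face_compose_le[OF f V(2)] V(3) A unfolding sieve_def by blast
    then show ?thesis using c V(1) cells_with_imageI by blast
  qed
  have ext: "x a = undefined" if "x \<in> cells_with_image T \<A> W" "a \<notin> edges W" for x a W
    using that by (auto simp: cells_with_image_def tree_maps_def)
  have fe: "x a \<in> forest_edges T" if "x \<in> cells_with_image T \<A> W" "a \<in> edges W" for x a W
  proof -
    from that(1) obtain V where V: "V \<in> comps T" "x \<in> tree_maps W V" by (rule cells_with_imageE)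
    show ?thesis using forest_edgeI[OF V(1) tree_map_edges[OF V(2) that(2)]] .
  qed
  show ?thesis
    unfolding is_gdset_def face_sub_def subrepresentable_def
  proof (simp, intro conjI allI ballI)
    fix U x assume x: "x \<in> cells_with_image T \<A> U"
    show "compose (edges U) x (restrict id (edges U)) = x" 
      using ext[OF x] by (auto simp: compose_def fun_eq_iff)
    show "compose (edges U) (gact T \<one>) x = x"
      using ext[OF x] act_one[OF fe[OF x]] by (auto simp: compose_def fun_eq_iff)
    fix g h assume "g \<in> carrier G" "h \<in> carrier G"
    then show "compose (edges U) (gact T (g \<otimes> h)) x = compose (edges U) (gact T g) (compose (edges U) (gact T h) x)"
      using act_mult[OF _ _ fe[OF x]] by (auto simp: compose_def fun_eq_iff)
  next
    fix U V W f g x assume f: "f \<in> tree_maps U V" "g \<in> tree_maps V W" and x: "x \<in> cells_with_image T \<A> W"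
    show "compose (edges U) x (compose (edges U) g f) = compose (edges U) (compose (edges V) x g) f"
      using tree_map_edges[OF f(1)] by (auto simp: compose_def fun_eq_iff)
  next
    fix g U V f x assume f: "f \<in> tree_maps U V"
    show "compose (edges U) (gact T g) (compose (edges U) x f) = compose (edges U) (compose (edges V) (gact T g) x) f"
      using tree_map_edges[OF f] by (auto simp: compose_def fun_eq_iff)
  qed (use act res in auto)
qed

lemma face_sub_inclusion:
  assumes "sieve \<A>" "sieve \<B>" "\<A> \<subseteq> \<B>"
  shows "is_gdmap G (face_sub T \<A> :: ('u cell, 'g) gdset) (face_sub T \<B>) trans_id"
proof -
  have "cells_with_image T \<A> U \<subseteq> cells_with_image T \<B> U" for U using assms(3) by (auto simp: cells_with_image_def)
  then show ?thesis
    using is_gdset_face_sub[OF assms(1)] is_gdset_face_sub[OF assms(2)]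
    unfolding is_gdmap_def by (auto simp: face_sub_def subrepresentable_def trans_id_def)
qed

text \<open>
  A face contains \<open>V - E\<close> for at most one component \<open>V\<close>, as \<open>V - E\<close> contains the root of \<open>V\<close>.
\<close>

lemma horn_faces_iff:
  assumes V: "V \<in> comps T" and F: "face V F"
  shows "F \<in> horn_faces T E \<longleftrightarrow> \<not> face_le (face_without V E) F"
proof -
  have "V' = V" if "V' \<in> comps T" "face_le (face_without V' E) F" for V'
  proof -
    have "root V' \<in> fst F" using that by (auto simp: face_le_def face_without_def inner_edges_def)
    then have "root V' \<in> edges V" using face_edges[of V "fst F" "snd F"] F by auto
    then show ?thesis using comps_eq[OF that(1) V, of "root V'"] by simp
  qed
  then show ?thesis using V F by (auto simp: horn_faces_def faces_def)
qed

lemma act_inner_edges: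
  assumes "g \<in> carrier G" "V \<in> comps T" "V' \<in> comps T" "carries g V V'"
  shows "gact T g ` inner_edges V = inner_edges V'"
proof -
  have eq: "inner_edges U = (edges U - leaves U) - {root U}" for U by (auto simp: inner_edges_def)
  have "gact T g ` ((edges V - leaves V) - {root V}) = gact T g ` (edges V - leaves V) - gact T g ` {root V}"
    by (rule inj_on_image_set_diff[OF act_inj_tree[OF assms]]) auto
  then show ?thesis unfolding eq using act_nonleaves[OF assms] act_root[OF assms] by simp
qed

lemma stable_image:
  assumes "G_stable G T E" "E \<subseteq> forest_edges T" "g \<in> carrier G" shows "gact T g ` E = E"
proof
  show "gact T g ` E \<subseteq> E" using assms by (auto simp: G_stable_def)
  show "E \<subseteq> gact T g ` E"
  proof
    fix e assume e: "e \<in> E"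
    then have "gact T (inv g) e \<in> E" using assms by (auto simp: G_stable_def)
    moreover have "e = gact T g (gact T (inv g) e)" using act_inv'[OF assms(3)] e assms(2) by auto
    ultimately show "e \<in> gact T g ` E" by blast
  qed
qed

lemma translate_face_without:
  assumes g: "g \<in> carrier G" "V \<in> comps T" "V' \<in> comps T" "carries g V V'"
    and E: "G_stable G T E" "E \<subseteq> forest_edges T"
  shows "translate T g (face_without V E) = face_without V' E"
proof -
  have "gact T g ` (E \<inter> inner_edges V) = gact T g ` E \<inter> gact T g ` inner_edges V"
    by (rule inj_on_image_Int[OF act_inj[OF g(1)]]) (use E(2) forest_edgeI[OF g(2)] in \<open>auto simp: inner_edges_def\<close>)
  then have 1: "gact T g ` (E \<inter> inner_edges V) = E \<inter> inner_edges V'"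
    using stable_image[OF E g(1)] act_inner_edges[OF g] by simp
  have "gact T g ` (edges V - E \<inter> inner_edges V) = gact T g ` edges V - gact T g ` (E \<inter> inner_edges V)"
    by (rule inj_on_image_set_diff[OF act_inj_tree[OF g]]) (auto simp: inner_edges_def)
  then show ?thesis
    using 1 act_image_edges[OF g] act_nonleaves[OF g] by (simp add: translate_def face_without_def)
qed

lemma sieve_horn:
  assumes E: "G_stable G T E" "E \<subseteq> forest_edges T"
  shows "sieve (horn_faces T E)"
  unfolding sieve_def
proof (intro conjI ballI impI)
  show "horn_faces T E \<subseteq> faces T" by (auto simp: horn_faces_def)
  show "F' \<in> horn_faces T E" if "F \<in> horn_faces T E" "F' \<in> faces T" "face_le F' F" for F F'
    using that face_le_trans[OF _ that(3)] unfolding horn_faces_def by blast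
  fix F g assume F: "F \<in> horn_faces T E" and g: "g \<in> carrier G"
  then obtain V where V: "V \<in> comps T" "face V F" by (auto simp: horn_faces_def faces_def)
  obtain V' where V': "V' \<in> comps T" "carries g V V'" using act_comp[OF V(1) g] by blast
  show "translate T g F \<in> horn_faces T E"
  proof (rule ccontr)
    assume "translate T g F \<notin> horn_faces T E"
    then have "face_le (face_without V' E) (translate T g F)"
      using horn_faces_iff[OF V'(1) act_translate_face[OF g V(1) V' V(2)]] by blast
    then have "face_le (translate T (inv g) (face_without V' E)) F"
      using face_le_translate[of _ _ T "inv g"] translate_inv[OF g, of F] V unfolding faces_def by fastforce
    then show False
      using translate_face_without[OF _ V'(1) V(1) act_inv_tree_map[OF g V(1) V'] E] g F V
      by (auto simp: horn_faces_def)
  qed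
qed

lemma inner_horn_face_sub:
  assumes E: "G_stable G T E" "E \<subseteq> forest_edges T"
  shows "inner_horn T E = face_sub T (horn_faces T E)"
proof -
  have "\<Union>{face_cells U f W | U V f. V \<in> comps T \<and> face_map U V f \<and>
        \<not> factors_through (remove_edges V (E \<inter> inner_edges V)) (edges_inclusion V (E \<inter> inner_edges V)) U f}
      = cells_with_image T (horn_faces T E) W" for W
  proof (rule union_face_cells)
    fix U V f assume *: "V \<in> comps T \<and> face_map U V f \<and>
        \<not> factors_through (remove_edges V (E \<inter> inner_edges V)) (edges_inclusion V (E \<inter> inner_edges V)) U f"
    then have f: "f \<in> tree_maps U V" "inj_on f (edges U)" by (auto simp: face_map_def)
    then show "V \<in> comps T \<and> f \<in> tree_maps U V \<and> inj_on f (edges U) \<and> image_face V U f \<in> horn_faces T E"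
      using * removal_factors_iff[OF f] horn_faces_iff[OF _ image_face_face[OF f(1)]] by blast
  next
    fix V F assume V: "V \<in> comps T" and F: "face V F" and h: "F \<in> horn_faces T E"
    note i = face_inclusion_tree_map[OF F] face_inclusion_inj[OF F]
    show "V \<in> comps T \<and> face_map (face_tree V F) V (face_inclusion V F) \<and>
        \<not> factors_through (remove_edges V (E \<inter> inner_edges V)) (edges_inclusion V (E \<inter> inner_edges V))
            (face_tree V F) (face_inclusion V F)"
      using V i h horn_faces_iff[OF V F] by (simp add: face_map_def removal_factors_iff[OF i] image_face_inclusion[OF F])
  qed (use sieve_horn[OF E] in \<open>auto simp: sieve_def\<close>)
  then show ?thesis by (simp add: inner_horn_def face_sub_def)
qed

text \<open>
  The boundary is the horn of the empty set of edges; this allows the attaching of boundaries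
  to be treated as the attaching of horns.
\<close>

lemma boundary_inner_horn: "boundary T = inner_horn T {}"
proof -
  have "\<not> tree_iso U V f \<longleftrightarrow> \<not> factors_through (remove_edges V ({} \<inter> inner_edges V)) (edges_inclusion V ({} \<inter> inner_edges V)) U f"
    if "face_map U V f" for U V f
    using that tree_iso_iff_top[of f U V] removal_factors_iff[of f U V "{}"]
    unfolding face_map_def face_without_empty by blast
  then show ?thesis unfolding boundary_def inner_horn_def
    by (intro arg_cong[where f = "subrepresentable T"] ext arg_cong[where f = Union]) blast
qed

lemma sieve_segal: "sieve (segal_faces T)"
  unfolding sieve_def segal_faces_def
proof (intro conjI ballI impI)
  fix F g assume F: "F \<in> {F \<in> faces T. \<exists>t. snd F \<subseteq> {t}}" and "g \<in> carrier G"
  then have "snd (translate T g F) \<subseteq> {gact T g t}" if "snd F \<subseteq> {t}" for t using that by (auto simp: translate_def)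
  then show "translate T g F \<in> {F \<in> faces T. \<exists>t. snd F \<subseteq> {t}}" using F translate_faces \<open>g \<in> carrier G\<close> by blast
qed (auto simp: face_le_def)

lemma segal_core_face_sub: "segal_core T = face_sub T (segal_faces T)"
proof -
  have "\<Union>{face_cells U f W | U V f. V \<in> comps T \<and> outer_face_map U V f \<and> inner_edges U = {}}
      = cells_with_image T (segal_faces T) W" for W
  proof (rule union_face_cells)
    fix U V f assume *: "V \<in> comps T \<and> outer_face_map U V f \<and> inner_edges U = {}"
    then have f: "f \<in> tree_maps U V" "inj_on f (edges U)" by (auto simp: outer_face_map_def face_map_def)
    then show "V \<in> comps T \<and> f \<in> tree_maps U V \<and> inj_on f (edges U) \<and> image_face V U f \<in> segal_faces T"
      using * outer_face_without_inner_edges[of U V f] image_face_face[OF f(1)]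
      unfolding segal_faces_def faces_def by blast
  next
    fix V F assume "V \<in> comps T" "face V F" "F \<in> segal_faces T"
    then show "V \<in> comps T \<and> outer_face_map (face_tree V F) V (face_inclusion V F) \<and> inner_edges (face_tree V F) = {}"
      using face_inclusion_outer[of V F] unfolding segal_faces_def by blast
  qed (use sieve_segal in \<open>auto simp: sieve_def\<close>)
  then show ?thesis by (simp add: segal_core_def face_sub_def)
qed

end

section \<open>The forest of translates of a face\<close>

lemma unlabel_compose:
  assumes F': "face V F'" and y: "y \<in> tree_maps W (face_tree V F')"
  shows "compose (edges W) unlabel y = compose (edges W) (face_inclusion V F') y"
    and "compose (edges W) unlabel y \<in> tree_maps W V"
    and "face_le (image_face V W (compose (edges W) unlabel y)) F'"
proof -
  show *: "compose (edges W) unlabel y = compose (edges W) (face_inclusion V F') y"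
    using tree_map_edges[OF y] by (auto simp: compose_def face_inclusion_def)
  show "compose (edges W) unlabel y \<in> tree_maps W V"
    unfolding * by (rule tree_map_compose[OF y face_inclusion_tree_map[OF F']])
  show "face_le (image_face V W (compose (edges W) unlabel y)) F'"
    unfolding * using image_face_compose_le[OF y face_inclusion_tree_map[OF F']] image_face_inclusion[OF F'] by simp
qed

lemma lift_cell:
  assumes F': "face V F'" and x: "x \<in> tree_maps W V" "face_le (image_face V W x) F'"
  shows "\<exists>y\<in>tree_maps W (face_tree V F'). x = compose (edges W) unlabel y"
proof -
  have "x \<in> face_cells (face_tree V F') (face_inclusion V F') W"
    using face_cells_iff[OF face_inclusion_tree_map[OF F'] face_inclusion_inj[OF F'] x(1)] x(2) image_face_inclusion[OF F']
    by simp
  then obtain y where y: "y \<in> tree_maps W (face_tree V F')" "x = compose (edges W) (face_inclusion V F') y"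
    by (auto simp: face_cells_def)
  then have "x = compose (edges W) unlabel y" using unlabel_compose(1)[OF F' y(1)] by simp
  then show ?thesis using y(1) by blast
qed

lemma unlabel_cell_inj:
  assumes "face V F'" "y \<in> tree_maps W (face_tree V F')" "y' \<in> tree_maps W (face_tree V F')"
    and eq: "compose (edges W) unlabel y = compose (edges W) unlabel y'"
  shows "y = y'"
proof
  fix a show "y a = y' a"
  proof (cases "a \<in> edges W")
    case True
    then have "unlabel (y a) = unlabel (y' a)" using fun_cong[OF eq, of a] by (simp add: compose_eq)
    then show ?thesis
      using inj_onD[OF inj_on_unlabel_label, of "y a" "y' a" F' "fst F'"]
        tree_map_edges[OF assms(2) True] tree_map_edges[OF assms(3) True] face_tree_sel(1)[OF assms(1)] by simp
  next
    case False
    then show ?thesis using tree_map_outside[OF assms(2)] tree_map_outside[OF assms(3)] by simp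
  qed
qed

context G_forest
begin

definition orbit :: "face \<Rightarrow> face set" where
  "orbit F = {translate T g F | g. g \<in> carrier G}"

text \<open>
  The edges of \<open>orbit_forest F\<close> that correspond to the sets \<open>\<epsilon> (snd F')\<close> in the translates \<open>F'\<close> of \<open>F\<close>.
\<close>

definition orbit_edges :: "face \<Rightarrow> (edge set \<Rightarrow> edge set) \<Rightarrow> edge set" where
  "orbit_edges F \<epsilon> = (\<Union>F'\<in>orbit F. label F' ` \<epsilon> (snd F'))"

text \<open>
  Disjoint copies of the translates of \<open>F\<close>.  It plays the part of \<open>G \<cdot>\<^sub>H F\<close> for the stabilizer \<open>H\<close> of \<open>F\<close>, but
  no representatives of cosets have to be chosen, since the components are indexed by the translates themselves.
\<close>

definition orbit_forest :: "face \<Rightarrow> 'g gforest" where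
  "orbit_forest F = \<lparr>comps = {face_tree V F' | V F'. V \<in> comps T \<and> F' \<in> orbit F \<and> face V F'},
     gact = (\<lambda>g e. label (translate T g (label_face e)) (gact T g (unlabel e)))\<rparr>"

lemma label_face_faces: "F \<in> faces T \<Longrightarrow> label_face (label F p) = F"
  using faces_edges[of F] finite_forest_edges finite_subset by (blast intro: label_face_label)

lemma gact_orbit_forest: "F' \<in> faces T \<Longrightarrow> gact (orbit_forest F) g (label F' p) = label (translate T g F') (gact T g p)"
  by (simp add: orbit_forest_def label_face_faces)

lemma orbit_comps: "U \<in> comps (orbit_forest F) \<longleftrightarrow> (\<exists>V F'. U = face_tree V F' \<and> V \<in> comps T \<and> F' \<in> orbit F \<and> face V F')"
  by (auto simp: orbit_forest_def)

context
  fixes F assumes F: "F \<in> faces T"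
begin

lemma orbit_faces: "F' \<in> orbit F \<Longrightarrow> F' \<in> faces T"
  using translate_faces[OF F] by (auto simp: orbit_def)

lemma orbit_self: "F \<in> orbit F"
  unfolding orbit_def using translate_one[OF F] one_closed by (intro CollectI exI[of _ "\<one>"]) simp

lemma translate_orbit: "F' \<in> orbit F \<Longrightarrow> g \<in> carrier G \<Longrightarrow> translate T g F' \<in> orbit F"
  using translate_mult[OF _ _ F] unfolding orbit_def by (smt (verit) m_closed mem_Collect_eq)

lemma orbit_transitive:
  assumes "F1 \<in> orbit F" "F2 \<in> orbit F" shows "\<exists>g\<in>carrier G. translate T g F1 = F2"
proof -
  obtain g1 g2 where g: "g1 \<in> carrier G" "F1 = translate T g1 F" "g2 \<in> carrier G" "F2 = translate T g2 F"
    using assms by (auto simp: orbit_def)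
  have "translate T (g2 \<otimes> inv g1) F1 = translate T g2 (translate T (inv g1) F1)"
    using translate_mult[of g2 "inv g1" F1] orbit_faces[OF assms(1)] g by simp
  also have "\<dots> = F2" using translate_inv[OF g(1) F] g by simp
  finally show ?thesis using g by (intro bexI[of _ "g2 \<otimes> inv g1"]) auto
qed

text \<open>
  The composite of the inclusion of \<open>F'\<close> with \<open>g\<close> has the translate of \<open>F'\<close> as image, so it
  factors through it, and the factorization can only be the action on names.
\<close>

lemma orbit_forest_act:
  assumes V: "V \<in> comps T" and F': "F' \<in> orbit F" "face V F'" and g: "g \<in> carrier G" and V': "V' \<in> comps T"
    and gV: "carries g V V'"
  shows "restrict (gact (orbit_forest F) g) (edges (face_tree V F')) \<in> tree_maps (face_tree V F') (face_tree V' (translate T g F'))"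
proof -
  let ?U = "face_tree V F'" and ?U' = "face_tree V' (translate T g F')" and ?gF = "translate T g F'"
  have gF: "face V' ?gF" by (rule act_translate_face[OF g V V' gV F'(2)])
  note i = face_inclusion_tree_map[OF F'(2)] and i' = face_inclusion_tree_map[OF gF] face_inclusion_inj[OF gF]
  let ?x = "compose (edges ?U) (gact T g) (face_inclusion V F')"
  have x: "?x \<in> tree_maps ?U V'" "image_face V' ?U ?x = ?gF"
    using act_compose[OF g V V' gV i] image_face_inclusion[OF F'(2)] by auto
  have "?x \<in> face_cells ?U' (face_inclusion V' ?gF) ?U"
    using face_cells_iff[OF i' x(1)] x(2) image_face_inclusion[OF gF] by simp
  then obtain y where y: "y \<in> tree_maps ?U ?U'" "?x = compose (edges ?U) (face_inclusion V' ?gF) y"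
    by (auto simp: face_cells_def)
  have "y = restrict (gact (orbit_forest F) g) (edges ?U)"
  proof
    fix e show "y e = restrict (gact (orbit_forest F) g) (edges ?U) e"
    proof (cases "e \<in> edges ?U")
      case True
      then obtain p where p: "e = label F' p" by (auto simp: face_tree_sel[OF F'(2)])
      have ye: "y e \<in> edges ?U'" using tree_map_edges[OF y(1) True] .
      then obtain q where q: "y e = label ?gF q" by (auto simp: face_tree_sel[OF gF])
      have "gact T g p = q"
        using fun_cong[OF y(2), of e] True ye by (simp add: compose_eq face_inclusion_def p[symmetric] q) (simp add: p)
      then show ?thesis using True p q gact_orbit_forest[OF orbit_faces[OF F'(1)]] by simp
    next
      case False
      then show ?thesis using y(1) by (auto simp: tree_maps_def)
    qed
  qed
  then show ?thesis using y(1) by simp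
qed

lemma orbit_forest_edge:
  "e \<in> forest_edges (orbit_forest F) \<longleftrightarrow> (\<exists>F'\<in>orbit F. \<exists>p\<in>fst F'. e = label F' p)"
proof
  assume "e \<in> forest_edges (orbit_forest F)"
  then obtain U where U: "U \<in> comps (orbit_forest F)" "e \<in> edges U" by (auto simp: forest_edges_def)
  then obtain V F' where "F' \<in> orbit F" "face V F'" "e \<in> edges (face_tree V F')"
    unfolding orbit_comps by blast
  then show "\<exists>F'\<in>orbit F. \<exists>p\<in>fst F'. e = label F' p"
    using face_tree_sel(1) by (intro bexI[of _ F']) auto
next
  assume "\<exists>F'\<in>orbit F. \<exists>p\<in>fst F'. e = label F' p"
  then obtain F' p where F': "F' \<in> orbit F" "p \<in> fst F'" "e = label F' p" by blast
  obtain V where V: "V \<in> comps T" "face V F'" using orbit_faces[OF F'(1)] by (auto simp: faces_def)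
  then have "face_tree V F' \<in> comps (orbit_forest F)" "e \<in> edges (face_tree V F')"
    using F' face_tree_sel(1)[OF V(2)] unfolding orbit_comps by blast+
  then show "e \<in> forest_edges (orbit_forest F)" by (auto simp: forest_edges_def)
qed

lemma G_tree_orbit_forest: "G_tree G (orbit_forest F)"
  unfolding G_tree_def
proof (intro conjI ballI impI)
  let ?S = "orbit_forest F"
  have "comps ?S \<subseteq> (\<lambda>(V, F'). face_tree V F') ` (comps T \<times> faces T)"
  proof
    fix U assume "U \<in> comps ?S"
    then obtain V F' where U: "U = face_tree V F'" "V \<in> comps T" "F' \<in> orbit F" unfolding orbit_comps by blast
    then show "U \<in> (\<lambda>(V, F'). face_tree V F') ` (comps T \<times> faces T)"
      using orbit_faces[OF U(3)] by (intro image_eqI[of _ _ "(V, F')"]) simp_all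
  qed
  then show "finite (comps ?S)" using comps_finite finite_faces finite_subset by blast
  obtain V where V: "V \<in> comps T" "face V F" using F by (auto simp: faces_def)
  then show "comps ?S \<noteq> {}" using orbit_self orbit_comps by blast
  fix U1 U2 assume U: "U1 \<in> comps ?S" "U2 \<in> comps ?S"
  then obtain V1 F1 V2 F2 where 1: "U1 = face_tree V1 F1" "V1 \<in> comps T" "F1 \<in> orbit F" "face V1 F1"
    and 2: "U2 = face_tree V2 F2" "V2 \<in> comps T" "F2 \<in> orbit F" "face V2 F2" by (auto simp: orbit_comps)
  show "edges U1 \<inter> edges U2 = {}" if "U1 \<noteq> U2"
  proof (rule ccontr)
    assume "edges U1 \<inter> edges U2 \<noteq> {}"
    then obtain p q where "label F1 p = label F2 q" using 1 2 by (auto simp: face_tree_sel)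
    then have "F1 = F2" using label_face_faces orbit_faces 1 2 by metis
    then show False using face_comp_unique[OF 1(2) 2(2) 1(4) 2(4)] 1 2 that by simp
  qed
  obtain g where g: "g \<in> carrier G" "translate T g F1 = F2" using orbit_transitive 1 2 by blast
  obtain V' where V': "V' \<in> comps T" "carries g V1 V'"
    using act_comp[OF 1(2) g(1)] by blast
  have "face V' F2" using act_translate_face[OF g(1) 1(2) V' 1(4)] g by simp
  then have "V2 = V'" using face_comp_unique[OF V'(1) 2(2) _ 2(4)] by simp
  then show "\<exists>g\<in>carrier G. restrict (gact ?S g) (edges U1) \<in> tree_maps U1 U2"
    using orbit_forest_act[OF 1(2,3,4) g(1) V'] g 1 2 by auto
next
  fix g assume g: "g \<in> carrier G"
  show "forest_map (orbit_forest F) (orbit_forest F) (gact (orbit_forest F) g)"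
    unfolding forest_map_def
  proof
    fix U assume "U \<in> comps (orbit_forest F)"
    then obtain V F' where U: "U = face_tree V F'" "V \<in> comps T" "F' \<in> orbit F" "face V F'" by (auto simp: orbit_comps)
    obtain V' where V': "V' \<in> comps T" "carries g V V'"
      using act_comp[OF U(2) g(1)] by blast
    have "face_tree V' (translate T g F') \<in> comps (orbit_forest F)"
      using act_translate_face[OF g U(2) V' U(4)] translate_orbit[OF U(3) g] V'(1) orbit_comps by blast
    then show "\<exists>V\<in>comps (orbit_forest F). restrict (gact (orbit_forest F) g) (edges U) \<in> tree_maps U V"
      using orbit_forest_act[OF U(2,3,4) g V'] U(1) by blast
  qed
  fix h e assume h: "h \<in> carrier G" and "e \<in> forest_edges (orbit_forest F)"
  then obtain F' p where e: "F' \<in> orbit F" "p \<in> fst F'" "e = label F' p" using orbit_forest_edge by blast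
  have F': "F' \<in> faces T" "p \<in> forest_edges T" using orbit_faces[OF e(1)] faces_edges[of F'] e(2) by auto
  show "gact (orbit_forest F) (g \<otimes> h) e = gact (orbit_forest F) g (gact (orbit_forest F) h e)"
    using F' g h translate_faces[OF F'(1) h] by (simp add: e(3) gact_orbit_forest translate_mult act_mult)
next
  fix e assume "e \<in> forest_edges (orbit_forest F)"
  then obtain F' p where e: "F' \<in> orbit F" "p \<in> fst F'" "e = label F' p" using orbit_forest_edge by blast
  have F': "F' \<in> faces T" "p \<in> forest_edges T" using orbit_faces[OF e(1)] faces_edges[of F'] e(2) by auto
  show "gact (orbit_forest F) \<one> e = e" using F' by (simp add: e(3) gact_orbit_forest translate_one act_one)
qed

lemma unlabel_equivariant:
  assumes "e \<in> forest_edges (orbit_forest F)"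
  shows "unlabel (gact (orbit_forest F) g e) = gact T g (unlabel e)"
proof -
  obtain F' p where e: "F' \<in> orbit F" "p \<in> fst F'" "e = label F' p" using assms orbit_forest_edge by blast
  then show ?thesis using gact_orbit_forest[OF orbit_faces] by simp
qed

context
  fixes \<epsilon> :: "edge set \<Rightarrow> edge set"
  assumes \<epsilon>_sub: "\<And>F'. F' \<in> orbit F \<Longrightarrow> \<epsilon> (snd F') \<subseteq> fst F' \<inter> snd F'"
    and \<epsilon>_face: "\<And>F'. F' \<in> orbit F \<Longrightarrow> (fst F' - \<epsilon> (snd F'), snd F') \<in> faces T"
    and \<epsilon>_equivariant: "\<And>F' g. F' \<in> orbit F \<Longrightarrow> g \<in> carrier G \<Longrightarrow> \<epsilon> (gact T g ` snd F') = gact T g ` \<epsilon> (snd F')"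
begin

text \<open>
  The root of \<open>F'\<close> does not belong to \<open>\<epsilon> (snd F')\<close>: it is the least element of the interior of the hull, and a face
  with the same interior but without the edges in \<open>\<epsilon> (snd F')\<close> exists and has this element as its root, too.
\<close>

lemma orbit_edges_Int:
  assumes V: "V \<in> comps T" and F': "F' \<in> orbit F" "face V F'"
  shows "orbit_edges F \<epsilon> \<inter> edges (face_tree V F') = label F' ` \<epsilon> (snd F')"
    and "label F' ` \<epsilon> (snd F') \<subseteq> inner_edges (face_tree V F')"
proof -
  have E: "edges (face_tree V F') = label F' ` fst F'" by (rule face_tree_sel(1)[OF F'(2)])
  have "F'' = F'" if "F'' \<in> orbit F" "label F'' p = label F' q" for F'' p q
    using that label_face_faces[of F'' p] label_face_faces[of F' q] orbit_faces F'(1) by simp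
  then show "orbit_edges F \<epsilon> \<inter> edges (face_tree V F') = label F' ` \<epsilon> (snd F')"
    using \<epsilon>_sub[OF F'(1)] F'(1) unfolding orbit_edges_def E by blast
  obtain P Q where PQ: "F' = (P, Q)" by fastforce
  have f': "face V (P, Q)" using F'(2) PQ by simp
  obtain t where t: "cut V t (P - Q)" "interior V t (P - Q) = Q" "t \<in> P" using faceE[OF f'] by blast
  have "face V (P - \<epsilon> Q, Q)"
    using face_comp[OF V F'(2) \<epsilon>_face[OF F'(1)]] PQ by simp
  then obtain u where u: "cut V u (P - \<epsilon> Q - Q)" "interior V u (P - \<epsilon> Q - Q) = Q" "u \<in> P - \<epsilon> Q" by (rule faceE)
  have "t \<notin> \<epsilon> Q"
  proof
    assume te: "t \<in> \<epsilon> Q"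
    then have "Q \<noteq> {}" using \<epsilon>_sub[OF F'(1)] PQ by auto
    then have "u \<in> Q" "t \<in> Q" using face_root_in[OF u] face_root_in[OF t] by auto
    then have "below V t u" "below V u t" using t(2) u(2) unfolding interior_def by blast+
    then show False using te u(3) below_antisym by blast
  qed
  then show "label F' ` \<epsilon> (snd F') \<subseteq> inner_edges (face_tree V F')"
    using \<epsilon>_sub[OF F'(1)] face_tree_sel[OF F'(2)] face_tree_root[OF f' t]
    by (auto simp: inner_edges_def PQ)
qed

lemma orbit_edges_inner: "orbit_edges F \<epsilon> \<subseteq> forest_inner_edges (orbit_forest F)"
proof
  fix e assume "e \<in> orbit_edges F \<epsilon>"
  then obtain F' where F': "F' \<in> orbit F" "e \<in> label F' ` \<epsilon> (snd F')" by (auto simp: orbit_edges_def)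
  obtain V where V: "V \<in> comps T" "face V F'" using orbit_faces[OF F'(1)] unfolding faces_def by blast
  have "face_tree V F' \<in> comps (orbit_forest F)" using V F'(1) orbit_comps by blast
  then show "e \<in> forest_inner_edges (orbit_forest F)"
    using orbit_edges_Int(2)[OF V(1) F'(1) V(2)] F'(2) unfolding forest_inner_edges_def by blast
qed

lemma orbit_edges_stable: "G_stable G (orbit_forest F) (orbit_edges F \<epsilon>)"
  unfolding G_stable_def
proof (intro ballI image_subsetI)
  fix g e assume g: "g \<in> carrier G" and "e \<in> orbit_edges F \<epsilon>"
  then obtain F' p where F': "F' \<in> orbit F" "p \<in> \<epsilon> (snd F')" "e = label F' p" by (auto simp: orbit_edges_def)
  have "gact T g p \<in> \<epsilon> (snd (translate T g F'))"
    using \<epsilon>_equivariant[OF F'(1) g] F'(2) by (simp add: translate_def)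
  moreover have "gact (orbit_forest F) g e = label (translate T g F') (gact T g p)"
    using gact_orbit_forest[OF orbit_faces[OF F'(1)]] F'(3) by simp
  ultimately show "gact (orbit_forest F) g e \<in> orbit_edges F \<epsilon>"
    using translate_orbit[OF F'(1) g] unfolding orbit_edges_def by blast
qed

lemma face_without_orbit_edges:
  assumes V: "V \<in> comps T" and F': "F' \<in> orbit F" "face V F'"
  shows "face_without (face_tree V F') (orbit_edges F \<epsilon>) = (label F' ` (fst F' - \<epsilon> (snd F')), label F' ` (fst F' \<inter> snd F'))"
proof -
  let ?U = "face_tree V F'"
  have "orbit_edges F \<epsilon> \<inter> inner_edges ?U = label F' ` \<epsilon> (snd F')"
    using orbit_edges_Int[OF V F'] unfolding inner_edges_def by blast
  then show ?thesis
    using \<epsilon>_sub[OF F'(1)] by (auto simp: face_without_def face_tree_sel[OF F'(2)])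
qed

text \<open>
  A cell of the copy of \<open>F'\<close> contains the copy without \<open>orbit_edges\<close> iff its image in \<open>T\<close> contains \<open>F'\<close> without
  \<open>\<epsilon> (snd F')\<close>.  The interior taken in the copy only sees edges of \<open>F'\<close>.  That the image in \<open>T\<close> then has all of \<open>snd F'\<close>
  in its interior follows as the root of \<open>F'\<close> and the images of leaves are edges of \<open>F'\<close>.
\<close>

lemma face_without_le_iff:
  assumes V: "V \<in> comps T" and F': "F' \<in> orbit F" "face V F'" and y: "y \<in> tree_maps W (face_tree V F')"
  shows "face_le (face_without (face_tree V F') (orbit_edges F \<epsilon>)) (image_face (face_tree V F') W y) \<longleftrightarrow>
     face_le (fst F' - \<epsilon> (snd F'), snd F') (image_face V W (compose (edges W) unlabel y))"
proof -
  obtain P Q where PQ: "F' = (P, Q)" by fastforce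
  have f': "face V (P, Q)" using F'(2) PQ by simp
  let ?U = "face_tree V F'" and ?x = "compose (edges W) unlabel y" and ?l = "label F'"
  have e: "?x a = unlabel (y a)" if "a \<in> edges W" for a using that by (rule compose_eq)
  have yl: "y a = ?l (?x a)" "?x a \<in> P" if "a \<in> edges W" for a
    using tree_map_edges[OF y that] that e unfolding face_tree_sel[OF F'(2)] by (auto simp: PQ)
  have im: "?l p \<in> y ` edges W \<longleftrightarrow> p \<in> ?x ` edges W" for p
    using yl(1) by (auto simp: image_iff)
  have bel: "below ?U (?l a) (?l b) \<longleftrightarrow> a \<in> P \<and> b \<in> P \<and> below V a b" for a b
    using face_tree_below[OF f'] PQ by simp
  define I where "I = interior V (?x (root W)) (?x ` leaves W)"
  have int: "?l p \<in> interior ?U (y (root W)) (y ` leaves W) \<longleftrightarrow> p \<in> P \<and> p \<in> I" for p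
    using yl leaves_edges[of W] bel unfolding interior_def I_def by (auto simp: subset_iff)
  have "Q \<subseteq> I" if sub: "P \<inter> Q \<subseteq> I"
  proof (cases "Q = {}")
    case False
    obtain t where t: "cut V t (P - Q)" "interior V t (P - Q) = Q" "t \<in> P" using faceE[OF f'] by blast
    have tI: "t \<in> I" using face_root_in[OF t False] t(3) sub by blast
    show ?thesis
    proof
      fix s assume s: "s \<in> Q"
      have "below V (?x (root W)) t" using tI unfolding I_def interior_def by blast
      moreover have "below V t s" using s t(2) unfolding interior_def by blast
      ultimately have "below V (?x (root W)) s" by (rule below_trans)
      moreover have "\<not> below V (?x l) s" if l: "l \<in> leaves W" for l
      proof
        assume ls: "below V (?x l) s"
        have lP: "?x l \<in> P" using yl(2) l leaves_edges by blast
        have "?x l \<in> Q"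
        proof (rule ccontr)
          assume "?x l \<notin> Q"
          then have "?x l \<in> P - Q" using lP by blast
          then show False using s t(2) ls unfolding interior_def by blast
        qed
        then have "?x l \<in> I" using lP sub by blast
        then show False using l below_refl[OF below_edges(1)[OF ls]] unfolding I_def interior_def by blast
      qed
      ultimately show "s \<in> I" unfolding I_def interior_def by blast
    qed
  qed simp
  then have QI: "P \<inter> Q \<subseteq> I \<longleftrightarrow> Q \<subseteq> I" by blast
  have "face_le (face_without ?U (orbit_edges F \<epsilon>)) (image_face ?U W y) \<longleftrightarrow>
      ?l ` (P - \<epsilon> Q) \<subseteq> y ` edges W \<and> ?l ` (P \<inter> Q) \<subseteq> interior ?U (y (root W)) (y ` leaves W)"
    unfolding face_without_orbit_edges[OF V F'] by (simp add: face_le_def image_face_def PQ)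
  also have "\<dots> \<longleftrightarrow> P - \<epsilon> Q \<subseteq> ?x ` edges W \<and> P \<inter> Q \<subseteq> I"
  proof -
    have "?l ` R \<subseteq> y ` edges W \<longleftrightarrow> R \<subseteq> ?x ` edges W" for R
      by (simp add: subset_eq im)
    moreover have "?l ` (P \<inter> Q) \<subseteq> interior ?U (y (root W)) (y ` leaves W) \<longleftrightarrow> P \<inter> Q \<subseteq> I"
      by (simp add: subset_eq int)
    ultimately show ?thesis by simp
  qed
  also have "\<dots> \<longleftrightarrow> face_le (fst F' - \<epsilon> (snd F'), snd F') (image_face V W ?x)"
    using QI by (simp add: face_le_def image_face_def PQ I_def)
  finally show ?thesis .
qed

end

end

end

section \<open>Attaching orbits of faces\<close>

context G_forest
begin

lemma finite_face: "F \<in> faces T \<Longrightarrow> finite (fst F) \<and> finite (snd F)"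
  using faces_edges[of F] finite_forest_edges finite_subset by blast

lemma card_translate:
  assumes "F \<in> faces T" "g \<in> carrier G"
  shows "card (gact T g ` fst F) = card (fst F)" "card (gact T g ` snd F) = card (snd F)"
  using faces_edges[OF assms(1)] act_inj[OF assms(2)] by (meson card_image inj_on_subset)+

text \<open>
  The hypothesis \<open>mem\<close> says that \<open>\<A>\<close> meets each translate \<open>F'\<close> in the horn of \<open>\<epsilon> (snd F')\<close>.  By \<open>face_without_le_iff\<close> the preimage
  of \<open>\<A>\<close> in \<open>\<Omega>[orbit_forest F]\<close> is a horn.  If a cell outside \<open>\<A>\<close> lies in translates \<open>F'\<close> and \<open>F''\<close>, it contains both
  \<open>F'\<close> without \<open>\<epsilon> (snd F')\<close> and \<open>F''\<close> without \<open>\<epsilon> (snd F'')\<close>; so \<open>snd F' = snd F''\<close>, then \<open>\<epsilon>\<close> agrees on the two, and \<open>F' = F''\<close>.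
  Thus new cells have unique preimages and excision applies.
\<close>

lemma attach_orbit:
  fixes K :: "('u cell, 'g) arrow set"
  assumes F: "F \<in> faces T"
    and \<epsilon>_sub: "\<And>F'. F' \<in> orbit F \<Longrightarrow> \<epsilon> (snd F') \<subseteq> fst F' \<inter> snd F'"
    and \<epsilon>_face: "\<And>F'. F' \<in> orbit F \<Longrightarrow> (fst F' - \<epsilon> (snd F'), snd F') \<in> faces T"
    and \<epsilon>_equivariant: "\<And>F' g. F' \<in> orbit F \<Longrightarrow> g \<in> carrier G \<Longrightarrow> \<epsilon> (gact T g ` snd F') = gact T g ` \<epsilon> (snd F')"
    and K: "saturated G K" and A: "sieve \<A>"
    and mem: "\<And>F' F1. F' \<in> orbit F \<Longrightarrow> F1 \<in> faces T \<Longrightarrow> face_le F1 F' \<Longrightarrow>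
      F1 \<in> \<A> \<longleftrightarrow> \<not> face_le (fst F' - \<epsilon> (snd F'), snd F') F1"
    and horn: "(inner_horn (orbit_forest F) (orbit_edges F \<epsilon>), trans_id, representable (orbit_forest F)) \<in> K"
  shows "sieve (\<A> \<union> {F1 \<in> faces T. \<exists>F'\<in>orbit F. face_le F1 F'})"
    and "(face_sub T \<A>, trans_id, face_sub T (\<A> \<union> {F1 \<in> faces T. \<exists>F'\<in>orbit F. face_le F1 F'})) \<in> K"
proof -
  let ?A' = "\<A> \<union> {F1 \<in> faces T. \<exists>F'\<in>orbit F. face_le F1 F'}"
  let ?S = "orbit_forest F" and ?E = "orbit_edges F \<epsilon>"
  note ctx = F \<epsilon>_sub \<epsilon>_face \<epsilon>_equivariant
  show A': "sieve ?A'"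
    unfolding sieve_def
  proof (intro conjI ballI impI)
    show "?A' \<subseteq> faces T" using A by (auto simp: sieve_def)
    fix F1 assume F1: "F1 \<in> ?A'"
    show "F2 \<in> ?A'" if F2: "F2 \<in> faces T" "face_le F2 F1" for F2
      using F1
    proof
      assume "F1 \<in> \<A>" then show ?thesis using A F2 unfolding sieve_def by blast
    next
      assume "F1 \<in> {F1 \<in> faces T. \<exists>F'\<in>orbit F. face_le F1 F'}"
      then show ?thesis using face_le_trans[OF F2(2)] F2(1) by blast
    qed
    show "translate T g F1 \<in> ?A'" if g: "g \<in> carrier G" for g
      using F1
    proof
      assume "F1 \<in> \<A>" then show ?thesis using A g unfolding sieve_def by blast
    next
      assume "F1 \<in> {F1 \<in> faces T. \<exists>F'\<in>orbit F. face_le F1 F'}"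
      then obtain F' where F': "F1 \<in> faces T" "F' \<in> orbit F" "face_le F1 F'" by blast
      show ?thesis
        by (intro UnI2 CollectI conjI bexI[OF _ translate_orbit[OF F F'(2) g]] translate_faces[OF F'(1) g]
            face_le_translate[OF F'(3)])
    qed
  qed
  interpret S: G_forest G ?S
    by unfold_locales (rule G_tree_orbit_forest[OF F])
  have Efe: "?E \<subseteq> forest_edges ?S"
    using orbit_edges_inner[OF ctx] by (auto simp: forest_inner_edges_def forest_edges_def inner_edges_def)
  note Est = orbit_edges_stable[OF ctx]
  have Sh: "S.sieve (horn_faces ?S ?E)" by (rule S.sieve_horn[OF Est Efe])
  define k :: "'u cell trans" where "k = (\<lambda>W. map_sum (\<lambda>y. compose (edges W) unlabel y) id)"
  have SE: "\<exists>V F'. V \<in> comps T \<and> F' \<in> orbit F \<and> face V F' \<and> y \<in> tree_maps W (face_tree V F')"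
    if "y \<in> cells_with_image ?S (faces ?S) W" for y W
  proof -
    from that obtain U where "U \<in> comps ?S" "y \<in> tree_maps W U" by (rule S.cells_with_imageE)
    then show ?thesis unfolding orbit_comps by blast
  qed
  have Scell: "y \<in> cells_with_image ?S (faces ?S) W \<and>
      (y \<in> cells_with_image ?S (horn_faces ?S ?E) W \<longleftrightarrow> compose (edges W) unlabel y \<in> cells_with_image T \<A> W) \<and>
      compose (edges W) unlabel y \<in> cells_with_image T ?A' W"
    if V: "V \<in> comps T" and F': "F' \<in> orbit F" "face V F'" and y: "y \<in> tree_maps W (face_tree V F')" for y V F' W
  proof -
    let ?x = "compose (edges W) unlabel y"
    have U: "face_tree V F' \<in> comps ?S" using V F' orbit_comps by blast
    note x = unlabel_compose[OF F'(2) y]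
    have yf: "face (face_tree V F') (image_face (face_tree V F') W y)" by (rule image_face_face[OF y])
    have xf: "image_face V W ?x \<in> faces T" using image_face_face[OF x(2)] V unfolding faces_def by blast
    have "image_face (face_tree V F') W y \<in> faces ?S" using yf U unfolding faces_def by blast
    then have "y \<in> cells_with_image ?S (faces ?S) W" using S.cells_with_image_iff[OF U y] by blast
    moreover have "y \<in> cells_with_image ?S (horn_faces ?S ?E) W \<longleftrightarrow> ?x \<in> cells_with_image T \<A> W"
      using S.cells_with_image_iff[OF U y, of "horn_faces ?S ?E"] S.horn_faces_iff[OF U yf, of ?E]
        face_without_le_iff[OF ctx V F' y] mem[OF F'(1) xf x(3)] cells_with_image_iff[OF V x(2), of \<A>] by blast
    moreover have "?x \<in> cells_with_image T ?A' W"
      using cells_with_image_iff[OF V x(2), of ?A'] xf x(3) F'(1) by blast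
    ultimately show ?thesis by blast
  qed
  let ?X = "face_sub ?S (faces ?S) :: ('u cell, 'g) gdset"
  let ?H = "face_sub ?S (horn_faces ?S ?E) :: ('u cell, 'g) gdset"
  let ?C = "face_sub T \<A> :: ('u cell, 'g) gdset"
  let ?D = "face_sub T ?A' :: ('u cell, 'g) gdset"
  have kmap: "is_gdmap G ?X ?D k"
    unfolding is_gdmap_def
  proof (intro conjI allI ballI)
    show "is_gdset G ?X" "is_gdset G ?D"
      using S.is_gdset_face_sub[OF S.sieve_faces] is_gdset_face_sub[OF A'] by auto
    show "k W \<in> cells ?X W \<rightarrow> cells ?D W" for W
    proof
      fix z :: "'u cell" assume "z \<in> cells ?X W"
      then obtain y where y: "z = Inl y" "y \<in> cells_with_image ?S (faces ?S) W" by (auto simp: cells_face_sub)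
      obtain V F' where V: "V \<in> comps T" "F' \<in> orbit F" "face V F'" "y \<in> tree_maps W (face_tree V F')"
        using SE[OF y(2)] by blast
      show "k W z \<in> cells ?D W"
        using Scell[OF V] y by (simp add: k_def cells_face_sub)
    qed
    fix W and z :: "'u cell" assume "z \<in> cells ?X W"
    then obtain y where y: "z = Inl y" "y \<in> cells_with_image ?S (faces ?S) W" by (auto simp: cells_face_sub)
    obtain U where U: "U \<in> comps ?S" "y \<in> tree_maps W U" using y(2) by (rule S.cells_with_imageE)
    have ye: "y a \<in> forest_edges ?S" if "a \<in> edges W" for a
      using S.forest_edgeI[OF U(1) tree_map_edges[OF U(2) that]] .
    show "k W (act ?X g W z) = act ?D g W (k W z)" if "g \<in> carrier G" for g
      using ye unlabel_equivariant[OF F] by (auto simp: k_def y(1) face_sub_def subrepresentable_def compose_def)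
    show "k W' (res ?X W' W f z) = res ?D W' W f (k W z)"
      if "f \<in> tree_maps W' W" for W' f
      using tree_map_edges[OF that] by (auto simp: k_def y(1) face_sub_def subrepresentable_def compose_def)
  qed
  have "is_pushout G ?H ?X ?C ?D
      trans_id k k trans_id"
  proof (rule pushout_of_excision)
    show "is_gdmap G ?H ?X trans_id"
      by (rule S.face_sub_inclusion[OF Sh S.sieve_faces]) (auto simp: horn_faces_def)
    show "is_gdmap G ?C ?D trans_id"
      by (rule face_sub_inclusion[OF A A']) auto
    show "is_gdmap G ?X ?D k" by (rule kmap)
    fix W
    have hf: "cells_with_image ?S (horn_faces ?S ?E) W \<subseteq> cells_with_image ?S (faces ?S) W"
      by (auto simp: cells_with_image_def horn_faces_def)
    have "y \<in> cells_with_image ?S (horn_faces ?S ?E) W \<longleftrightarrow> compose (edges W) unlabel y \<in> cells_with_image T \<A> W"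
      if y: "y \<in> cells_with_image ?S (faces ?S) W" for y
    proof -
      obtain V F' where V: "V \<in> comps T" "F' \<in> orbit F" "face V F'" "y \<in> tree_maps W (face_tree V F')"
        using SE[OF y] by blast
      show ?thesis using Scell[OF V] by blast
    qed
    then show "cells ?H W
        = {z \<in> cells ?X W. k W z \<in> cells ?C W}"
      using hf by (auto simp: cells_face_sub k_def)
    show "cells ?D W \<subseteq> cells ?C W \<union> k W ` cells ?X W"
    proof
      fix z :: "'u cell" assume "z \<in> cells ?D W"
      then obtain x where x: "z = Inl x" "x \<in> cells_with_image T ?A' W" by (auto simp: cells_face_sub)
      obtain V where V: "V \<in> comps T" "x \<in> tree_maps W V" "image_face V W x \<in> ?A'" using x(2) by (rule cells_with_imageE)
      from V(3) show "z \<in> cells ?C W \<union> k W ` cells ?X W"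
      proof
        assume "image_face V W x \<in> \<A>"
        then have "x \<in> cells_with_image T \<A> W" using cells_with_imageI V by blast
        then show ?thesis by (simp add: x(1) cells_face_sub)
      next
        assume "image_face V W x \<in> {F1 \<in> faces T. \<exists>F'\<in>orbit F. face_le F1 F'}"
        then obtain F' where F': "F' \<in> orbit F" "face_le (image_face V W x) F'" by blast
        obtain V' where V': "V' \<in> comps T" "face V' F'" using orbit_faces[OF F F'(1)] unfolding faces_def by blast
        have "V = V'"
          using face_comp_unique[OF V'(1) V(1) V'(2) image_face_face[OF V(2)]] F'(2) by (simp add: face_le_def)
        then obtain y where y: "y \<in> tree_maps W (face_tree V' F')" "x = compose (edges W) unlabel y"
          using lift_cell[OF V'(2) _ F'(2)[unfolded \<open>V = V'\<close>]] V(2) by blast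
        have "Inl y \<in> cells ?X W"
          using Scell[OF V'(1) F'(1) V'(2) y(1)] by (simp add: cells_face_sub)
        moreover have "z = k W (Inl y)" by (simp add: x(1) y(2) k_def)
        ultimately show ?thesis by blast
      qed
    qed
    fix z z' :: "'u cell" assume z: "z \<in> cells ?X W" "z' \<in> cells ?X W"
      and eq: "k W z = k W z'" and nA: "k W z \<notin> cells ?C W"
    obtain y y' where y: "z = Inl y" "y \<in> cells_with_image ?S (faces ?S) W"
        "z' = Inl y'" "y' \<in> cells_with_image ?S (faces ?S) W"
      using z by (auto simp: cells_face_sub)
    obtain V F' where V: "V \<in> comps T" "F' \<in> orbit F" "face V F'" "y \<in> tree_maps W (face_tree V F')"
      using SE[OF y(2)] by blast
    obtain V' F'' where V': "V' \<in> comps T" "F'' \<in> orbit F" "face V' F''" "y' \<in> tree_maps W (face_tree V' F'')"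
      using SE[OF y(4)] by blast
    let ?x = "compose (edges W) unlabel y"
    have xx: "?x = compose (edges W) unlabel y'" using eq y by (simp add: k_def)
    have xA: "?x \<notin> cells_with_image T \<A> W" using nA y by (auto simp: k_def cells_face_sub)
    note x = unlabel_compose[OF V(3,4)] and x' = unlabel_compose[OF V'(3,4), folded xx]
    have VV: "V' = V"
      by (rule comps_eq[OF V'(1) V(1) tree_map_edges[OF x'(2) root_edges] tree_map_edges[OF x(2) root_edges]])
    let ?I = "image_face V W ?x"
    have I: "?I \<in> faces T" "?I \<notin> \<A>"
      using image_face_face[OF x(2)] V(1) xA cells_with_image_iff[OF V(1) x(2)] unfolding faces_def by blast+
    have le: "face_le ?I F'" "face_le ?I F''" using x(3) x'(3) VV by simp_all
    have ge: "face_le (fst F' - \<epsilon> (snd F'), snd F') ?I" "face_le (fst F'' - \<epsilon> (snd F''), snd F'') ?I"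
      using mem[OF V(2) I(1) le(1)] mem[OF V'(2) I(1) le(2)] I(2) by blast+
    have Q: "snd F' = snd F''" using le ge by (auto simp: face_le_def)
    have "fst F' \<subseteq> fst F''" "fst F'' \<subseteq> fst F'"
      using le ge \<epsilon>_sub[OF V(2)] \<epsilon>_sub[OF V'(2)] unfolding face_le_def Q fst_conv by blast+
    then have "F' = F''" using Q by (simp add: prod_eq_iff)
    then show "z = z'" using unlabel_cell_inj[OF V(3,4) _ xx] V'(4) VV y by simp
  qed
  moreover have "(?H, trans_id, ?X) \<in> K"
    using horn by (simp add: S.inner_horn_face_sub[OF Est Efe] representable_face_sub)
  ultimately show "(?C, trans_id, ?D) \<in> K"
    using K unfolding saturated_def closed_pushouts_def by blast
qed

text \<open>
  Induction on the number of faces in \<open>\<B>\<close> but not in \<open>\<A>\<close>, with a step that attaches the orbit of one face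
  of the form \<open>(P\<^sub>0 \<union> \<epsilon> Q, Q)\<close>.  The conditions on \<open>\<epsilon>\<close> survive the step: if deleting \<open>\<epsilon> Q'\<close> from \<open>(P, Q')\<close> leads to a new
  face of a translate \<open>F'\<close>, then \<open>Q' = snd F'\<close> by minimality, so \<open>\<epsilon> Q'\<close> consists of edges of \<open>F'\<close> and
  \<open>(P, Q')\<close> is itself a face of \<open>F'\<close>.
\<close>

theorem sieve_extension:
  fixes K :: "('u cell, 'g) arrow set"
  assumes K: "saturated G K" and B: "sieve \<B>"
    and "sieve \<A>" "\<A> \<subseteq> \<B>"
    and "\<And>P Q. (P, Q) \<in> \<B> - \<A> \<Longrightarrow> \<epsilon> Q \<subseteq> Q"
    and "\<And>P Q. (P, Q) \<in> \<B> - \<A> \<Longrightarrow> (P - \<epsilon> Q, Q) \<in> \<B> - \<A>"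
    and "\<And>P Q. (P, Q) \<in> \<B> - \<A> \<Longrightarrow> (P \<union> \<epsilon> Q, Q) \<in> \<B>"
    and "\<And>P Q g. (P, Q) \<in> \<B> - \<A> \<Longrightarrow> g \<in> carrier G \<Longrightarrow> \<epsilon> (gact T g ` Q) = gact T g ` \<epsilon> Q"
    and "\<And>P Q. (P, Q) \<in> \<B> - \<A> \<Longrightarrow> \<epsilon> Q \<subseteq> P \<Longrightarrow>
      (inner_horn (orbit_forest (P, Q)) (orbit_edges (P, Q) \<epsilon>), trans_id, representable (orbit_forest (P, Q))) \<in> K"
  shows "(face_sub T \<A>, trans_id, face_sub T \<B>) \<in> K"
  using assms(3-)
proof (induction "card (\<B> - \<A>)" arbitrary: \<A> rule: less_induct)
  case less
  note A = less.prems(1) and AB = less.prems(2) and sub = less.prems(3) and down = less.prems(4)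
    and up = less.prems(5) and eqv = less.prems(6) and horn = less.prems(7)
  let ?D = "\<B> - \<A>"
  have Bf: "\<B> \<subseteq> faces T" using B by (simp add: sieve_def)
  have fin: "finite ?D" using finite_subset[OF Bf finite_faces] by simp
  show ?case
  proof (cases "?D = {}")
    case True
    then have "\<A> = \<B>" using AB by blast
    then show ?thesis using saturated_id[OF K is_gdset_face_sub[OF B]] by simp
  next
    case False
    then obtain F1 where F1: "F1 \<in> ?D" and m1: "\<And>F. F \<in> ?D \<Longrightarrow> card (snd F1) \<le> card (snd F)"
      using ex_has_least_nat[of "\<lambda>F. F \<in> ?D" _ "\<lambda>F. card (snd F)"] by blast
    obtain F0 where F0: "F0 \<in> ?D" "card (snd F0) = card (snd F1)"
      and m2: "\<And>F. F \<in> ?D \<Longrightarrow> card (snd F) = card (snd F1) \<Longrightarrow> card (fst F0) \<le> card (fst F)"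
      using ex_has_least_nat[of "\<lambda>F. F \<in> ?D \<and> card (snd F) = card (snd F1)" F1 "\<lambda>F. card (fst F)"] F1 by blast
    obtain P0 Q where PQ: "F0 = (P0, Q)" by fastforce
    have D0: "(P0, Q) \<in> ?D" and m1: "\<And>F. F \<in> ?D \<Longrightarrow> card Q \<le> card (snd F)"
      and m2: "\<And>F. F \<in> ?D \<Longrightarrow> card (snd F) = card Q \<Longrightarrow> card P0 \<le> card (fst F)"
      using F0 m1 m2 PQ by auto
    have f0: "(P0, Q) \<in> faces T" using D0 Bf by blast
    have fin0: "finite P0" "finite Q" using finite_face[OF f0] by auto
    \<comment> \<open>Otherwise deleting \<open>\<epsilon> Q\<close> would contradict the minimality of \<open>P0\<close>.\<close>
    have disj: "P0 \<inter> \<epsilon> Q = {}"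
    proof -
      have "card P0 \<le> card (P0 - \<epsilon> Q)" using m2[OF down[OF D0]] by simp
      then have "P0 - \<epsilon> Q = P0" using card_subset_eq[OF fin0(1), of "P0 - \<epsilon> Q"] card_mono[OF fin0(1), of "P0 - \<epsilon> Q"] by auto
      then show ?thesis by blast
    qed
    \<comment> \<open>The face to be attached; \<open>(P0, Q)\<close> is this face without \<open>\<epsilon> Q\<close>.\<close>
    define F where "F = (P0 \<union> \<epsilon> Q, Q)"
    have FD: "F \<in> ?D"
    proof -
      have "F \<in> \<A> \<Longrightarrow> (P0, Q) \<in> \<A>" using A f0 unfolding sieve_def by (force simp: F_def face_le_def)
      then show ?thesis using up[OF D0] D0 by (auto simp: F_def)
    qed
    then have Ff: "F \<in> faces T" using Bf by blast
    have trD: "translate T g F' \<in> ?D" if "F' \<in> ?D" "g \<in> carrier G" for F' g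
      using that sieve_translate_iff[OF A] sieve_translate_iff[OF B] Bf by blast
    have orb: "\<exists>g\<in>carrier G. F' = translate T g F \<and> \<epsilon> (snd F') = gact T g ` \<epsilon> Q \<and>
        snd F' = gact T g ` Q \<and> (fst F' - \<epsilon> (snd F'), snd F') = translate T g (P0, Q)"
      if "F' \<in> orbit F" for F'
    proof -
      obtain g where g: "g \<in> carrier G" "F' = translate T g F" using \<open>F' \<in> orbit F\<close> by (auto simp: orbit_def)
      have e: "\<epsilon> (snd F') = gact T g ` \<epsilon> Q" using eqv[OF D0 g(1)] g(2) by (simp add: F_def translate_def)
      have "gact T g ` (P0 \<union> \<epsilon> Q) - gact T g ` \<epsilon> Q = gact T g ` ((P0 \<union> \<epsilon> Q) - \<epsilon> Q)"
        by (rule inj_on_image_set_diff[OF act_inj[OF g(1)], symmetric])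
           (use faces_edges[OF Ff] sub[OF D0] in \<open>auto simp: F_def\<close>)
      moreover have "(P0 \<union> \<epsilon> Q) - \<epsilon> Q = P0" using disj by blast
      ultimately show ?thesis using g e by (intro bexI[of _ g]) (auto simp: F_def translate_def)
    qed
    have orbD: "F' \<in> ?D" if "F' \<in> orbit F" for F' using orb[OF that] trD[OF FD] by blast
    have mem: "F2 \<in> \<A> \<longleftrightarrow> \<not> face_le (fst F' - \<epsilon> (snd F'), snd F') F2"
      and memQ: "F2 \<notin> \<A> \<Longrightarrow> snd F2 = snd F'"
      if F': "F' \<in> orbit F" and F2: "F2 \<in> faces T" "face_le F2 F'" for F' F2
    proof -
      obtain g where g: "g \<in> carrier G" "snd F' = gact T g ` Q" "\<epsilon> (snd F') = gact T g ` \<epsilon> Q"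
        and F0': "(fst F' - \<epsilon> (snd F'), snd F') = translate T g (P0, Q)" using orb[OF F'] by blast
      have F2B: "F2 \<in> \<B>" using B orbD[OF F'] F2 unfolding sieve_def by blast
      have nA: "face_le (fst F' - \<epsilon> (snd F'), snd F') F2 \<and> snd F2 = snd F'" if "F2 \<notin> \<A>"
      proof -
        obtain P2 Q2 where PQ2: "F2 = (P2, Q2)" by fastforce
        have F2D: "(P2, Q2) \<in> ?D" using F2B that PQ2 by simp
        have finF': "finite (fst F')" "finite (snd F')" using finite_face orbD[OF F'] Bf by blast+
        \<comment> \<open>Translates of \<open>(P0, Q)\<close> are minimal as well, because minimality is a matter of cardinalities.\<close>
        have "card (snd F') = card Q" using card_translate(2)[OF f0 g(1)] g(2) by simp
        then have Q2: "Q2 = snd F'"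
          using card_seteq[OF finF'(2), of Q2] m1[OF F2D] F2(2) by (simp add: PQ2 face_le_def)
        have "card P0 \<le> card (P2 - \<epsilon> Q2)"
          using m2[OF down[OF F2D]] Q2 \<open>card (snd F') = card Q\<close> by simp
        moreover have "card (fst F' - \<epsilon> (snd F')) = card P0"
        proof -
          have "fst F' - \<epsilon> (snd F') = gact T g ` P0" using F0' unfolding translate_def by (metis fst_conv)
          then show ?thesis using card_translate(1)[OF f0 g(1)] by (metis fst_conv)
        qed
        moreover have "P2 - \<epsilon> Q2 \<subseteq> fst F' - \<epsilon> (snd F')" using F2(2) Q2 by (auto simp: PQ2 face_le_def)
        ultimately have "P2 - \<epsilon> Q2 = fst F' - \<epsilon> (snd F')"
          using card_seteq[of "fst F' - \<epsilon> (snd F')" "P2 - \<epsilon> Q2"] finF'(1) by simp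
        then show ?thesis using Q2 by (auto simp: PQ2 face_le_def)
      qed
      have "\<not> face_le (fst F' - \<epsilon> (snd F'), snd F') F2" if "F2 \<in> \<A>"
      proof
        assume "face_le (fst F' - \<epsilon> (snd F'), snd F') F2"
        then have "translate T g (P0, Q) \<in> \<A>"
          using A that translate_faces[OF f0 g(1)] unfolding sieve_def F0' by blast
        then show False using sieve_translate_iff[OF A f0 g(1)] D0 by blast
      qed
      with nA show "F2 \<in> \<A> \<longleftrightarrow> \<not> face_le (fst F' - \<epsilon> (snd F'), snd F') F2" by blast
      show "snd F2 = snd F'" if "F2 \<notin> \<A>" using nA[OF that] by blast
    qed
    have esub: "\<epsilon> (snd F') \<subseteq> fst F' \<inter> snd F'" if F': "F' \<in> orbit F" for F'
    proof -
      obtain g where "F' = translate T g F" "\<epsilon> (snd F') = gact T g ` \<epsilon> Q" using orb[OF F'] by blast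
      then show ?thesis using image_mono[OF sub[OF D0], of "gact T g"] by (auto simp: F_def translate_def)
    qed
    define A' where "A' = \<A> \<union> {F1 \<in> faces T. \<exists>F'\<in>orbit F. face_le F1 F'}"
    have step: "sieve A'" "(face_sub T \<A>, trans_id, face_sub T A') \<in> K"
    proof -
      have ef: "(fst F' - \<epsilon> (snd F'), snd F') \<in> faces T" if "F' \<in> orbit F" for F'
        using orb[OF that] translate_faces[OF f0] by metis
      have ee: "\<epsilon> (gact T g ` snd F') = gact T g ` \<epsilon> (snd F')" if "F' \<in> orbit F" "g \<in> carrier G" for F' g
        using eqv[of "fst F'" "snd F'" g] orbD[OF that(1)] that(2) by simp
      have h: "(inner_horn (orbit_forest F) (orbit_edges F \<epsilon>), trans_id, representable (orbit_forest F)) \<in> K"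
        using horn[of "fst F" "snd F"] FD by (simp add: F_def)
      show "sieve A'" "(face_sub T \<A>, trans_id, face_sub T A') \<in> K"
        using attach_orbit[OF Ff esub ef ee K A mem h] unfolding A'_def by blast+
    qed
    have A'B: "A' \<subseteq> \<B>" using AB orbD B unfolding A'_def sieve_def by blast
    have AA': "\<A> \<subseteq> A'" by (auto simp: A'_def)
    have "F \<in> A'" using orbit_self[OF Ff] Ff face_le_refl unfolding A'_def by blast
    then have "\<B> - A' \<subset> ?D" using FD AA' by blast
    then have card: "card (\<B> - A') < card ?D" using fin by (rule psubset_card_mono[rotated])
    have "(face_sub T A', trans_id, face_sub T \<B>) \<in> K"
    proof (rule less.hyps[OF card step(1) A'B])
      fix P Q' assume PQ': "(P, Q') \<in> \<B> - A'"
      then have PD: "(P, Q') \<in> ?D" using AA' by blast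
      show "\<epsilon> Q' \<subseteq> Q'" "(P \<union> \<epsilon> Q', Q') \<in> \<B>" using sub[OF PD] up[OF PD] by auto
      show "(P - \<epsilon> Q', Q') \<in> \<B> - A'"
      proof (rule ccontr)
        assume n: "(P - \<epsilon> Q', Q') \<notin> \<B> - A'"
        have d: "(P - \<epsilon> Q', Q') \<in> ?D" by (rule down[OF PD])
        then obtain F' where F': "F' \<in> orbit F" "face_le (P - \<epsilon> Q', Q') F'" using n unfolding A'_def by blast
        have "Q' = snd F'" using memQ[OF F'(1) _ F'(2)] d Bf by auto
        then have "face_le (P, Q') F'" using F'(2) esub[OF F'(1)] by (auto simp: face_le_def)
        then have "(P, Q') \<in> A'" using F'(1) PD Bf unfolding A'_def by blast
        then show False using PQ' by blast
      qed
      show "\<epsilon> (gact T g ` Q') = gact T g ` \<epsilon> Q'" if "g \<in> carrier G" for g using eqv[OF PD that] .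
      show "(inner_horn (orbit_forest (P, Q')) (orbit_edges (P, Q') \<epsilon>), trans_id, representable (orbit_forest (P, Q'))) \<in> K"
        if "\<epsilon> Q' \<subseteq> P" using horn[OF PD that] .
    qed
    from saturated_comp[OF K step(2) this] show ?thesis by simp
  qed
qed

end

section \<open>Orbital horns\<close>

text \<open>
  As \<open>face\<close>, with the root made explicit.
\<close>

definition rooted_face :: "tree \<Rightarrow> edge \<Rightarrow> face \<Rightarrow> bool" where
  "rooted_face V t F \<longleftrightarrow> cut V t (fst F - snd F) \<and> interior V t (fst F - snd F) = snd F \<and> t \<in> fst F"

lemma face_rooted: "face V F \<longleftrightarrow> (\<exists>t. rooted_face V t F)"
proof
  assume "face V F"
  then have "face V (fst F, snd F)" by simp
  then show "\<exists>t. rooted_face V t F" unfolding rooted_face_def by (rule faceE) blast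
next
  assume "\<exists>t. rooted_face V t F"
  then show "face V F" unfolding rooted_face_def using faceI[of V _ "fst F" "snd F"] by auto
qed

text \<open>
  Subtrees with a common root have a union that is again a subtree, and likewise for faces.  Its leaves are those edges
  that are not interior to any of the faces.  An edge above the root and outside all the interiors has a leaf of each
  face below it; the highest of these leaves is a leaf of the union.
\<close>

lemma rooted_face_Union:
  assumes ne: "\<F> \<noteq> {}" and rf: "\<And>F. F \<in> \<F> \<Longrightarrow> rooted_face V t F"
  shows "rooted_face V t (\<Union>(fst ` \<F>), \<Union>(snd ` \<F>))"
proof -
  let ?P = "\<Union>(fst ` \<F>)" and ?Q = "\<Union>(snd ` \<F>)"
  let ?L = "?P - ?Q"
  have c: "cut V t (fst F - snd F)" "interior V t (fst F - snd F) = snd F" "t \<in> fst F" if "F \<in> \<F>" for F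
    using rf[OF that] by (auto simp: rooted_face_def)
  have te: "t \<in> edges V" using c(1) ne cut_edges by blast
  have tb: "below V t p" if p: "p \<in> fst F" "F \<in> \<F>" for p F
    using face_root_below[OF c(1,2)[OF p(2)] p(1) c(3)[OF p(2)]] .
  have leafy: "\<exists>b\<in>fst F - snd F. below V b s" if "F \<in> \<F>" "s \<notin> snd F" "below V t s" for F s
    using c(2)[OF that(1)] that(2,3) unfolding interior_def by blast
  have nleaf: "\<not> below V b s" if "F \<in> \<F>" "s \<in> snd F" "b \<in> fst F - snd F" for F s b
    using c(2)[OF that(1)] that(2,3) unfolding interior_def by blast
  have cover: "\<exists>b\<in>?L. below V b s" if s: "below V t s" "s \<notin> ?Q" for s
  proof -
    let ?B = "{b. below V b s \<and> (\<exists>F\<in>\<F>. b \<in> fst F - snd F)}"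
    have "?B \<subseteq> edges V" using below_edges(1) by blast
    then have "finite ?B" using tree_props(1) finite_subset by blast
    moreover have "?B \<noteq> {}" using ne leafy s by blast
    ultimately obtain b where b: "b \<in> ?B" and mx: "\<And>a. a \<in> ?B \<Longrightarrow> card {u. below V u a} \<le> card {u. below V u b}"
      using finite_has_max_on[of ?B "\<lambda>b. card {u. below V u b}"] by blast
    have "b \<notin> snd F" if F: "F \<in> \<F>" for F
    proof
      assume bF: "b \<in> snd F"
      obtain a where a: "a \<in> fst F - snd F" "below V a s" using leafy[OF F _ s(1)] s(2) F by blast
      have "\<not> below V a b" by (rule nleaf[OF F bF a(1)])
      then have ba: "below V b a" using below_comparable[OF a(2)] b by blast
      have "{u. below V u b} \<subset> {u. below V u a}"
        using below_trans[OF _ ba] below_refl[OF below_edges(2)[OF ba]] \<open>\<not> below V a b\<close> by blast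
      then have "card {u. below V u b} < card {u. below V u a}" by (rule psubset_card_mono[OF finite_below])
      then show False using mx[of a] a F by fastforce
    qed
    then show ?thesis using b by blast
  qed
  have "interior V t ?L = ?Q"
  proof (intro equalityI subsetI)
    fix s assume "s \<in> interior V t ?L"
    then show "s \<in> ?Q" using cover unfolding interior_def by blast
  next
    fix s assume "s \<in> ?Q"
    then obtain F where F: "F \<in> \<F>" "s \<in> snd F" by blast
    then have "below V t s" using c(2)[OF F(1)] unfolding interior_def by blast
    moreover have "\<not> below V a s" if a: "a \<in> ?L" for a
    proof
      assume as: "below V a s"
      have "below V t a" "a \<notin> snd F" using a tb F(1) by auto
      then obtain b where "b \<in> fst F - snd F" "below V b a" using leafy[OF F(1)] by blast
      then show False using nleaf[OF F] below_trans[OF _ as] by blast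
    qed
    ultimately show "s \<in> interior V t ?L" unfolding interior_def by blast
  qed
  moreover have "cut V t ?L"
    unfolding cut_def
  proof (intro conjI ballI impI)
    show "below V t a" if "a \<in> ?L" for a using that tb by blast
    show "a = b" if a: "a \<in> ?L" and b: "b \<in> ?L" and ab: "below V a b" for a b
    proof -
      obtain F where F: "F \<in> \<F>" "b \<in> fst F - snd F" using b by blast
      have "below V t a" "a \<notin> snd F" using a tb F(1) by auto
      then obtain d where d: "d \<in> fst F - snd F" "below V d a" using leafy[OF F(1)] by blast
      then have "d = b" using c(1)[OF F(1)] F(2) below_trans[OF d(2) ab] unfolding cut_def by blast
      then show ?thesis using d ab below_antisym by blast
    qed
    show "\<exists>a\<in>?L. below V a l" if l: "l \<in> leaves V" "below V t l" for l
    proof (rule cover[OF l(2)])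
      show "l \<notin> ?Q" using interior_nonleaf[OF c(1)] c(2) l(1) by blast
    qed
  qed (rule te)
  moreover have "t \<in> ?P" using ne c(3) by blast
  ultimately show ?thesis by (simp add: rooted_face_def)
qed

context G_forest
begin

text \<open>
  The translates of the face together contain \<open>T - E\<close>.
\<close>

definition orbit_covers :: "edge set \<Rightarrow> face \<Rightarrow> bool" where
  "orbit_covers E F \<longleftrightarrow> forest_edges T - E \<subseteq> (\<Union>g\<in>carrier G. gact T g ` fst F) \<and>
     (\<Union>V\<in>comps T. edges V - leaves V) \<subseteq> (\<Union>g\<in>carrier G. gact T g ` snd F)"

text \<open>
  The faces whose orbital hull does not contain \<open>T - E\<close>; see \<open>orbital_inner_horn_face_sub\<close>.
\<close>

definition orbital_faces :: "edge set \<Rightarrow> face set" where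
  "orbital_faces E = {F \<in> faces T. \<not> orbit_covers E F}"

lemma orbit_covers_mono:
  assumes "face_le F' F" "orbit_covers E F'" shows "orbit_covers E F"
proof -
  have "(\<Union>g\<in>carrier G. gact T g ` fst F') \<subseteq> (\<Union>g\<in>carrier G. gact T g ` fst F)"
    "(\<Union>g\<in>carrier G. gact T g ` snd F') \<subseteq> (\<Union>g\<in>carrier G. gact T g ` snd F)"
    using assms(1) unfolding face_le_def by blast+
  then show ?thesis using assms(2) unfolding orbit_covers_def by (meson subset_trans)
qed

lemma union_translates:
  assumes X: "X \<subseteq> forest_edges T" and h: "h \<in> carrier G"
  shows "(\<Union>g\<in>carrier G. gact T g ` gact T h ` X) = (\<Union>g\<in>carrier G. gact T g ` X)"
proof (intro equalityI subsetI)
  fix e assume "e \<in> (\<Union>g\<in>carrier G. gact T g ` gact T h ` X)"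
  then obtain g p where g: "g \<in> carrier G" "p \<in> X" "e = gact T g (gact T h p)" by blast
  then have "e = gact T (g \<otimes> h) p" using act_mult[OF g(1) h] X by auto
  then show "e \<in> (\<Union>g\<in>carrier G. gact T g ` X)" using g h by blast
next
  fix e assume "e \<in> (\<Union>g\<in>carrier G. gact T g ` X)"
  then obtain g p where g: "g \<in> carrier G" "p \<in> X" "e = gact T g p" by blast
  have pe: "p \<in> forest_edges T" using g X by blast
  have "e = gact T (g \<otimes> inv h) (gact T h p)"
    using act_mult[of g "inv h" "gact T h p"] act_inv[OF h pe] act_forest_edge[OF h pe] g h by simp
  then show "e \<in> (\<Union>g\<in>carrier G. gact T g ` gact T h ` X)" using g h by blast
qed

lemma sieve_orbital: "sieve (orbital_faces E)"
  unfolding sieve_def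
proof (intro conjI ballI impI)
  show "orbital_faces E \<subseteq> faces T" by (auto simp: orbital_faces_def)
  show "F' \<in> orbital_faces E" if "F \<in> orbital_faces E" "F' \<in> faces T" "face_le F' F" for F F'
    using that orbit_covers_mono unfolding orbital_faces_def by blast
  fix F g assume F: "F \<in> orbital_faces E" and g: "g \<in> carrier G"
  then have f: "F \<in> faces T" by (simp add: orbital_faces_def)
  show "translate T g F \<in> orbital_faces E"
    using F translate_faces[OF f g] union_translates[OF _ g, of "fst F"] union_translates[OF _ g, of "snd F"] faces_edges[OF f]
    by (simp add: orbital_faces_def orbit_covers_def translate_def)
qed

text \<open>
  The number of elements below an edge is preserved by the action, and the elements below a given edge form
  a chain; so distinct translates of an edge are incomparable.
\<close>

lemma below_translate_eq:
  assumes k: "k \<in> carrier G" and V: "V \<in> comps T" and u: "below V u (gact T k u) \<or> below V (gact T k u) u"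
  shows "gact T k u = u"
proof -
  let ?w = "gact T k u"
  have e: "u \<in> edges V" "?w \<in> edges V" using u below_edges by blast+
  have kV: "carries k V V" by (rule act_tree_map[OF k V V e])
  \<comment> \<open>The elements below \<open>u\<close> and \<open>k u\<close> are equal in number, so an inclusion between them is an equality.\<close>
  have D: "{t. below V t ?w} = gact T k ` {t. below V t u}"
  proof (intro equalityI subsetI)
    fix t assume t: "t \<in> {t. below V t ?w}"
    then have "t \<in> edges V" using below_edges by blast
    then obtain s where s: "s \<in> edges V" "t = gact T k s" using act_image_edges[OF k V V kV] by blast
    then show "t \<in> gact T k ` {t. below V t u}" using t act_below_iff[OF k V V kV s(1) e(1)] by blast
  next
    fix t assume "t \<in> gact T k ` {t. below V t u}"
    then obtain s where s: "below V s u" "t = gact T k s" by blast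
    then show "t \<in> {t. below V t ?w}" using act_below_iff[OF k V V kV below_edges(1)[OF s(1)] e(1)] by simp
  qed
  have sub: "{t. below V t u} \<subseteq> edges V" using below_edges(1) by blast
  have card: "card {t. below V t ?w} = card {t. below V t u}"
    unfolding D using card_image[OF inj_on_subset[OF act_inj_tree[OF k V V kV] sub]] .
  have "{t. below V t u} = {t. below V t ?w}"
    using u
  proof
    assume "below V u ?w"
    then have "{t. below V t u} \<subseteq> {t. below V t ?w}" using below_trans by blast
    then show ?thesis using card_subset_eq[OF finite_below _ card[symmetric]] by blast
  next
    assume "below V ?w u"
    then have "{t. below V t ?w} \<subseteq> {t. below V t u}" using below_trans by blast
    then show ?thesis using card_subset_eq[OF finite_below _ card] by blast
  qed
  then have "below V u ?w" "below V ?w u" using below_refl[OF e(1)] below_refl[OF e(2)] by blast+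
  then show ?thesis using below_antisym by blast
qed

lemma translate_rooted_face:
  assumes g: "g \<in> carrier G" and V: "V \<in> comps T" and V': "V' \<in> comps T"
    and gV: "carries g V V'" and F: "rooted_face V t F"
  shows "rooted_face V' (gact T g t) (translate T g F)"
proof -
  have c: "cut V t (fst F - snd F)" "interior V t (fst F - snd F) = snd F" "t \<in> fst F"
    using F by (auto simp: rooted_face_def)
  have f: "face V F" using F face_rooted by blast
  have e: "fst F \<subseteq> edges V" "snd F \<subseteq> edges V" using face_edges[of V "fst F" "snd F"] f by auto
  have L: "fst F - snd F \<subseteq> edges V" "t \<in> edges V" using e c by auto
  have d: "gact T g ` (fst F - snd F) = gact T g ` fst F - gact T g ` snd F"
    by (rule inj_on_image_set_diff[OF act_inj_tree[OF g V V' gV]]) (use e in auto)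
  have "restrict (gact T g) (edges V) ` (fst F - snd F) = gact T g ` (fst F - snd F)" using L by (intro image_cong) auto
  then have "cut V' (gact T g t) (gact T g ` (fst F - snd F))" using tree_map_cut[OF gV c(1)] L by simp
  then show ?thesis
    using act_interior[OF g V V' gV L(2,1)] c by (simp add: rooted_face_def translate_def d)
qed

definition stabilizer :: "edge \<Rightarrow> 'g set" where
  "stabilizer t = {g \<in> carrier G. gact T g t = t}"

text \<open>
  The component at \<open>F\<close> of the smallest orbital face that contains \<open>F\<close>, for \<open>F\<close> with root \<open>t\<close>.  Translates of \<open>F\<close> with different
  roots have no edge in common, by \<open>below_translate_eq\<close>; so only the translates with root \<open>t\<close> have to be merged with \<open>F\<close>.
\<close>

definition orbital_hull :: "edge \<Rightarrow> face \<Rightarrow> face" where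
  "orbital_hull t F = (\<Union>g\<in>stabilizer t. gact T g ` fst F, \<Union>g\<in>stabilizer t. gact T g ` snd F)"

context
  fixes V t F assumes V: "V \<in> comps T" and F: "rooted_face V t F"
begin

lemma root_of_rooted_face: "t \<in> edges V"
  using F cut_edges unfolding rooted_face_def by blast

lemma face_of_rooted_face: "face V F" "F \<in> faces T"
  using F V face_rooted unfolding faces_def by blast+

lemma orbital_hull_rooted: "rooted_face V t (orbital_hull t F)"
proof -
  have r: "rooted_face V t (translate T g F)" if g: "g \<in> stabilizer t" for g
  proof -
    have g': "g \<in> carrier G" "gact T g t = t" using g by (auto simp: stabilizer_def)
    have "carries g V V"
      using act_tree_map[OF g'(1) V V root_of_rooted_face] g'(2) root_of_rooted_face by simp
    then show ?thesis using translate_rooted_face[OF g'(1) V V _ F] g'(2) by simp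
  qed
  have "\<one> \<in> stabilizer t" using act_one[OF forest_edgeI[OF V root_of_rooted_face]] by (simp add: stabilizer_def)
  then have "(\<lambda>g. translate T g F) ` stabilizer t \<noteq> {}" by blast
  from rooted_face_Union[OF this, of V t] r show ?thesis
    by (auto simp: orbital_hull_def translate_def image_image)
qed

lemma orbital_hull_ge: "face_le F (orbital_hull t F)"
proof -
  have 1: "\<one> \<in> stabilizer t" using act_one[OF forest_edgeI[OF V root_of_rooted_face]] by (simp add: stabilizer_def)
  have "gact T \<one> ` fst F = fst F" "gact T \<one> ` snd F = snd F"
    using translate_one[OF face_of_rooted_face(2)] by (auto simp: translate_def prod_eq_iff)
  then show ?thesis using 1 unfolding face_le_def orbital_hull_def fst_conv snd_conv by blast
qed

lemma hull_faces: "orbital_hull t F \<in> faces T"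
  using orbital_hull_rooted V face_rooted unfolding faces_def by blast

lemma translate_hull:
  assumes k: "k \<in> stabilizer t" shows "translate T k (orbital_hull t F) = orbital_hull t F"
proof -
  have k': "k \<in> carrier G" "gact T k t = t" using k by (auto simp: stabilizer_def)
  have te: "t \<in> forest_edges T" using forest_edgeI[OF V root_of_rooted_face] .
  have "gact T k ` (\<Union>g\<in>stabilizer t. gact T g ` X) = (\<Union>g\<in>stabilizer t. gact T g ` X)"
    if X: "X \<subseteq> forest_edges T" for X
  proof (intro equalityI subsetI)
    fix e assume "e \<in> gact T k ` (\<Union>g\<in>stabilizer t. gact T g ` X)"
    then obtain g p where g: "g \<in> carrier G" "gact T g t = t" "p \<in> X" "e = gact T k (gact T g p)"
      unfolding stabilizer_def by blast
    have "k \<otimes> g \<in> stabilizer t" using act_mult[OF k'(1) g(1) te] g k' by (simp add: stabilizer_def)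
    moreover have "e = gact T (k \<otimes> g) p" using act_mult[OF k'(1) g(1)] g X by auto
    ultimately show "e \<in> (\<Union>g\<in>stabilizer t. gact T g ` X)" using g by blast
  next
    fix e assume "e \<in> (\<Union>g\<in>stabilizer t. gact T g ` X)"
    then obtain g p where g: "g \<in> carrier G" "gact T g t = t" "p \<in> X" "e = gact T g p"
      unfolding stabilizer_def by blast
    have pe: "p \<in> forest_edges T" using g X by blast
    have i: "inv k \<in> carrier G" using k' by simp
    have "gact T (inv k) t = t" using act_inv[OF k'(1) te] k' by simp
    then have "inv k \<otimes> g \<in> stabilizer t" using act_mult[OF i g(1) te] g i by (simp add: stabilizer_def)
    moreover have "e = gact T k (gact T (inv k \<otimes> g) p)"
      using act_mult[OF i g(1) pe] act_inv'[OF k'(1) act_forest_edge[OF g(1) pe]] g by simp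
    ultimately show "e \<in> gact T k ` (\<Union>g\<in>stabilizer t. gact T g ` X)" using g by blast
  qed
  then show ?thesis using faces_edges[OF face_of_rooted_face(2)] by (simp add: translate_def orbital_hull_def)
qed

lemma hull_translates_disjoint:
  assumes F1: "F1 \<in> orbit (orbital_hull t F)" and F2: "F2 \<in> orbit (orbital_hull t F)" and p: "p \<in> fst F1" "p \<in> fst F2"
  shows "F1 = F2"
proof -
  let ?H = "orbital_hull t F"
  obtain g h where g: "g \<in> carrier G" "F1 = translate T g ?H" and h: "h \<in> carrier G" "F2 = translate T h ?H"
    using F1 F2 by (auto simp: orbit_def)
  obtain V1 where V1: "V1 \<in> comps T" "carries g V V1" using act_comp[OF V g(1)] by blast
  obtain V2 where V2: "V2 \<in> comps T" "carries h V V2" using act_comp[OF V h(1)] by blast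
  note r1 = translate_rooted_face[OF g(1) V V1 orbital_hull_rooted, folded g(2)]
  note r2 = translate_rooted_face[OF h(1) V V2 orbital_hull_rooted, folded h(2)]
  have b1: "below V1 (gact T g t) p" using r1 p(1) face_root_below unfolding rooted_face_def by blast
  have b2: "below V2 (gact T h t) p" using r2 p(2) face_root_below unfolding rooted_face_def by blast
  have VV: "V2 = V1" by (rule comps_eq[OF V2(1) V1(1) below_edges(2)[OF b2] below_edges(2)[OF b1]])
  have te: "t \<in> forest_edges T" using forest_edgeI[OF V root_of_rooted_face] .
  let ?k = "h \<otimes> inv g"
  have "gact T ?k (gact T g t) = gact T h t"
    using act_mult[of h "inv g" "gact T g t"] act_inv[OF g(1) te] act_forest_edge[OF g(1) te] g h by simp
  then have eq: "gact T h t = gact T g t"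
    using below_translate_eq[of ?k V1 "gact T g t"] below_comparable[OF b1 b2[unfolded VV]] V1(1) g h by simp
  have i: "inv h \<in> carrier G" using h by simp
  have "inv h \<otimes> g \<in> stabilizer t"
    using act_mult[OF i g(1) te] act_inv[OF h(1) te] eq i g by (simp add: stabilizer_def)
  then have "translate T (inv h \<otimes> g) ?H = ?H" by (rule translate_hull)
  then have "translate T h ?H = translate T (h \<otimes> (inv h \<otimes> g)) ?H"
    using translate_mult[of h "inv h \<otimes> g" ?H] hull_faces g h by simp
  also have "h \<otimes> (inv h \<otimes> g) = g" using g h by (simp add: m_assoc[symmetric])
  finally show ?thesis using g h by simp
qed

lemma hull_union_translates:
  assumes "F' \<in> orbit (orbital_hull t F)"
  shows "fst F' \<subseteq> (\<Union>g\<in>carrier G. gact T g ` fst F)" "snd F' \<subseteq> (\<Union>g\<in>carrier G. gact T g ` snd F)"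
proof -
  obtain g where g: "g \<in> carrier G" "F' = translate T g (orbital_hull t F)" using assms by (auto simp: orbit_def)
  have "gact T g ` (\<Union>k\<in>stabilizer t. gact T k ` X) \<subseteq> (\<Union>g\<in>carrier G. gact T g ` X)" if X: "X \<subseteq> forest_edges T" for X
  proof
    fix e assume "e \<in> gact T g ` (\<Union>k\<in>stabilizer t. gact T k ` X)"
    then obtain k p where k: "k \<in> carrier G" "p \<in> X" "e = gact T g (gact T k p)" unfolding stabilizer_def by blast
    then have "e = gact T (g \<otimes> k) p" using act_mult[OF g(1) k(1)] X by auto
    then show "e \<in> (\<Union>g\<in>carrier G. gact T g ` X)" using g k by blast
  qed
  then show "fst F' \<subseteq> (\<Union>g\<in>carrier G. gact T g ` fst F)" "snd F' \<subseteq> (\<Union>g\<in>carrier G. gact T g ` snd F)"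
    using faces_edges[OF face_of_rooted_face(2)] g by (simp_all add: translate_def orbital_hull_def)
qed

text \<open>
  The disjoint copies of the translates of the orbital hull are already disjoint within \<open>T\<close>, so
  together they form an orbital face of \<open>T\<close>.
\<close>

lemma orbital_face_hull: "orbital_face G (orbit_forest (orbital_hull t F)) T unlabel"
  unfolding orbital_face_def G_tree_map_def
proof (intro conjI ballI)
  let ?H = "orbital_hull t F"
  show "G_tree G (orbit_forest ?H)" by (rule G_tree_orbit_forest[OF hull_faces])
  show "forest_map (orbit_forest ?H) T unlabel"
    unfolding forest_map_def
  proof
    fix U assume "U \<in> comps (orbit_forest ?H)"
    then obtain V' F' where U: "U = face_tree V' F'" "V' \<in> comps T" "face V' F'" unfolding orbit_comps by blast
    then show "\<exists>V\<in>comps T. restrict unlabel (edges U) \<in> tree_maps U V"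
      using face_inclusion_tree_map[OF U(3)] unfolding face_inclusion_def by blast
  qed
  show "unlabel (gact (orbit_forest ?H) g e) = gact T g (unlabel e)" if "e \<in> forest_edges (orbit_forest ?H)" for g e
    by (rule unlabel_equivariant[OF hull_faces that])
  show "inj_on unlabel (forest_edges (orbit_forest ?H))"
  proof (rule inj_onI)
    fix e e' assume e: "e \<in> forest_edges (orbit_forest ?H)" "e' \<in> forest_edges (orbit_forest ?H)" and eq: "unlabel e = unlabel e'"
    obtain F1 p where 1: "F1 \<in> orbit ?H" "p \<in> fst F1" "e = label F1 p" using e(1) orbit_forest_edge[OF hull_faces] by blast
    obtain F2 q where 2: "F2 \<in> orbit ?H" "q \<in> fst F2" "e' = label F2 q" using e(2) orbit_forest_edge[OF hull_faces] by blast
    have "p = q" using eq 1 2 by simp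
    then show "e = e'" using hull_translates_disjoint[OF 1(1) 2(1) 1(2)] 1 2 by simp
  qed
qed

text \<open>
  A factorization of \<open>T - E\<close> would show that the translates of the hull contain \<open>T - E\<close>; these consist of
  translates of \<open>F\<close>.
\<close>

lemma hull_not_removal:
  assumes O: "F \<in> orbital_faces E"
  shows "\<not> removal_factors_through G T E (orbit_forest (orbital_hull t F)) unlabel"
proof
  let ?H = "orbital_hull t F" and ?R = "forest_remove_edges T E"
  assume "removal_factors_through G T E (orbit_forest ?H) unlabel"
  then obtain h where h: "forest_map ?R (orbit_forest ?H) h" "\<And>e. e \<in> forest_edges ?R \<Longrightarrow> unlabel (h e) = e"
    unfolding removal_factors_through_def G_tree_map_def by blast
  have *: "\<exists>F'\<in>orbit ?H. face_le (face_without V' E) F'" if V': "V' \<in> comps T" for V'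
  proof -
    let ?D = "E \<inter> inner_edges V'"
    let ?W = "remove_edges V' ?D"
    have W: "?W \<in> comps ?R" using V' by (auto simp: forest_remove_edges_def)
    then obtain U where U: "U \<in> comps (orbit_forest ?H)" "restrict h (edges ?W) \<in> tree_maps ?W U"
      using h(1) unfolding forest_map_def by blast
    obtain V'' F' where F': "U = face_tree V'' F'" "V'' \<in> comps T" "F' \<in> orbit ?H" "face V'' F'"
      using U(1) unfolding orbit_comps by blast
    have i: "edges_inclusion V' ?D \<in> tree_maps ?W V'"
      using remove_edges_inner_face[of ?D V'] by (simp add: inner_face_map_def face_map_def)
    have We: "edges ?W = edges V' - ?D" by (rule remove_edges_sel) simp
    have eq: "compose (edges ?W) unlabel (restrict h (edges ?W)) = edges_inclusion V' ?D"
    proof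
      fix a show "compose (edges ?W) unlabel (restrict h (edges ?W)) a = edges_inclusion V' ?D a"
      proof (cases "a \<in> edges ?W")
        case True
        then have "a \<in> forest_edges ?R" using W by (auto simp: forest_edges_def)
        then show ?thesis using h(2) True by (simp add: compose_eq edges_inclusion_def We)
      next
        case False
        then show ?thesis by (auto simp: compose_def edges_inclusion_def We)
      qed
    qed
    note u = unlabel_compose[OF F'(4) U(2)[unfolded F'(1)], unfolded eq]
    have "V'' = V'"
      by (rule comps_eq[OF F'(2) V' tree_map_edges[OF u(2) root_edges] tree_map_edges[OF i root_edges]])
    then show ?thesis using u(3) F'(3) by (auto simp: image_face_removal)
  qed
  have "forest_edges T - E \<subseteq> (\<Union>g\<in>carrier G. gact T g ` fst F)"
  proof
    fix a assume a: "a \<in> forest_edges T - E"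
    then obtain V' where V': "V' \<in> comps T" "a \<in> edges V'" by (auto elim: forest_edgeE)
    obtain F' where F': "F' \<in> orbit ?H" "face_le (face_without V' E) F'" using *[OF V'(1)] by blast
    have "a \<in> fst (face_without V' E)" using a V'(2) by (simp add: face_without_def)
    then have "a \<in> fst F'" using F'(2) unfolding face_le_def by blast
    then show "a \<in> (\<Union>g\<in>carrier G. gact T g ` fst F)" using hull_union_translates(1)[OF F'(1)] by blast
  qed
  moreover have "(\<Union>V\<in>comps T. edges V - leaves V) \<subseteq> (\<Union>g\<in>carrier G. gact T g ` snd F)"
  proof
    fix a assume "a \<in> (\<Union>V\<in>comps T. edges V - leaves V)"
    then obtain V' where V': "V' \<in> comps T" "a \<in> edges V' - leaves V'" by blast
    obtain F' where F': "F' \<in> orbit ?H" "face_le (face_without V' E) F'" using *[OF V'(1)] by blast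
    have "a \<in> snd (face_without V' E)" using V'(2) by (simp add: face_without_def)
    then have "a \<in> snd F'" using F'(2) unfolding face_le_def by blast
    then show "a \<in> (\<Union>g\<in>carrier G. gact T g ` snd F)" using hull_union_translates(2)[OF F'(1)] by blast
  qed
  ultimately show False using O by (simp add: orbital_faces_def orbit_covers_def)
qed

end

context
  fixes S f assumes o: "orbital_face G S T f"
begin

lemma orbital_face_source: "G_tree G S" and orbital_face_inj: "inj_on f (forest_edges S)"
  and orbital_face_equivariant: "g \<in> carrier G \<Longrightarrow> e \<in> forest_edges S \<Longrightarrow> f (gact S g e) = gact T g (f e)"
  and orbital_face_comp: "U \<in> comps S \<Longrightarrow> \<exists>V\<in>comps T. restrict f (edges U) \<in> tree_maps U V"
  using o by (auto simp: orbital_face_def G_tree_map_def forest_map_def)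

lemma orbital_face_edge: "U \<in> comps S \<Longrightarrow> e \<in> edges U \<Longrightarrow> e \<in> forest_edges S"
  by (auto simp: forest_edges_def)

lemma orbital_face_inj_comp: "U \<in> comps S \<Longrightarrow> inj_on (restrict f (edges U)) (edges U)"
  using inj_on_subset[OF orbital_face_inj, of "edges U"] orbital_face_edge by (auto simp: inj_on_def)

text \<open>
  As \<open>f\<close> is equivariant, the component into which \<open>g\<close> maps \<open>U\<close> has the translate of the image of \<open>U\<close> as its image.
\<close>

lemma orbital_component_translate:
  assumes U: "U \<in> comps S" and V: "V \<in> comps T" and fU: "restrict f (edges U) \<in> tree_maps U V" and g: "g \<in> carrier G"
  shows "\<exists>U'\<in>comps S. \<exists>V'\<in>comps T. restrict (gact S g) (edges U) \<in> tree_maps U U' \<and>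
    carries g V V' \<and> restrict f (edges U') \<in> tree_maps U' V' \<and>
    image_face V' U' (restrict f (edges U')) = translate T g (image_face V U (restrict f (edges U)))"
proof -
  interpret S: G_forest G S by unfold_locales (rule orbital_face_source)
  obtain U' where U': "U' \<in> comps S" "restrict (gact S g) (edges U) \<in> tree_maps U U'" using S.act_comp[OF U g] by blast
  obtain V' where V': "V' \<in> comps T" "restrict f (edges U') \<in> tree_maps U' V'" using orbital_face_comp[OF U'(1)] by blast
  have fg: "f (gact S g a) = gact T g (f a)" if "a \<in> edges U" for a
    using orbital_face_equivariant[OF g orbital_face_edge[OF U that]] .
  have fe: "f a \<in> edges V" if "a \<in> edges U" for a using tree_map_edges[OF fU that] that by simp
  have r: "gact S g (root U) = root U'" by (rule S.act_root[OF g U U'])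
  have "gact T g (f (root U)) \<in> edges V'"
    using tree_map_edges[OF V'(2) root_edges] fg[OF root_edges] r by simp
  then have gV: "carries g V V'"
    using act_tree_map[OF g V V'(1) fe[OF root_edges]] by simp
  have im: "restrict f (edges U') ` gact S g ` X = gact T g ` restrict f (edges U) ` X" if X: "X \<subseteq> edges U" for X
    unfolding image_image
  proof (rule image_cong)
    fix a assume "a \<in> X"
    then have a: "a \<in> edges U" using X by blast
    then have "gact S g a \<in> edges U'" using S.act_edge[OF g U _ U'(2)] by blast
    then show "restrict f (edges U') (gact S g a) = gact T g (restrict f (edges U) a)" using fg[OF a] a by simp
  qed simp
  have E: "restrict f (edges U') ` edges U' = gact T g ` restrict f (edges U) ` edges U"
    using im[OF subset_refl] unfolding S.act_image_edges[OF g U U'] .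
  have L: "restrict f (edges U') ` leaves U' = gact T g ` restrict f (edges U) ` leaves U"
    using im[OF leaves_edges] unfolding S.act_leaves[OF g U U'] .
  have R: "restrict f (edges U') (root U') = gact T g (restrict f (edges U) (root U))"
    using fg[OF root_edges] r by simp
  have "restrict f (edges U) (root U) \<in> edges V" "restrict f (edges U) ` leaves U \<subseteq> edges V"
    using tree_map_edges[OF fU root_edges] tree_map_edges[OF fU] leaves_edges[of U] by (simp, blast)
  then have "image_face V' U' (restrict f (edges U')) = translate T g (image_face V U (restrict f (edges U)))"
    unfolding image_face_def translate_def fst_conv snd_conv E L R using act_interior[OF g V V'(1) gV] by simp
  then show ?thesis using U' V' gV by blast
qed

text \<open>
  Suppose that the components of \<open>S\<close> together contain \<open>T - E\<close>.  Some component \<open>U'\<close> contains the root of a component \<open>V'\<close>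
  of \<open>T\<close>.  It is the only one over \<open>V'\<close>, since an element that permutes components over \<open>V'\<close> fixes the root of \<open>V'\<close>.
  Therefore \<open>U'\<close> contains all of \<open>V' - E\<close>, and the inverse of \<open>f\<close> is the required factorization.
\<close>

lemma removal_if_orbit_covers:
  assumes E: "E \<subseteq> forest_inner_edges T"
    and U: "U \<in> comps S" and V: "V \<in> comps T" and fU: "restrict f (edges U) \<in> tree_maps U V"
    and covers: "orbit_covers E (image_face V U (restrict f (edges U)))"
  shows "removal_factors_through G T E S f"
proof -
  interpret S: G_forest G S by unfold_locales (rule orbital_face_source)
  let ?F = "image_face V U (restrict f (edges U))"
  have fst_edges: "fst (image_face V' U' (restrict f (edges U'))) = f ` edges U'" for V' U'
    by (simp add: image_face_def)
  have rE: "root V' \<notin> E" if V': "V' \<in> comps T" for V'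
  proof
    assume "root V' \<in> E"
    then obtain V'' where "V'' \<in> comps T" "root V' \<in> inner_edges V''" using E unfolding forest_inner_edges_def by blast
    then show False using comps_eq[OF V', of V'' "root V'"] by (auto simp: inner_edges_def)
  qed
  have comp: "\<exists>U'\<in>comps S. restrict f (edges U') \<in> tree_maps U' V' \<and>
      face_le (face_without V' E) (image_face V' U' (restrict f (edges U')))" if V': "V' \<in> comps T" for V'
  proof -
    have "root V' \<in> forest_edges T - E" using rE[OF V'] forest_edgeI[OF V'] by simp
    then obtain g where g: "g \<in> carrier G" "root V' \<in> fst (translate T g ?F)"
      using covers unfolding orbit_covers_def translate_def by auto
    obtain U' V1 where U': "U' \<in> comps S" "V1 \<in> comps T" "restrict f (edges U') \<in> tree_maps U' V1"
      and F': "image_face V1 U' (restrict f (edges U')) = translate T g ?F"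
      using orbital_component_translate[OF U V fU g(1)] by blast
    obtain u where u: "u \<in> edges U'" "f u = root V'" using g(2) fst_edges[of V1 U'] F' by auto
    have "root V' \<in> edges V1" using tree_map_edges[OF U'(3) u(1)] u by simp
    then have V1: "V1 = V'" using comps_eq[OF U'(2) V'] by simp
    \<comment> \<open>An element that carries \<open>U'\<close> to another component over \<open>V'\<close> fixes the root of \<open>V'\<close>, so its preimage is common to both.\<close>
    have uniq: "U2 = U'" if U2: "U2 \<in> comps S" "restrict f (edges U2) \<in> tree_maps U2 V'" for U2
    proof -
      obtain k where k: "k \<in> carrier G" "restrict (gact S k) (edges U') \<in> tree_maps U' U2"
        using S.act_transitive[OF U'(1) U2(1)] by blast
      have ku: "gact S k u \<in> edges U2" by (rule S.act_edge[OF k(1) U'(1) u(1) k(2)])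
      have fk: "f (gact S k u) = gact T k (root V')" using orbital_face_equivariant[OF k(1) orbital_face_edge[OF U'(1) u(1)]] u by simp
      have "gact T k (root V') \<in> edges V'" using tree_map_edges[OF U2(2) ku] ku fk by simp
      then have "carries k V' V'" by (rule act_tree_map[OF k(1) V' V' root_edges])
      then have "gact T k (root V') = root V'" by (rule act_root[OF k(1) V' V'])
      then have "gact S k u = u" using inj_onD[OF orbital_face_inj] fk u orbital_face_edge[OF U2(1) ku] orbital_face_edge[OF U'(1) u(1)] by simp
      then show ?thesis using S.comps_eq[OF U2(1) U'(1)] ku u by simp
    qed
    have tr: "translate T h ?F = image_face V' U' (restrict f (edges U'))"
      if h: "h \<in> carrier G" "a \<in> edges V'" "a \<in> fst (translate T h ?F) \<union> snd (translate T h ?F)" for h a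
    proof -
      obtain U2 V2 where U2: "U2 \<in> comps S" "V2 \<in> comps T" "restrict f (edges U2) \<in> tree_maps U2 V2"
        and F2: "image_face V2 U2 (restrict f (edges U2)) = translate T h ?F"
        using orbital_component_translate[OF U V fU h(1)] by blast
      have "a \<in> edges V2"
        using face_edges[of V2 "fst (translate T h ?F)" "snd (translate T h ?F)"] image_face_face[OF U2(3)] F2 h(3) by auto
      then have "V2 = V'" using comps_eq[OF U2(2) V'] h(2) by simp
      then show ?thesis using uniq[OF U2(1)] U2 F2 by simp
    qed
    have "fst (face_without V' E) \<subseteq> f ` edges U'"
    proof
      fix a assume "a \<in> fst (face_without V' E)"
      then have a: "a \<in> edges V'" "a \<notin> E \<inter> inner_edges V'" by (auto simp: face_without_def)
      have "a \<notin> E"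
      proof
        assume aE: "a \<in> E"
        then obtain V'' where "V'' \<in> comps T" "a \<in> inner_edges V''" using E unfolding forest_inner_edges_def by blast
        then show False using comps_eq[OF V', of V'' a] a aE by (auto simp: inner_edges_def)
      qed
      then have "a \<in> forest_edges T - E" using a forest_edgeI[OF V'] by simp
      then obtain h where h: "h \<in> carrier G" "a \<in> fst (translate T h ?F)"
        using covers unfolding orbit_covers_def translate_def by auto
      then show "a \<in> f ` edges U'" using tr[OF h(1) a(1)] fst_edges[of V' U'] by simp
    qed
    moreover have "snd (face_without V' E) \<subseteq> snd (image_face V' U' (restrict f (edges U')))"
    proof
      fix a assume "a \<in> snd (face_without V' E)"
      then have a: "a \<in> edges V' - leaves V'" by (simp add: face_without_def)
      then obtain h where h: "h \<in> carrier G" "a \<in> snd (translate T h ?F)"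
        using covers V' unfolding orbit_covers_def translate_def by auto
      then show "a \<in> snd (image_face V' U' (restrict f (edges U')))" using tr[OF h(1), of a] a by simp
    qed
    ultimately show ?thesis using U' V1 fst_edges by (auto simp: face_le_def)
  qed
  define h where "h = inv_into (forest_edges S) f"
  have hf: "h (f u) = u" if "u \<in> forest_edges S" for u using orbital_face_inj that by (simp add: h_def)
  have comp': "\<exists>U'\<in>comps S. restrict h (edges (remove_edges V' (E \<inter> inner_edges V'))) \<in> tree_maps (remove_edges V' (E \<inter> inner_edges V')) U'
      \<and> (\<forall>a\<in>edges (remove_edges V' (E \<inter> inner_edges V')). f (h a) = a \<and> h a \<in> forest_edges S)"
    if V': "V' \<in> comps T" for V'
  proof -
    let ?W = "remove_edges V' (E \<inter> inner_edges V')"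
    obtain U' where U': "U' \<in> comps S" "restrict f (edges U') \<in> tree_maps U' V'"
      "face_le (face_without V' E) (image_face V' U' (restrict f (edges U')))" using comp[OF V'] by blast
    obtain m where m: "m \<in> tree_maps ?W U'"
      "edges_inclusion V' (E \<inter> inner_edges V') = compose (edges ?W) (restrict f (edges U')) m"
      using removal_factors_iff[OF U'(2) orbital_face_inj_comp[OF U'(1)], of E] U'(3) unfolding factors_through_def by blast
    have We: "edges ?W = edges V' - (E \<inter> inner_edges V')" by (rule remove_edges_sel) simp
    have fm: "f (m a) = a" "m a \<in> forest_edges S" if a: "a \<in> edges ?W" for a
    proof -
      have ma: "m a \<in> edges U'" by (rule tree_map_edges[OF m(1) a])
      have "a = edges_inclusion V' (E \<inter> inner_edges V') a" using a by (simp add: edges_inclusion_def We)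
      also have "\<dots> = restrict f (edges U') (m a)" unfolding m(2) using a by (rule compose_eq)
      finally show "f (m a) = a" using ma by simp
      show "m a \<in> forest_edges S" by (rule orbital_face_edge[OF U'(1) ma])
    qed
    have hm: "h a = m a" if "a \<in> edges ?W" for a using hf[OF fm(2)[OF that]] fm(1)[OF that] by simp
    have "restrict h (edges ?W) = m"
    proof
      fix a show "restrict h (edges ?W) a = m a"
        using hm tree_map_outside[OF m(1)] by (cases "a \<in> edges ?W") auto
    qed
    then show ?thesis using U'(1) m(1) fm hm by auto
  qed
  let ?R = "forest_remove_edges T E"
  have R: "\<exists>V'\<in>comps T. e \<in> edges (remove_edges V' (E \<inter> inner_edges V'))" if "e \<in> forest_edges ?R" for e
    using that by (auto simp: forest_edges_def forest_remove_edges_def)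
  have fh: "f (h e) = e" "h e \<in> forest_edges S" if "e \<in> forest_edges ?R" for e
    using R[OF that] comp' by blast+
  have "forest_map ?R S h" using comp' by (auto simp: forest_map_def forest_remove_edges_def)
  moreover have "h (gact ?R g e) = gact S g (h e)" if g: "g \<in> carrier G" and e: "e \<in> forest_edges ?R" for g e
  proof -
    have "f (gact S g (h e)) = gact ?R g e"
      using orbital_face_equivariant[OF g fh(2)[OF e]] fh(1)[OF e] by (simp add: forest_remove_edges_def)
    then show ?thesis using hf[OF S.act_forest_edge[OF g fh(2)[OF e]]] by simp
  qed
  ultimately show ?thesis unfolding removal_factors_through_def G_tree_map_def using fh by blast
qed

end

text \<open>
  An orbital face contains \<open>T - E\<close> iff the translates of one of its components cover \<open>T - E\<close>; and a face lies in some orbital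
  face without \<open>T - E\<close> iff its orbital hull is such an orbital face.
\<close>

lemma orbital_inner_horn_face_sub:
  assumes E: "E \<subseteq> forest_inner_edges T"
  shows "orbital_inner_horn G T E = face_sub T (orbital_faces E)"
proof -
  define \<Phi> where "\<Phi> U V f' \<longleftrightarrow> V \<in> comps T \<and> f' \<in> tree_maps U V \<and>
    (\<exists>S f. orbital_face G S T f \<and> \<not> removal_factors_through G T E S f \<and> U \<in> comps S \<and> f' = restrict f (edges U))"
    for U V f'
  have r: "face_cells U (restrict f (edges U)) W = face_cells U f W" for U W f
    unfolding face_cells_def
  proof (rule image_cong[OF refl])
    fix y assume "y \<in> tree_maps W U"
    then show "compose (edges W) (restrict f (edges U)) y = compose (edges W) f y"
      using tree_map_edges by (auto simp: compose_def)
  qed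
  have "\<Union>{face_cells U f W | U S f. orbital_face G S T f \<and> \<not> removal_factors_through G T E S f \<and> U \<in> comps S}
      = \<Union>{face_cells U f W | U V f. \<Phi> U V f}" for W
  proof (rule arg_cong[where f = Union], intro equalityI subsetI)
    fix X assume "X \<in> {face_cells U f W | U S f. orbital_face G S T f \<and> \<not> removal_factors_through G T E S f \<and> U \<in> comps S}"
    then obtain U S f where X: "X = face_cells U f W" "orbital_face G S T f" "\<not> removal_factors_through G T E S f" "U \<in> comps S"
      by blast
    obtain V where V: "V \<in> comps T" "restrict f (edges U) \<in> tree_maps U V" using orbital_face_comp[OF X(2,4)] by blast
    then have "\<Phi> U V (restrict f (edges U))" using X unfolding \<Phi>_def by blast
    then show "X \<in> {face_cells U f W | U V f. \<Phi> U V f}" using r[of U f W] X(1) by blast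
  next
    fix X assume "X \<in> {face_cells U f W | U V f. \<Phi> U V f}"
    then obtain U S f where "X = face_cells U (restrict f (edges U)) W" "orbital_face G S T f"
      "\<not> removal_factors_through G T E S f" "U \<in> comps S" unfolding \<Phi>_def by blast
    then show "X \<in> {face_cells U f W | U S f. orbital_face G S T f \<and> \<not> removal_factors_through G T E S f \<and> U \<in> comps S}"
      unfolding r by blast
  qed
  moreover have "\<Union>{face_cells U f W | U V f. \<Phi> U V f} = cells_with_image T (orbital_faces E) W" for W
  proof (rule union_face_cells_cofinal)
    fix U V f' assume "\<Phi> U V f'"
    then obtain S f where f: "V \<in> comps T" "f' \<in> tree_maps U V" "orbital_face G S T f"
      "\<not> removal_factors_through G T E S f" "U \<in> comps S" "f' = restrict f (edges U)" unfolding \<Phi>_def by blast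
    have "image_face V U f' \<in> faces T" using image_face_face[OF f(2)] f(1) unfolding faces_def by blast
    moreover have "\<not> orbit_covers E (image_face V U f')"
      using removal_if_orbit_covers[OF f(3) E f(5,1)] f(2,4,6) by blast
    ultimately show "V \<in> comps T \<and> f' \<in> tree_maps U V \<and> inj_on f' (edges U) \<and> image_face V U f' \<in> orbital_faces E"
      using f orbital_face_inj_comp[OF f(3,5)] by (simp add: orbital_faces_def)
  next
    fix V F assume V: "V \<in> comps T" and "face V F" and O: "F \<in> orbital_faces E"
    then obtain t where t: "rooted_face V t F" using face_rooted by blast
    let ?H = "orbital_hull t F"
    have H: "face V ?H" using orbital_hull_rooted[OF V t] face_rooted by blast
    have "face_tree V ?H \<in> comps (orbit_forest ?H)"
      using V H orbit_self[OF hull_faces[OF V t]] orbit_comps by blast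
    then have "\<Phi> (face_tree V ?H) V (face_inclusion V ?H)"
      using V face_inclusion_tree_map[OF H] orbital_face_hull[OF V t] hull_not_removal[OF V t O]
      unfolding \<Phi>_def face_inclusion_def by blast
    moreover have "face_le F (image_face V (face_tree V ?H) (face_inclusion V ?H))"
      using orbital_hull_ge[OF V t] image_face_inclusion[OF H] by simp
    ultimately show "\<exists>U f. \<Phi> U V f \<and> face_le F (image_face V U f)" by blast
  qed (use sieve_orbital[of E] in \<open>auto simp: sieve_def\<close>)
  ultimately show ?thesis by (simp add: orbital_inner_horn_def face_sub_def)
qed

end

section \<open>Comparison of the four sets of inclusions\<close>

text \<open>
  Vertices are counted along with edges, since replacing a stump by a leaf gives a proper face with the same edges.
\<close>

definition tree_size :: "tree \<Rightarrow> nat" where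
  "tree_size V = card (edges V) + card (edges V - leaves V)"

definition smaller :: "'g gforest \<Rightarrow> 'g gforest \<Rightarrow> bool" where
  "smaller S T \<longleftrightarrow> (\<forall>U\<in>comps S. \<exists>V\<in>comps T. tree_size U < tree_size V)"

definition horn_datum :: "('g, 'b) monoid_scheme \<Rightarrow> 'g gforest \<Rightarrow> edge set \<Rightarrow> bool" where
  "horn_datum G T E \<longleftrightarrow> G_tree G T \<and> E \<noteq> {} \<and> E \<subseteq> forest_inner_edges T \<and> G_stable G T E"

definition horn_arrow :: "'g gforest \<Rightarrow> edge set \<Rightarrow> ('u cell, 'g) arrow" where
  "horn_arrow T E = (inner_horn T E, trans_id, representable T)"

lemma forest_inner_edges_subset: "forest_inner_edges T \<subseteq> forest_edges T"
  by (auto simp: forest_inner_edges_def forest_edges_def inner_edges_def)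

lemma tree_size_face_tree:
  assumes F: "face V F" and n: "\<not> face_le (top_face V) F"
  shows "tree_size (face_tree V F) < tree_size V"
proof -
  have e: "fst F \<subseteq> edges V" "snd F \<subseteq> edges V - leaves V" using face_edges[of V "fst F" "snd F"] F by auto
  have fin: "finite (edges V)" "finite (edges V - leaves V)" using tree_props(1)[of V] by auto
  have "edges (face_tree V F) - leaves (face_tree V F) = label F ` (fst F \<inter> snd F)"
    by (auto simp: face_tree_sel[OF F])
  moreover have "card (label F ` X) = card X" for X by (rule card_image) (simp add: inj_on_def)
  ultimately have s: "tree_size (face_tree V F) = card (fst F) + card (fst F \<inter> snd F)"
    by (simp add: tree_size_def face_tree_sel[OF F])
  have le: "card (fst F) \<le> card (edges V)" "card (fst F \<inter> snd F) \<le> card (edges V - leaves V)"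
    by (rule card_mono[OF fin(1) e(1)], rule card_mono[OF fin(2)]) (use e in blast)
  show ?thesis
  proof (rule ccontr)
    assume "\<not> ?thesis"
    then have "card (fst F) = card (edges V)" "card (fst F \<inter> snd F) = card (edges V - leaves V)"
      using le s by (simp_all add: tree_size_def)
    then have "fst F = edges V" "fst F \<inter> snd F = edges V - leaves V"
      using card_subset_eq[OF fin(1) e(1)] card_subset_eq[OF fin(2), of "fst F \<inter> snd F"] e by blast+
    then show False using n by (auto simp: face_le_def top_face_def)
  qed
qed

context G_forest
begin

text \<open>
  With \<open>\<epsilon> Q = {}\<close>, faces are attached along their boundaries.
\<close>

lemma inner_horn_normal:
  assumes E: "G_stable G T E" "E \<subseteq> forest_inner_edges T"
  shows "horn_arrow T E \<in> (normal_monos G :: ('u cell, 'g) arrow set)"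
  unfolding normal_monos_def saturation_def
proof (rule InterI)
  fix K :: "('u cell, 'g) arrow set"
  assume "K \<in> {K. saturated G K \<and> {(boundary T, trans_id, representable T) |T. G_tree G T} \<subseteq> K}"
  then have K: "saturated G K" and b: "\<And>S. G_tree G S \<Longrightarrow> (boundary S, trans_id, representable S) \<in> K" by blast+
  have E': "E \<subseteq> forest_edges T" using E(2) forest_inner_edges_subset by blast
  have "(face_sub T (horn_faces T E), trans_id, face_sub T (faces T)) \<in> K"
  proof (rule sieve_extension[OF K sieve_faces sieve_horn[OF E(1) E'], where \<epsilon> = "\<lambda>_. {}"])
    show "horn_faces T E \<subseteq> faces T" by (auto simp: horn_faces_def)
    fix P Q assume D: "(P, Q) \<in> faces T - horn_faces T E"
    then have F: "(P, Q) \<in> faces T" by blast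
    let ?S = "orbit_forest (P, Q)"
    interpret S: G_forest G ?S by unfold_locales (rule G_tree_orbit_forest[OF F])
    have "orbit_edges (P, Q) (\<lambda>_. {}) = {}" unfolding orbit_edges_def by simp
    then show "(inner_horn ?S (orbit_edges (P, Q) (\<lambda>_. {})), trans_id, representable ?S) \<in> K"
      using b[OF S.G_tree] by (simp add: S.boundary_inner_horn)
  qed auto
  then show "horn_arrow T E \<in> K"
    by (simp add: horn_arrow_def inner_horn_face_sub[OF E(1) E'] representable_face_sub)
qed

text \<open>
  The faces that are attached on the way to \<open>\<Lambda>\<^sup>E[T]\<close> are faces in this horn, hence proper and of smaller size;
  so only horns of smaller \<open>G\<close>-trees are needed.
\<close>

lemma extension_to_inner_horn:
  fixes K :: "('u cell, 'g) arrow set"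
  assumes K: "saturated G K" and small: "\<And>S E. horn_datum G S E \<Longrightarrow> smaller S T \<Longrightarrow> horn_arrow S E \<in> K"
    and E: "G_stable G T E" "E \<subseteq> forest_inner_edges T"
    and A: "sieve \<A>" "\<A> \<subseteq> horn_faces T E"
    and sub: "\<And>P Q. (P, Q) \<in> horn_faces T E - \<A> \<Longrightarrow> \<epsilon> Q \<subseteq> Q"
    and ne: "\<And>P Q. (P, Q) \<in> horn_faces T E - \<A> \<Longrightarrow> \<epsilon> Q \<noteq> {}"
    and down: "\<And>P Q. (P, Q) \<in> horn_faces T E - \<A> \<Longrightarrow> (P - \<epsilon> Q, Q) \<in> horn_faces T E - \<A>"
    and up: "\<And>P Q. (P, Q) \<in> horn_faces T E - \<A> \<Longrightarrow> (P \<union> \<epsilon> Q, Q) \<in> horn_faces T E"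
    and eqv: "\<And>P Q g. (P, Q) \<in> horn_faces T E - \<A> \<Longrightarrow> g \<in> carrier G \<Longrightarrow> \<epsilon> (gact T g ` Q) = gact T g ` \<epsilon> Q"
  shows "(face_sub T \<A>, trans_id, inner_horn T E) \<in> K"
proof -
  let ?D = "horn_faces T E - \<A>"
  have E': "E \<subseteq> forest_edges T" using E(2) forest_inner_edges_subset by blast
  note B = sieve_horn[OF E(1) E']
  have Df: "?D \<subseteq> faces T" by (auto simp: horn_faces_def)
  have "(face_sub T \<A>, trans_id, face_sub T (horn_faces T E)) \<in> K"
  proof (rule sieve_extension[OF K B A sub down up eqv])
    fix P Q assume D: "(P, Q) \<in> ?D" and eP: "\<epsilon> Q \<subseteq> P"
    let ?F = "(P, Q)"
    have F: "?F \<in> faces T" using D Df by blast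
    have orbD: "F' \<in> ?D" if "F' \<in> orbit ?F" for F'
      using that sieve_translate_iff[OF A(1) F] sieve_translate_iff[OF B F] D unfolding orbit_def by blast
    have 1: "\<epsilon> (snd F') \<subseteq> fst F' \<inter> snd F'" if F': "F' \<in> orbit ?F" for F'
    proof -
      obtain g where g: "g \<in> carrier G" "F' = translate T g ?F" using F' by (auto simp: orbit_def)
      then have "\<epsilon> (snd F') = gact T g ` \<epsilon> Q" using eqv[OF D g(1)] by (simp add: translate_def)
      then show ?thesis using image_mono[OF eP, of "gact T g"] image_mono[OF sub[OF D], of "gact T g"] g(2) by (simp add: translate_def)
    qed
    have 2: "(fst F' - \<epsilon> (snd F'), snd F') \<in> faces T" if "F' \<in> orbit ?F" for F'
      using down[of "fst F'" "snd F'"] orbD[OF that] Df by auto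
    have 3: "\<epsilon> (gact T g ` snd F') = gact T g ` \<epsilon> (snd F')" if "F' \<in> orbit ?F" "g \<in> carrier G" for F' g
      using eqv[of "fst F'" "snd F'" g] orbD[OF that(1)] that(2) by simp
    note ctx = F 1 2 3
    have "orbit_edges ?F \<epsilon> \<noteq> {}"
      using ne[OF D] orbit_self[OF F] unfolding orbit_edges_def by fastforce
    then have "horn_datum G (orbit_forest ?F) (orbit_edges ?F \<epsilon>)"
      using G_tree_orbit_forest[OF F] orbit_edges_inner[OF ctx] orbit_edges_stable[OF ctx] by (simp add: horn_datum_def)
    moreover have "smaller (orbit_forest ?F) T"
      unfolding smaller_def
    proof
      fix U assume "U \<in> comps (orbit_forest ?F)"
      then obtain V F' where U: "U = face_tree V F'" "V \<in> comps T" "F' \<in> orbit ?F" "face V F'" unfolding orbit_comps by blast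
      have "\<not> face_le (face_without V E) F'" using horn_faces_iff[OF U(2,4)] orbD[OF U(3)] by blast
      then have "\<not> face_le (top_face V) F'" by (auto simp: face_le_def top_face_def face_without_def)
      then have "tree_size U < tree_size V" using tree_size_face_tree[OF U(4)] U(1) by simp
      then show "\<exists>V\<in>comps T. tree_size U < tree_size V" using U(2) by blast
    qed
    ultimately have "horn_arrow (orbit_forest ?F) (orbit_edges ?F \<epsilon>) \<in> K" by (rule small)
    then show "(inner_horn (orbit_forest ?F) (orbit_edges ?F \<epsilon>), trans_id, representable (orbit_forest ?F)) \<in> K"
      by (simp add: horn_arrow_def)
  qed
  then show ?thesis by (simp add: inner_horn_face_sub[OF E(1) E'])
qed

context
  fixes E assumes ne: "E \<noteq> {}" and st: "G_stable G T E" and inner: "E \<subseteq> forest_inner_edges T"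
begin

lemma stable_edge: assumes V: "V \<in> comps T" shows "\<exists>e\<in>E. e \<in> inner_edges V"
proof -
  obtain e V0 where e: "e \<in> E" "V0 \<in> comps T" "e \<in> inner_edges V0" using ne inner unfolding forest_inner_edges_def by blast
  obtain g where g: "g \<in> carrier G" "carries g V0 V" using act_transitive[OF e(2) V] by blast
  have "gact T g e \<in> inner_edges V" using act_inner_edges[OF g(1) e(2) V g(2)] e(3) by blast
  moreover have "gact T g e \<in> E" using st g(1) e(1) unfolding G_stable_def by blast
  ultimately show ?thesis by blast
qed

lemma stable_inner: "V \<in> comps T \<Longrightarrow> e \<in> E \<Longrightarrow> e \<in> edges V \<Longrightarrow> e \<in> inner_edges V"
  using inner comps_eq unfolding forest_inner_edges_def inner_edges_def by blast

lemma root_nonleaf: assumes V: "V \<in> comps T" shows "root V \<notin> leaves V"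
proof
  assume l: "root V \<in> leaves V"
  obtain e where e: "e \<in> inner_edges V" using stable_edge[OF V] by blast
  then have "e = root V" using below_leaf[OF l below_root[of e V]] by (simp add: inner_edges_def)
  then show False using e by (simp add: inner_edges_def)
qed

lemma stable_edges_subset: "E \<subseteq> forest_edges T"
  using inner forest_inner_edges_subset by blast

text \<open>
  If the faces outside \<open>\<A>\<close> have the root of the tree in their interior, then the choice \<open>\<epsilon> Q = E \<inter> Q\<close> consists of inner edges of
  these faces.  Deleting or adding these edges does not affect whether a face contains \<open>T - E\<close>.
\<close>

lemma extension_by_stable_edges:
  fixes K :: "('u cell, 'g) arrow set"
  assumes K: "saturated G K" and small: "\<And>S E. horn_datum G S E \<Longrightarrow> smaller S T \<Longrightarrow> horn_arrow S E \<in> K"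
    and A: "sieve \<A>" "\<A> \<subseteq> horn_faces T E"
    and root: "\<And>P Q V. V \<in> comps T \<Longrightarrow> face V (P, Q) \<Longrightarrow> (P, Q) \<notin> \<A> \<Longrightarrow> root V \<in> Q \<and> E \<inter> Q \<noteq> {}"
    and down: "\<And>P Q. (P, Q) \<in> faces T \<Longrightarrow> (P, Q) \<notin> \<A> \<Longrightarrow> (P - E \<inter> Q, Q) \<notin> \<A>"
  shows "(face_sub T \<A>, trans_id, inner_horn T E) \<in> K"
proof (rule extension_to_inner_horn[OF K small st inner A, where \<epsilon> = "\<lambda>Q. E \<inter> Q"])
  fix P Q assume D: "(P, Q) \<in> horn_faces T E - \<A>"
  then have F: "(P, Q) \<in> faces T" by (simp add: horn_faces_def)
  then obtain V where V: "V \<in> comps T" "face V (P, Q)" unfolding faces_def by blast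
  note r = root[OF V] 
  obtain t where t: "cut V t (P - Q)" "interior V t (P - Q) = Q" "t \<in> P" using faceE[OF V(2)] by blast
  have rQ: "root V \<in> Q" "E \<inter> Q \<noteq> {}" using r D by auto
  then have "below V t (root V)" using t(2) unfolding interior_def by blast
  then have tr: "t = root V" using below_antisym below_root below_edges(1) by blast
  have rE: "root V \<notin> E" using stable_inner[OF V(1), of "root V"] by (auto simp: inner_edges_def)
  have f1: "face V (P - E \<inter> Q, Q)"
  proof -
    have "P - E \<inter> Q - Q = P - Q" by blast
    then show ?thesis using t tr rE by (intro faceI[of _ t]) auto
  qed
  have f2: "face V (P \<union> E \<inter> Q, Q)"
  proof -
    have "P \<union> E \<inter> Q - Q = P - Q" by blast
    then show ?thesis using t by (intro faceI[of _ t]) auto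
  qed
  have nl: "\<not> face_le (face_without V E) (P, Q)" using horn_faces_iff[OF V] D by blast
  show "(P - E \<inter> Q, Q) \<in> horn_faces T E - \<A>"
  proof
    have "\<not> face_le (face_without V E) (P - E \<inter> Q, Q)" using nl unfolding face_le_def by auto
    then show "(P - E \<inter> Q, Q) \<in> horn_faces T E" using horn_faces_iff[OF V(1) f1] by blast
    show "(P - E \<inter> Q, Q) \<notin> \<A>" using down[OF F] D by blast
  qed
  have "\<not> face_le (face_without V E) (P \<union> E \<inter> Q, Q)"
  proof
    assume "face_le (face_without V E) (P \<union> E \<inter> Q, Q)"
    then have "edges V - E \<inter> inner_edges V \<subseteq> P \<union> E \<inter> Q" "edges V - leaves V \<subseteq> Q"
      by (auto simp: face_le_def face_without_def)
    then have "face_le (face_without V E) (P, Q)"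
      using stable_inner[OF V(1)] unfolding face_le_def face_without_def by auto
    then show False using nl by blast
  qed
  then show "(P \<union> E \<inter> Q, Q) \<in> horn_faces T E" using horn_faces_iff[OF V(1) f2] by blast
  show "E \<inter> Q \<noteq> {}" by (rule rQ)
  show "E \<inter> gact T g ` Q = gact T g ` (E \<inter> Q)" if g: "g \<in> carrier G" for g
    using inj_on_image_Int[OF act_inj[OF g] stable_edges_subset, of Q] faces_edges[OF F] stable_image[OF st stable_edges_subset g] by simp
qed auto

lemma horn_to_horn:
  fixes K :: "('u cell, 'g) arrow set"
  assumes K: "saturated G K" and small: "\<And>S E. horn_datum G S E \<Longrightarrow> smaller S T \<Longrightarrow> horn_arrow S E \<in> K"
    and E': "G_stable G T E'" "E' \<subseteq> forest_inner_edges T" "E \<subseteq> E'"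
  shows "(inner_horn T E', trans_id, inner_horn T E) \<in> K"
proof -
  have E'e: "E' \<subseteq> forest_edges T" using E'(2) forest_inner_edges_subset by blast
  have E'inner: "e \<in> inner_edges V" if V: "V \<in> comps T" and e: "e \<in> E'" "e \<in> edges V" for e V
    using E'(2) comps_eq[OF V _ e(2)] e(1) unfolding forest_inner_edges_def inner_edges_def by blast
  have "(face_sub T (horn_faces T E'), trans_id, inner_horn T E) \<in> K"
  proof (rule extension_by_stable_edges[OF K small sieve_horn[OF E'(1) E'e]])
    show "horn_faces T E' \<subseteq> horn_faces T E"
      using E'(3) unfolding horn_faces_def face_le_def face_without_def by fastforce
    show "root V \<in> Q \<and> E \<inter> Q \<noteq> {}" if V: "V \<in> comps T" "face V (P, Q)" "(P, Q) \<notin> horn_faces T E'" for P Q V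
    proof -
      have "edges V - leaves V \<subseteq> Q"
        using horn_faces_iff[OF V(1,2)] V(3) by (auto simp: face_le_def face_without_def)
      moreover obtain e where "e \<in> E" "e \<in> inner_edges V" using stable_edge[OF V(1)] by blast
      ultimately show ?thesis using root_nonleaf[OF V(1)] root_edges[of V] by (auto simp: inner_edges_def)
    qed
    show "(P - E \<inter> Q, Q) \<notin> horn_faces T E'" if F: "(P, Q) \<in> faces T" "(P, Q) \<notin> horn_faces T E'" for P Q
    proof -
      obtain V where V: "V \<in> comps T" "face V (P, Q)" using F(1) unfolding faces_def by blast
      have "face_le (face_without V E') (P, Q)" using horn_faces_iff[OF V] F(2) by blast
      then have "face_le (face_without V E') (P - E \<inter> Q, Q)"
        using E'inner[OF V(1)] E'(3) unfolding face_le_def face_without_def by auto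
      then show ?thesis using V(1) unfolding horn_faces_def by blast
    qed
  qed
  then show ?thesis by (simp add: inner_horn_face_sub[OF E'(1) E'e])
qed

text \<open>
  A face \<open>(P, Q)\<close> outside the orbital horn has translates that cover all non-leaf edges of \<open>T\<close>.  The root of a tree
  has only roots as translates, and the edges in \<open>E\<close> only edges in \<open>E\<close>; so \<open>Q\<close> contains the root, and it meets \<open>E\<close>.
\<close>

lemma orbital_horn_to_horn:
  fixes K :: "('u cell, 'g) arrow set"
  assumes K: "saturated G K" and small: "\<And>S E. horn_datum G S E \<Longrightarrow> smaller S T \<Longrightarrow> horn_arrow S E \<in> K"
  shows "(orbital_inner_horn G T E, trans_id, inner_horn T E) \<in> K"
proof -
  have preE: "gact T g p \<in> E \<longleftrightarrow> p \<in> E" if "g \<in> carrier G" "p \<in> forest_edges T" for g p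
    using stable_image[OF st stable_edges_subset that(1)] act_inj[OF that(1)] that(2) stable_edges_subset
    by (metis (no_types, lifting) imageI inj_on_image_mem_iff)
  have "(face_sub T (orbital_faces E), trans_id, inner_horn T E) \<in> K"
  proof (rule extension_by_stable_edges[OF K small sieve_orbital])
    show "orbital_faces E \<subseteq> horn_faces T E"
    proof
      fix F assume F: "F \<in> orbital_faces E"
      have "orbit_covers E (face_without V E)" if V: "V \<in> comps T" for V
        unfolding orbit_covers_def
      proof (intro conjI subsetI)
        fix a assume a: "a \<in> forest_edges T - E"
        then obtain V' where V': "V' \<in> comps T" "a \<in> edges V'" by (auto elim: forest_edgeE)
        obtain g where g: "g \<in> carrier G" "carries g V V'" using act_transitive[OF V V'(1)] by blast
        obtain b where b: "b \<in> edges V" "a = gact T g b" using act_image_edges[OF g(1) V V'(1) g(2)] V'(2) by blast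
        have "b \<notin> E" using preE[OF g(1) forest_edgeI[OF V b(1)]] a b(2) by blast
        then show "a \<in> (\<Union>g\<in>carrier G. gact T g ` fst (face_without V E))"
          using b g(1) by (auto simp: face_without_def)
      next
        fix a assume "a \<in> (\<Union>V\<in>comps T. edges V - leaves V)"
        then obtain V' where V': "V' \<in> comps T" "a \<in> edges V' - leaves V'" by blast
        obtain g where g: "g \<in> carrier G" "carries g V V'" using act_transitive[OF V V'(1)] by blast
        have "a \<in> gact T g ` (edges V - leaves V)" using act_nonleaves[OF g(1) V V'(1) g(2)] V'(2) by simp
        then show "a \<in> (\<Union>g\<in>carrier G. gact T g ` snd (face_without V E))"
          using g(1) unfolding face_without_def snd_conv by blast
      qed
      then have "\<not> face_le (face_without V E) F" if "V \<in> comps T" for V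
        using orbit_covers_mono[of "face_without V E" F E] F that unfolding orbital_faces_def by blast
      then show "F \<in> horn_faces T E" using F unfolding orbital_faces_def horn_faces_def by blast
    qed
    show "root V \<in> Q \<and> E \<inter> Q \<noteq> {}" if V: "V \<in> comps T" "face V (P, Q)" "(P, Q) \<notin> orbital_faces E" for P Q V
    proof -
      have F: "(P, Q) \<in> faces T" using V unfolding faces_def by blast
      have Qe: "Q \<subseteq> edges V" using face_edges[OF V(2)] by blast
      have cov: "edges V - leaves V \<subseteq> (\<Union>g\<in>carrier G. gact T g ` Q)"
        using V F unfolding orbital_faces_def orbit_covers_def by auto
      obtain g q where g: "g \<in> carrier G" "q \<in> Q" "root V = gact T g q"
        using cov root_nonleaf[OF V(1)] root_edges[of V] by blast
      have gV: "carries g V V"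
        using act_tree_map[OF g(1) V(1) V(1), of q] g(3) Qe g(2) root_edges[of V] by auto
      have "gact T g (root V) = gact T g q" using act_root[OF g(1) V(1) V(1) gV] g(3) by simp
      then have "root V = q" using inj_onD[OF act_inj_tree[OF g(1) V(1) V(1) gV]] g(2) Qe by auto
      moreover obtain e where e: "e \<in> E" "e \<in> inner_edges V" using stable_edge[OF V(1)] by blast
      moreover obtain h p where h: "h \<in> carrier G" "p \<in> Q" "e = gact T h p" using cov e(2) unfolding inner_edges_def by blast
      moreover have "p \<in> E" using preE[OF h(1), of p] e(1) h Qe forest_edgeI[OF V(1)] by blast
      ultimately show ?thesis using g(2) by blast
    qed
    show "(P - E \<inter> Q, Q) \<notin> orbital_faces E" if F: "(P, Q) \<in> faces T" "(P, Q) \<notin> orbital_faces E" for P Q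
    proof -
      have cov: "orbit_covers E (P, Q)" using F unfolding orbital_faces_def by blast
      have "forest_edges T - E \<subseteq> (\<Union>g\<in>carrier G. gact T g ` (P - E \<inter> Q))"
      proof
        fix a assume a: "a \<in> forest_edges T - E"
        then obtain g p where g: "g \<in> carrier G" "p \<in> P" "a = gact T g p" using cov unfolding orbit_covers_def by auto
        have "p \<in> forest_edges T" using faces_edges[OF F(1)] g(2) by auto
        then have "p \<notin> E" using preE[OF g(1)] a g(3) by blast
        then show "a \<in> (\<Union>g\<in>carrier G. gact T g ` (P - E \<inter> Q))" using g by blast
      qed
      then have "orbit_covers E (P - E \<inter> Q, Q)" using cov unfolding orbit_covers_def by simp
      then show ?thesis unfolding orbital_faces_def by blast
    qed
  qed
  then show ?thesis by (simp add: orbital_inner_horn_face_sub[OF inner])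
qed

end

lemma inner_edges_stable: "G_stable G T (forest_inner_edges T)"
  unfolding G_stable_def
proof (intro ballI image_subsetI)
  fix g e assume g: "g \<in> carrier G" and "e \<in> forest_inner_edges T"
  then obtain V where V: "V \<in> comps T" "e \<in> inner_edges V" unfolding forest_inner_edges_def by blast
  obtain V' where V': "V' \<in> comps T" "carries g V V'" using act_comp[OF V(1) g] by blast
  then show "gact T g e \<in> forest_inner_edges T"
    using act_inner_edges[OF g V(1) V'] V(2) unfolding forest_inner_edges_def by blast
qed

text \<open>
  The interior of a face outside the Segal core has at least two elements, so that
  \<open>\<epsilon> Q\<close>, the interior without its least element, is not empty.
\<close>

lemma segal_core_to_horn:
  fixes K :: "('u cell, 'g) arrow set"
  assumes K: "saturated G K" and small: "\<And>S E. horn_datum G S E \<Longrightarrow> smaller S T \<Longrightarrow> horn_arrow S E \<in> K"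
    and ne: "forest_inner_edges T \<noteq> {}"
  shows "(segal_core T, trans_id, inner_horn T (forest_inner_edges T)) \<in> K"
proof -
  let ?E = "forest_inner_edges T"
  define fbelow where "fbelow t s \<longleftrightarrow> (\<exists>V\<in>comps T. below V t s)" for t s
  define \<epsilon> where "\<epsilon> Q = {s \<in> Q. \<exists>t\<in>Q. t \<noteq> s \<and> fbelow t s}" for Q
  have fb: "fbelow t s \<longleftrightarrow> below V t s" if "V \<in> comps T" "s \<in> edges V" for V t s
  proof
    assume "fbelow t s"
    then obtain V' where V': "V' \<in> comps T" "below V' t s" unfolding fbelow_def by blast
    have "V' = V" by (rule comps_eq[OF V'(1) that(1) below_edges(2)[OF V'(2)] that(2)])
    then show "below V t s" using V' by simp
  qed (use that in \<open>auto simp: fbelow_def\<close>)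
  have "(face_sub T (segal_faces T), trans_id, inner_horn T ?E) \<in> K"
  proof (rule extension_to_inner_horn[OF K small inner_edges_stable subset_refl sieve_segal, where \<epsilon> = \<epsilon>])
    show "segal_faces T \<subseteq> horn_faces T ?E"
    proof
      fix F assume F: "F \<in> segal_faces T"
      then obtain u where u: "F \<in> faces T" "snd F \<subseteq> {u}" by (auto simp: segal_faces_def)
      have "\<not> face_le (face_without V ?E) F" if V: "V \<in> comps T" for V
      proof
        assume "face_le (face_without V ?E) F"
        then have "edges V - leaves V \<subseteq> {u}" using u(2) unfolding face_le_def face_without_def by auto
        moreover obtain e where "e \<in> inner_edges V" using stable_edge[OF ne inner_edges_stable subset_refl V] by blast
        moreover have "root V \<in> edges V - leaves V" using root_nonleaf[OF ne inner_edges_stable subset_refl V] by simp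
        ultimately show False unfolding inner_edges_def by blast
      qed
      then show "F \<in> horn_faces T ?E" using u(1) unfolding horn_faces_def by blast
    qed
    fix P Q assume D: "(P, Q) \<in> horn_faces T ?E - segal_faces T"
    then have F: "(P, Q) \<in> faces T" by (simp add: horn_faces_def)
    then obtain V where V: "V \<in> comps T" "face V (P, Q)" unfolding faces_def by blast
    have nQ: "\<not> Q \<subseteq> {u}" for u using D F by (auto simp: segal_faces_def)
    obtain t where t: "cut V t (P - Q)" "interior V t (P - Q) = Q" "t \<in> P" using faceE[OF V(2)] by blast
    have Qe: "Q \<subseteq> edges V - leaves V" using face_edges[OF V(2)] by blast
    have "Q \<noteq> {}" using nQ by blast
    then have tQ: "t \<in> Q" by (rule face_root_in[OF t])
    have tb: "below V t s" if "s \<in> Q" for s using that t(2) unfolding interior_def by blast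
    have e: "\<epsilon> Q = Q - {t}"
    proof (intro equalityI subsetI)
      fix s assume "s \<in> \<epsilon> Q"
      then obtain u where u: "s \<in> Q" "u \<in> Q" "u \<noteq> s" "fbelow u s" unfolding \<epsilon>_def by blast
      have "below V u s" using fb[OF V(1), of s u] u Qe by blast
      then have "s \<noteq> t" using tb[OF u(2)] u(3) below_antisym by blast
      then show "s \<in> Q - {t}" using u(1) by blast
    next
      fix s assume s: "s \<in> Q - {t}"
      then have "fbelow t s" using tb fbelow_def V(1) by blast
      then show "s \<in> \<epsilon> Q" using s tQ by (auto simp: \<epsilon>_def)
    qed
    show "\<epsilon> Q \<subseteq> Q" "\<epsilon> Q \<noteq> {}" using e nQ by auto
    have f1: "face V (P - \<epsilon> Q, Q)"
    proof -
      have "P - \<epsilon> Q - Q = P - Q" using e by blast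
      then show ?thesis using t e by (intro faceI[of _ t]) auto
    qed
    have f2: "face V (P \<union> \<epsilon> Q, Q)"
    proof -
      have "P \<union> \<epsilon> Q - Q = P - Q" using e by blast
      then show ?thesis using t by (intro faceI[of _ t]) auto
    qed
    have nl: "\<not> face_le (face_without V ?E) (P, Q)" using horn_faces_iff[OF V] D by blast
    show "(P - \<epsilon> Q, Q) \<in> horn_faces T ?E - segal_faces T"
    proof
      have "\<not> face_le (face_without V ?E) (P - \<epsilon> Q, Q)" using nl unfolding face_le_def by auto
      then show "(P - \<epsilon> Q, Q) \<in> horn_faces T ?E" using horn_faces_iff[OF V(1) f1] by blast
      show "(P - \<epsilon> Q, Q) \<notin> segal_faces T" using nQ by (auto simp: segal_faces_def)
    qed
    have "\<not> face_le (face_without V ?E) (P \<union> \<epsilon> Q, Q)"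
    proof
      assume "face_le (face_without V ?E) (P \<union> \<epsilon> Q, Q)"
      then have le: "edges V - ?E \<inter> inner_edges V \<subseteq> P \<union> \<epsilon> Q" "edges V - leaves V \<subseteq> Q"
        by (auto simp: face_le_def face_without_def)
      have "root V \<in> Q" using le(2) root_nonleaf[OF ne inner_edges_stable subset_refl V(1)] by auto
      then have tr: "t = root V" using tb below_antisym below_root below_edges(1) by blast
      have "\<epsilon> Q \<subseteq> ?E \<inter> inner_edges V" using e Qe tr V(1) unfolding inner_edges_def forest_inner_edges_def by blast
      then have "face_le (face_without V ?E) (P, Q)" using le unfolding face_le_def face_without_def by auto
      then show False using nl by blast
    qed
    then show "(P \<union> \<epsilon> Q, Q) \<in> horn_faces T ?E" using horn_faces_iff[OF V(1) f2] by blast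
    show "\<epsilon> (gact T g ` Q) = gact T g ` \<epsilon> Q" if g: "g \<in> carrier G" for g
    proof -
      obtain V' where V': "V' \<in> comps T" "carries g V V'" using act_comp[OF V(1) g] by blast
      have b: "fbelow (gact T g u) (gact T g s) \<longleftrightarrow> fbelow u s" if "u \<in> Q" "s \<in> Q" for u s
      proof -
        have us: "u \<in> edges V" "s \<in> edges V" using that Qe by auto
        show ?thesis
          using fb[OF V'(1) act_edge[OF g V(1) us(2) V'(2)]] fb[OF V(1) us(2)] act_below_iff[OF g V(1) V' us] by simp
      qed
      have i: "gact T g u = gact T g s \<longleftrightarrow> u = s" if "u \<in> Q" "s \<in> Q" for u s
        using inj_onD[OF act_inj_tree[OF g V(1) V'], of u s] that Qe by auto
      have "gact T g s \<in> \<epsilon> (gact T g ` Q) \<longleftrightarrow> s \<in> \<epsilon> Q" if s: "s \<in> Q" for s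
      proof -
        have "(\<exists>u\<in>Q. gact T g u \<noteq> gact T g s \<and> fbelow (gact T g u) (gact T g s)) \<longleftrightarrow> (\<exists>u\<in>Q. u \<noteq> s \<and> fbelow u s)"
          by (rule bex_cong[OF refl]) (simp add: b[OF _ s] i[OF _ s])
        then show ?thesis using s by (simp add: \<epsilon>_def)
      qed
      moreover have "\<epsilon> (gact T g ` Q) \<subseteq> gact T g ` Q" "\<epsilon> Q \<subseteq> Q" unfolding \<epsilon>_def by blast+
      ultimately show ?thesis by blast
    qed
  qed
  then show ?thesis by (simp add: segal_core_face_sub)
qed

lemma segal_core_no_inner_edges:
  assumes "forest_inner_edges T = {}" shows "segal_core T = representable T"
proof -
  have "faces T \<subseteq> segal_faces T"
  proof
    fix F assume F: "F \<in> faces T"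
    then obtain V where V: "V \<in> comps T" "face V F" unfolding faces_def by blast
    have "snd F \<subseteq> edges V - leaves V" using face_edges[of V "fst F" "snd F"] V(2) by simp
    moreover have "inner_edges V = {}" using assms V(1) unfolding forest_inner_edges_def by blast
    ultimately have "snd F \<subseteq> {root V}" unfolding inner_edges_def by blast
    then show "F \<in> segal_faces T" using F unfolding segal_faces_def by blast
  qed
  then have "segal_faces T = faces T" by (auto simp: segal_faces_def)
  then show ?thesis by (simp add: segal_core_face_sub representable_face_sub)
qed

lemma edge_orbit_props:
  assumes e: "e \<in> E" and E: "G_stable G T E" "E \<subseteq> forest_edges T"
  shows "e \<in> edge_orbit G T e" "edge_orbit G T e \<subseteq> E" "G_stable G T (edge_orbit G T e)"
proof -
  have ee: "e \<in> forest_edges T" using e E by blast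
  show "e \<in> edge_orbit G T e"
    unfolding edge_orbit_def using act_one[OF ee] by (intro CollectI exI[of _ "\<one>"]) simp
  show "edge_orbit G T e \<subseteq> E" using e E unfolding edge_orbit_def G_stable_def by blast
  show "G_stable G T (edge_orbit G T e)"
    unfolding G_stable_def
  proof (intro ballI image_subsetI)
    fix g a assume g: "g \<in> carrier G" and "a \<in> edge_orbit G T e"
    then obtain h where h: "h \<in> carrier G" "a = gact T h e" unfolding edge_orbit_def by blast
    then have "gact T g a = gact T (g \<otimes> h) e" using act_mult[OF g h(1) ee] by simp
    then show "gact T g a \<in> edge_orbit G T e" using g h(1) unfolding edge_orbit_def by blast
  qed
qed

end

lemma horn_induction:
  fixes K :: "('u cell, 'g) arrow set"
  assumes step: "\<And>T E. horn_datum G T E \<Longrightarrow> (\<And>S E. horn_datum G S E \<Longrightarrow> smaller S T \<Longrightarrow> horn_arrow S E \<in> K) \<Longrightarrow>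
      horn_arrow T E \<in> K"
  shows "horn_datum G T E \<Longrightarrow> horn_arrow T E \<in> K"
proof -
  have "\<forall>T E. (\<forall>V\<in>comps T. tree_size V < n) \<longrightarrow> horn_datum G T E \<longrightarrow> horn_arrow T E \<in> K" for n
  proof (induction n)
    case 0
    then show ?case by (auto simp: horn_datum_def G_tree_def)
  next
    case (Suc n)
    show ?case
    proof (intro allI impI)
      fix T E assume T: "\<forall>V\<in>comps T. tree_size V < Suc n" "horn_datum G T E"
      show "horn_arrow T E \<in> K"
      proof (rule step[OF T(2)])
        fix S E' assume "horn_datum G S E'" "smaller S T"
        moreover have "\<forall>U\<in>comps S. tree_size U < n" using \<open>smaller S T\<close> T(1) unfolding smaller_def by fastforce
        ultimately show "horn_arrow S E' \<in> K" using Suc by blast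
      qed
    qed
  qed
  moreover assume h: "horn_datum G T E"
  moreover have "\<exists>n. \<forall>V\<in>comps T. tree_size V < n"
  proof -
    have "finite (tree_size ` comps T)" using h by (simp add: horn_datum_def G_tree_def)
    then obtain n where "\<forall>m\<in>tree_size ` comps T. m < n" using finite_nat_set_iff_bounded by blast
    then show ?thesis by blast
  qed
  ultimately show "horn_arrow T E \<in> K" by blast
qed

lemma inner_horn_inclusions_horn_arrows: "inner_horn_inclusions G = {horn_arrow T E | T E. horn_datum G T E}"
  unfolding inner_horn_inclusions_def horn_arrow_def horn_datum_def by blast

lemma hypersaturated_cancel:
  assumes K: "hypersaturated G K" and "(A, trans_id, B) \<in> K" "(A, trans_id, C) \<in> K"
    and "(B, trans_id, C) \<in> normal_monos G"
  shows "(B, trans_id, C) \<in> K"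
proof -
  have n: "(A, trans_id, B) \<in> normal_monos G" using assms(1,2) unfolding hypersaturated_def by blast
  have "(A, trans_comp trans_id trans_id, C) \<in> K" using assms(3) by simp
  then show ?thesis using assms(2,4) n K unfolding hypersaturated_def by blast
qed

text \<open>
  It suffices to compare the hypersaturated classes that contain the two sets.
\<close>

lemma hypersaturation_eqI:
  assumes "\<And>K. hypersaturated G K \<Longrightarrow> S \<subseteq> K \<longleftrightarrow> S' \<subseteq> K"
  shows "hypersaturation G S = hypersaturation G S'"
proof -
  have "{K. hypersaturated G K \<and> S \<subseteq> K} = {K. hypersaturated G K \<and> S' \<subseteq> K}" using assms by blast
  then show ?thesis by (simp add: hypersaturation_def)
qed

context
  fixes G :: "('g, 'b) monoid_scheme" and K :: "('u cell, 'g) arrow set"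
  assumes G: "group G" and K: "hypersaturated G K"
begin

lemma saturated_K: "saturated G K"
  using K by (simp add: hypersaturated_def)

lemma G_forestI: "G_tree G T \<Longrightarrow> G_forest G T"
  using G by (simp add: G_forest_def G_forest_axioms_def)

lemma generating_iff_inner: "generating_inner_horn_inclusions G \<subseteq> K \<longleftrightarrow> inner_horn_inclusions G \<subseteq> K"
proof
  assume gen: "generating_inner_horn_inclusions G \<subseteq> K"
  have "horn_arrow T E \<in> K" if "horn_datum G T E" for T E
  proof (rule horn_induction[OF _ that])
    fix T E assume d: "horn_datum G T E" and small: "\<And>S E. horn_datum G S E \<Longrightarrow> smaller S T \<Longrightarrow> horn_arrow S E \<in> K"
    then have T: "G_tree G T" "E \<noteq> {}" "E \<subseteq> forest_inner_edges T" "G_stable G T E" by (auto simp: horn_datum_def)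
    interpret G_forest G T by (rule G_forestI[OF T(1)])
    have Ee: "E \<subseteq> forest_edges T" using T(3) forest_inner_edges_subset by blast
    obtain e where e: "e \<in> E" using T(2) by blast
    note o = edge_orbit_props[OF e T(4) Ee]
    have "(inner_horn T E, trans_id, inner_horn T (edge_orbit G T e)) \<in> K"
      by (rule horn_to_horn[OF _ o(3) _ saturated_K small T(4,3) o(2)]) (use o T(3) in auto)
    moreover have "(inner_horn T (edge_orbit G T e), trans_id, representable T) \<in> K"
      using gen e T unfolding generating_inner_horn_inclusions_def by blast
    ultimately have "(inner_horn T E, trans_comp trans_id trans_id, representable T) \<in> K" by (rule saturated_comp[OF saturated_K])
    then show "horn_arrow T E \<in> K" by (simp add: horn_arrow_def)
  qed
  then show "inner_horn_inclusions G \<subseteq> K" unfolding inner_horn_inclusions_horn_arrows by blast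
next
  assume inn: "inner_horn_inclusions G \<subseteq> K"
  show "generating_inner_horn_inclusions G \<subseteq> K"
    unfolding generating_inner_horn_inclusions_def
  proof (rule subset_trans[OF _ inn], safe)
    fix T e assume T: "G_tree G T" "e \<in> forest_inner_edges T"
    interpret G_forest G T by (rule G_forestI[OF T(1)])
    note o = edge_orbit_props[OF T(2) inner_edges_stable forest_inner_edges_subset]
    show "(inner_horn T (edge_orbit G T e), trans_id, representable T) \<in> inner_horn_inclusions G"
      using T o unfolding inner_horn_inclusions_def by blast
  qed
qed

text \<open>
  Cancelling \<open>X \<rightarrow> \<Lambda>\<^sup>E[T]\<close> from \<open>X \<rightarrow> \<Omega>[T]\<close> leaves \<open>\<Lambda>\<^sup>E[T] \<rightarrow> \<Omega>[T]\<close>; the horns of smaller \<open>G\<close>-trees, which go into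
  the construction of the former, are available by induction.
\<close>

lemma inner_horns_by_cancellation:
  assumes X: "\<And>T E. horn_datum G T E \<Longrightarrow> (\<And>S E. horn_datum G S E \<Longrightarrow> smaller S T \<Longrightarrow> horn_arrow S E \<in> K) \<Longrightarrow>
      \<exists>X. (X, trans_id, inner_horn T E) \<in> K \<and> (X, trans_id, representable T) \<in> K"
  shows "inner_horn_inclusions G \<subseteq> K"
proof -
  have "horn_arrow T E \<in> K" if "horn_datum G T E" for T E
  proof (rule horn_induction[OF _ that])
    fix T E assume d: "horn_datum G T E" and small: "\<And>S E. horn_datum G S E \<Longrightarrow> smaller S T \<Longrightarrow> horn_arrow S E \<in> K"
    interpret G_forest G T by (rule G_forestI) (use d in \<open>simp add: horn_datum_def\<close>)
    obtain X where "(X, trans_id, inner_horn T E) \<in> K" "(X, trans_id, representable T) \<in> K" using X[OF d small] by blast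
    then show "horn_arrow T E \<in> K"
      using hypersaturated_cancel[OF K] inner_horn_normal[of E] d unfolding horn_arrow_def horn_datum_def by blast
  qed
  then show ?thesis unfolding inner_horn_inclusions_horn_arrows by blast
qed

lemma inner_iff_orbital: "inner_horn_inclusions G \<subseteq> K \<longleftrightarrow> orbital_inner_horn_inclusions G \<subseteq> K"
proof
  assume inn: "inner_horn_inclusions G \<subseteq> K"
  then have small: "horn_arrow S E \<in> K" if "horn_datum G S E" for S E
    using that unfolding inner_horn_inclusions_horn_arrows by blast
  have "(orbital_inner_horn G T E, trans_id, representable T) \<in> K"
    if T: "G_tree G T" "E \<subseteq> forest_inner_edges T" "G_stable G T E" "E \<noteq> {}" for T E
  proof -
    interpret G_forest G T by (rule G_forestI[OF T(1)])
    have "(orbital_inner_horn G T E, trans_id, inner_horn T E) \<in> K"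
      by (rule orbital_horn_to_horn[OF T(4,3,2) saturated_K small])
    moreover have "(inner_horn T E, trans_id, representable T) \<in> K"
      using small[of T E] T by (simp add: horn_datum_def horn_arrow_def)
    ultimately have "(orbital_inner_horn G T E, trans_comp trans_id trans_id, representable T) \<in> K"
      by (rule saturated_comp[OF saturated_K])
    then show "(orbital_inner_horn G T E, trans_id, representable T) \<in> K" by simp
  qed
  then show "orbital_inner_horn_inclusions G \<subseteq> K" unfolding orbital_inner_horn_inclusions_def by blast
next
  assume orb: "orbital_inner_horn_inclusions G \<subseteq> K"
  show "inner_horn_inclusions G \<subseteq> K"
  proof (rule inner_horns_by_cancellation)
    fix T E assume d: "horn_datum G T E" and small: "\<And>S E. horn_datum G S E \<Longrightarrow> smaller S T \<Longrightarrow> horn_arrow S E \<in> K"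
    then have T: "G_tree G T" "E \<noteq> {}" "E \<subseteq> forest_inner_edges T" "G_stable G T E" by (auto simp: horn_datum_def)
    interpret G_forest G T by (rule G_forestI[OF T(1)])
    have "(orbital_inner_horn G T E, trans_id, inner_horn T E) \<in> K"
      by (rule orbital_horn_to_horn[OF T(2,4,3) saturated_K small])
    moreover have "(orbital_inner_horn G T E, trans_id, representable T) \<in> K"
      using orb T unfolding orbital_inner_horn_inclusions_def by blast
    ultimately show "\<exists>X. (X, trans_id, inner_horn T E) \<in> K \<and> (X, trans_id, representable T) \<in> K" by blast
  qed
qed

lemma inner_iff_segal: "inner_horn_inclusions G \<subseteq> K \<longleftrightarrow> segal_core_inclusions G \<subseteq> K"
proof
  assume inn: "inner_horn_inclusions G \<subseteq> K"
  then have small: "horn_arrow S E \<in> K" if "horn_datum G S E" for S E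
    using that unfolding inner_horn_inclusions_horn_arrows by blast
  show "segal_core_inclusions G \<subseteq> K"
    unfolding segal_core_inclusions_def
  proof safe
    fix T assume T: "G_tree G T"
    interpret G_forest G T by (rule G_forestI[OF T])
    show "(segal_core T, trans_id, representable T) \<in> K"
    proof (cases "forest_inner_edges T = {}")
      case True
      then show ?thesis
        using saturated_id[OF saturated_K is_gdset_face_sub[OF sieve_faces]]
        by (simp add: segal_core_no_inner_edges representable_face_sub)
    next
      case False
      have "(segal_core T, trans_id, inner_horn T (forest_inner_edges T)) \<in> K"
        by (rule segal_core_to_horn[OF saturated_K small False])
      moreover have "(inner_horn T (forest_inner_edges T), trans_id, representable T) \<in> K"
        using small[of T "forest_inner_edges T"] T False inner_edges_stable by (simp add: horn_datum_def horn_arrow_def)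
      ultimately have "(segal_core T, trans_comp trans_id trans_id, representable T) \<in> K"
        by (rule saturated_comp[OF saturated_K])
      then show ?thesis by simp
    qed
  qed
next
  assume seg: "segal_core_inclusions G \<subseteq> K"
  show "inner_horn_inclusions G \<subseteq> K"
  proof (rule inner_horns_by_cancellation)
    fix T E assume d: "horn_datum G T E" and small: "\<And>S E. horn_datum G S E \<Longrightarrow> smaller S T \<Longrightarrow> horn_arrow S E \<in> K"
    then have T: "G_tree G T" "E \<noteq> {}" "E \<subseteq> forest_inner_edges T" "G_stable G T E" by (auto simp: horn_datum_def)
    interpret G_forest G T by (rule G_forestI[OF T(1)])
    have "(segal_core T, trans_id, inner_horn T (forest_inner_edges T)) \<in> K"
      by (rule segal_core_to_horn[OF saturated_K small]) (use T in auto)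
    moreover have "(inner_horn T (forest_inner_edges T), trans_id, inner_horn T E) \<in> K"
      by (rule horn_to_horn[OF T(2,4,3) saturated_K small inner_edges_stable subset_refl T(3)])
    ultimately have "(segal_core T, trans_comp trans_id trans_id, inner_horn T E) \<in> K"
      by (rule saturated_comp[OF saturated_K])
    moreover have "(segal_core T, trans_id, representable T) \<in> K"
      using seg T(1) unfolding segal_core_inclusions_def by blast
    ultimately show "\<exists>X. (X, trans_id, inner_horn T E) \<in> K \<and> (X, trans_id, representable T) \<in> K" by auto
  qed
qed

end

theorem proposition3p22:
  fixes G :: "('g, 'b) monoid_scheme"
  assumes "group G" and "finite (carrier G)"
  shows "hypersaturation G (generating_inner_horn_inclusions G :: ('u cell, 'g) arrow set)
           = hypersaturation G (inner_horn_inclusions G)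
       \<and> hypersaturation G (inner_horn_inclusions G :: ('u cell, 'g) arrow set)
           = hypersaturation G (orbital_inner_horn_inclusions G)
       \<and> hypersaturation G (orbital_inner_horn_inclusions G :: ('u cell, 'g) arrow set)
           = hypersaturation G (segal_core_inclusions G)"
proof (intro conjI hypersaturation_eqI)
  fix K :: "('u cell, 'g) arrow set" assume K: "hypersaturated G K"
  note iffs = generating_iff_inner[OF assms(1) K] inner_iff_orbital[OF assms(1) K] inner_iff_segal[OF assms(1) K]
  show "generating_inner_horn_inclusions G \<subseteq> K \<longleftrightarrow> inner_horn_inclusions G \<subseteq> K" by (rule iffs)
  show "inner_horn_inclusions G \<subseteq> K \<longleftrightarrow> orbital_inner_horn_inclusions G \<subseteq> K" by (rule iffs)
  show "orbital_inner_horn_inclusions G \<subseteq> K \<longleftrightarrow> segal_core_inclusions G \<subseteq> K" using iffs by blast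
qed

end
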